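(* Let $n\ge2$. There exists a vector field $b\in L^\infty\cap C^\infty(\mathbb{R}^n)$ such that the operator $\mathcal{L}=\Delta+b\cdot\nabla$ satisfies, for each $R\ge1$, $$0\le\lambda_1(-\mathcal{L},\mathbb{R}^n)\le\lambda_1(-\mathcal{L},B_R)\le C R^{-2}e^{-C_0M_0R}$$ and $C_1\le M_0\le C_2$, where $M_0:=\|b\|_{L^\infty(B_R)}$ and $C,C_0,C_1,C_2>0$ depend only on $n$.
   Context: $B_R=\{x\in\mathbb{R}^n:|x|<R\}$. $\lambda_1(-\mathcal{L},B_R)$ denotes the first (principal) Dirichlet eigenvalue of $-\mathcal{L}$ in $B_R$: the real, simple eigenvalue with smallest real part, characterized by the existence of a positive eigenfunction $\varphi_1\in H^1_0(B_R)$ with $-\mathcal{L}\varphi_1=\lambda_1\varphi_1$. Moreover $\lambda_1(-\mathcal{L},\mathbb{R}^n):=\lim_{R\to\infty}\lambda_1(-\mathcal{L},B_R)\in[-\infty,\infty)$. *)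

theory Defs
  imports "HOL-Analysis.Analysis" "HOL-Probability.Essential_Supremum"
begin

text \<open>
  Spectral theory of the (non-self-adjoint) operator \<open>L = \<Delta> + b \<cdot> \<nabla>\<close> with Dirichlet
  conditions requires complex scalars, so Sobolev functions and test functions are complex valued.
  Products such as \<open>g \<cdot> \<nabla>\<psi>\<close> are bilinear, without conjugation.
\<close>

primrec Ck :: "nat \<Rightarrow> ('a::euclidean_space \<Rightarrow> 'b::real_normed_vector) \<Rightarrow> bool" where
  "Ck 0 f \<longleftrightarrow> continuous_on UNIV f"
| "Ck (Suc k) f \<longleftrightarrow> (\<forall>x. f differentiable (at x)) \<and>
     (\<forall>v. Ck k (\<lambda>x. frechet_derivative f (at x) v))"

definition smooth :: "('a::euclidean_space \<Rightarrow> 'b::real_normed_vector) \<Rightarrow> bool" where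
  "smooth f \<longleftrightarrow> (\<forall>k. Ck k f)"

definition Linf_norm :: "(real^'n) set \<Rightarrow> (real^'n \<Rightarrow> real^'n) \<Rightarrow> ereal" where
  "Linf_norm U b = esssup (lebesgue_on U) (\<lambda>x. ereal (norm (b x)))"

definition test_fun :: "(real^'n) set \<Rightarrow> (real^'n \<Rightarrow> complex) \<Rightarrow> bool" where
  "test_fun U \<psi> \<longleftrightarrow> smooth \<psi> \<and> compact (closure {x. \<psi> x \<noteq> 0}) \<and> closure {x. \<psi> x \<noteq> 0} \<subseteq> U"

definition grad :: "(real^'n \<Rightarrow> complex) \<Rightarrow> real^'n \<Rightarrow> complex^'n" where
  "grad \<psi> x = (\<chi> i. frechet_derivative \<psi> (at x) (axis i 1))"

definition L2_sq :: "(real^'n) set \<Rightarrow> (real^'n \<Rightarrow> 'b::real_normed_vector) \<Rightarrow> ennreal" where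
  "L2_sq U f = (\<integral>\<^sup>+x. ennreal ((norm (f x))\<^sup>2) \<partial>lebesgue_on U)"

definition L2 :: "(real^'n) set \<Rightarrow> (real^'n \<Rightarrow> 'b::real_normed_vector) \<Rightarrow> bool" where
  "L2 U f \<longleftrightarrow> f \<in> borel_measurable (lebesgue_on U) \<and> L2_sq U f < \<infinity>"

definition weak_gradient :: "(real^'n) set \<Rightarrow> (real^'n \<Rightarrow> complex) \<Rightarrow> (real^'n \<Rightarrow> complex^'n) \<Rightarrow> bool" where
  "weak_gradient U u g \<longleftrightarrow> (\<forall>\<psi> i. test_fun U \<psi> \<longrightarrow>
     (\<integral>x. u x * (grad \<psi> x $ i) \<partial>lebesgue_on U) = - (\<integral>x. (g x $ i) * \<psi> x \<partial>lebesgue_on U))"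

text \<open>
  \<open>H10 U u g\<close>: the function \<open>u\<close> belongs to \<open>H\<^sup>1\<^sub>0(U)\<close>, the closure of the test functions in
  \<open>H\<^sup>1(U)\<close>, and \<open>g\<close> is its weak gradient (unique up to null sets).
\<close>

definition H10 :: "(real^'n) set \<Rightarrow> (real^'n \<Rightarrow> complex) \<Rightarrow> (real^'n \<Rightarrow> complex^'n) \<Rightarrow> bool" where
  "H10 U u g \<longleftrightarrow> L2 U u \<and> L2 U g \<and> weak_gradient U u g \<and>
     (\<exists>\<phi>. (\<forall>k::nat. test_fun U (\<phi> k)) \<and>
        (\<lambda>k. L2_sq U (\<lambda>x. \<phi> k x - u x)) \<longlonglongrightarrow> 0 \<and>
        (\<lambda>k. L2_sq U (\<lambda>x. grad (\<phi> k) x - g x)) \<longlonglongrightarrow> 0)"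

text \<open>\<open>u \<in> H\<^sup>1\<^sub>0(U)\<close> solves \<open>- \<Delta> u - b \<cdot> \<nabla>u = f\<close> in \<open>U\<close> in the weak sense.\<close>

definition dirichlet_sol ::
    "(real^'n \<Rightarrow> real^'n) \<Rightarrow> (real^'n) set \<Rightarrow> (real^'n \<Rightarrow> complex) \<Rightarrow> (real^'n \<Rightarrow> complex) \<Rightarrow> bool" where
  "dirichlet_sol b U u f \<longleftrightarrow> (\<exists>g. H10 U u g \<and> (\<forall>\<psi>. test_fun U \<psi> \<longrightarrow>
     (\<integral>x. (\<Sum>i\<in>UNIV. (g x $ i) * (grad \<psi> x $ i))
          - (\<Sum>i\<in>UNIV. of_real (b x $ i) * (g x $ i)) * \<psi> x \<partial>lebesgue_on U)
     = (\<integral>x. f x * \<psi> x \<partial>lebesgue_on U)))"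

definition eigenfunction ::
    "(real^'n \<Rightarrow> real^'n) \<Rightarrow> (real^'n) set \<Rightarrow> complex \<Rightarrow> (real^'n \<Rightarrow> complex) \<Rightarrow> bool" where
  "eigenfunction b U \<mu> u \<longleftrightarrow> dirichlet_sol b U u (\<lambda>x. \<mu> * u x) \<and>
     \<not> (AE x in lebesgue_on U. u x = 0)"

definition eigenvalue :: "(real^'n \<Rightarrow> real^'n) \<Rightarrow> (real^'n) set \<Rightarrow> complex \<Rightarrow> bool" where
  "eigenvalue b U \<mu> \<longleftrightarrow> (\<exists>u. eigenfunction b U \<mu> u)"

text \<open>
  Simplicity is algebraic: the kernel of \<open>(- L - \<mu>)\<^sup>2\<close> (hence the whole generalized eigenspace)
  is spanned by one eigenfunction \<open>\<phi>\<close>. The case \<open>v = 0\<close> gives geometric simplicity.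
\<close>

definition simple_eigenvalue :: "(real^'n \<Rightarrow> real^'n) \<Rightarrow> (real^'n) set \<Rightarrow> complex \<Rightarrow> bool" where
  "simple_eigenvalue b U \<mu> \<longleftrightarrow> (\<exists>\<phi>. eigenfunction b U \<mu> \<phi> \<and>
     (\<forall>v w. dirichlet_sol b U v (\<lambda>x. \<mu> * v x) \<and> dirichlet_sol b U w (\<lambda>x. \<mu> * w x + v x) \<longrightarrow>
        (\<exists>c. AE x in lebesgue_on U. w x = c * \<phi> x)))"

definition principal_eigenvalue :: "(real^'n \<Rightarrow> real^'n) \<Rightarrow> (real^'n) set \<Rightarrow> real \<Rightarrow> bool" where
  "principal_eigenvalue b U l \<longleftrightarrow>
     simple_eigenvalue b U (of_real l) \<and>
     (\<forall>\<mu>. eigenvalue b U \<mu> \<longrightarrow> l \<le> Re \<mu>) \<and>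
     (\<exists>\<phi>::real^'n \<Rightarrow> real. (\<forall>x\<in>U. 0 < \<phi> x) \<and>
        eigenfunction b U (of_real l) (\<lambda>x. of_real (\<phi> x)))"

lemma principal_eigenvalue_unique:
  assumes "principal_eigenvalue b U l" "principal_eigenvalue b U m"
  shows "l = m"
proof (rule order_antisym)
  have ev: "eigenvalue b U (of_real l)" "eigenvalue b U (of_real m)"
    using assms by (meson principal_eigenvalue_def eigenvalue_def)+
  show "l \<le> m"
    using assms(1) ev(2) unfolding principal_eigenvalue_def by (metis Re_complex_of_real)
  show "m \<le> l"
    using assms(2) ev(1) unfolding principal_eigenvalue_def by (metis Re_complex_of_real)
qed

definition lambda1 :: "(real^'n \<Rightarrow> real^'n) \<Rightarrow> (real^'n) set \<Rightarrow> real" where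
  "lambda1 b U = (THE l. principal_eigenvalue b U l)"

lemma lambda1_eqI: "principal_eigenvalue b U l \<Longrightarrow> lambda1 b U = l"
  unfolding lambda1_def by (rule the_equality) (auto intro: principal_eigenvalue_unique)

definition lambda1_space :: "(real^'n \<Rightarrow> real^'n) \<Rightarrow> ereal" where
  "lambda1_space b = Lim at_top (\<lambda>R::real. ereal (lambda1 b (ball 0 R)))"

end

theory Submission
  imports Defs
begin

text \<open>
  The drift is the gradient \<open>b = \<nabla>V\<close> of \<open>V x = - sqrt (1 + \<bar>x\<bar>\<^sup>2)\<close>. It is smooth, it points
  inward, and its length increases from \<open>0\<close> to \<open>1\<close> as \<open>\<bar>x\<bar>\<close> grows. With \<open>W = exp V\<close> the
  operator is \<open>W\<^sup>-\<^sup>1 div (W \<nabla>u)\<close>, hence symmetric for the measure \<open>W dx\<close>; most of that measure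
  sits near the origin. A diffusion with this drift needs an exponentially long time to reach the
  sphere of radius \<open>R\<close>, which is why the principal eigenvalue is exponentially small.

  A radial eigenfunction \<open>f \<bar>x\<bar>\<close> solves \<open>(r\<^sup>n\<^sup>-\<^sup>1 W f')' = - l r\<^sup>n\<^sup>-\<^sup>1 W f\<close>. Integrated
  twice, this is a Volterra equation, and its Neumann series gives a solution \<open>sol n l\<close> that is
  jointly continuous in \<open>r\<close> and \<open>l\<close>. The flux \<open>- r\<^sup>n\<^sup>-\<^sup>1 W f'\<close> is at least \<open>l\<close> times the mass
  collected near the origin. Dividing by the weight, which is below \<open>exp (- R / 2)\<close> on
  \<open>[R / 2, R]\<close>, shows that \<open>f\<close> can stay positive up to \<open>R\<close> only if
  \<open>l \<le> C R\<^sup>n\<^sup>-\<^sup>2 exp (- R / 2)\<close> (\<open>positive_sol_imp_bound\<close>). A shooting argument produces the \<open>l\<close> for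
  which the first zero of \<open>f\<close> is exactly \<open>R\<close> (\<open>radial_eigenvalue_exists\<close>).

  It remains to see that this \<open>l\<close> is the principal eigenvalue among all complex ones, and simple.
  The radial function \<open>u\<close> lies in \<open>H\<^sup>1\<^sub>0\<close> and is a weak eigenfunction (\<open>ground_state_H10\<close>,
  \<open>ground_state_dirichlet_sol\<close>). For a test function \<open>\<psi>\<close>, the ground state representation
  \<open>\<integral>W \<bar>\<nabla>\<psi>\<bar>\<^sup>2 - l \<integral>W \<bar>\<psi>\<bar>\<^sup>2 = \<integral>W \<bar>u \<nabla>(\<psi> / u)\<bar>\<^sup>2\<close> (\<open>ground_state_representation\<close>)
  shows that the quadratic form is bounded below by \<open>l\<close>; applied to test functions that approximate
  an eigenfunction \<open>v\<close> for \<open>\<mu>\<close> it yields \<open>(\<mu> - l) \<integral>W\<bar>v\<bar>\<^sup>2 \<ge> 0\<close> (\<open>eigenvalue_Re_ge\<close>). Its right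
  hand side also controls the \<open>L\<^sup>2\<close> distance of \<open>\<psi>\<close> from the line spanned by \<open>u\<close>
  (\<open>spectral_gap\<close>), so the eigenspace of \<open>l\<close> is this line (\<open>eigenspace_spanned\<close>). If
  \<open>(- L - l) w = v\<close> with \<open>v = c u\<close>, then symmetry makes \<open>v\<close> orthogonal to \<open>u\<close>, so \<open>c = 0\<close>, and the
  eigenvalue is algebraically simple (\<open>principal_eigenvalue_ground_state\<close>).

  The eigenvalues of the balls are thus positive and tend to \<open>0\<close>, so that the eigenvalue of the
  whole space is \<open>0\<close>.
\<close>

section \<open>Calculus of smooth functions\<close>

lemma Ck_SucI:
  assumes "\<And>x. (f has_derivative f' x) (at x)" and "\<And>v. Ck k (\<lambda>x. f' x v)"
  shows "Ck (Suc k) f"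
proof -
  have "frechet_derivative f (at x) = f' x" for x
    using frechet_derivative_at[OF assms(1)] by simp
  then show ?thesis
    using assms by (auto simp: differentiable_def)
qed

lemma Ck_SucD:
  assumes "Ck (Suc k) f"
  shows "(f has_derivative frechet_derivative f (at x)) (at x)"
    and "Ck k (\<lambda>x. frechet_derivative f (at x) v)"
  using assms frechet_derivative_works by auto

lemma Ck_Suc_imp_Ck: "Ck (Suc k) f \<Longrightarrow> Ck k f"
proof (induction k arbitrary: f)
  case 0
  then show ?case
    by (auto intro!: continuous_at_imp_continuous_on differentiable_imp_continuous_within)
next
  case (Suc k)
  have "\<forall>v. Ck k (\<lambda>x. frechet_derivative f (at x) v)"
    using Suc.IH Suc.prems by auto
  with Suc.prems show ?case by simp
qed

lemma Ck_const: "Ck k (\<lambda>x. c)"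
proof (induction k arbitrary: c)
  case (Suc k)
  show ?case by (rule Ck_SucI[where f' = "\<lambda>x v. 0"]) (auto intro: Suc.IH)
qed simp

lemma Ck_bounded_linear_comp:
  assumes L: "bounded_linear L"
  shows "Ck k f \<Longrightarrow> Ck k (\<lambda>x. L (f x))"
proof (induction k arbitrary: f)
  case 0
  then show ?case
    using L by (auto intro: bounded_linear.continuous_on)
next
  case (Suc k)
  show ?case
  proof (rule Ck_SucI)
    show "((\<lambda>x. L (f x)) has_derivative (\<lambda>v. L (frechet_derivative f (at x) v))) (at x)" for x
      by (rule bounded_linear.has_derivative[OF L Ck_SucD(1)[OF Suc.prems]])
    show "Ck k (\<lambda>x. L (frechet_derivative f (at x) v))" for v
      by (rule Suc.IH[OF Ck_SucD(2)[OF Suc.prems]])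
  qed
qed

lemma Ck_add: "Ck k f \<Longrightarrow> Ck k g \<Longrightarrow> Ck k (\<lambda>x. f x + g x)"
proof (induction k arbitrary: f g)
  case 0
  then show ?case by (auto intro: continuous_intros)
next
  case (Suc k)
  show ?case
  proof (rule Ck_SucI)
    show "((\<lambda>x. f x + g x) has_derivative
        (\<lambda>v. frechet_derivative f (at x) v + frechet_derivative g (at x) v)) (at x)" for x
      by (intro has_derivative_add Ck_SucD(1)[OF Suc.prems(1)] Ck_SucD(1)[OF Suc.prems(2)])
    show "Ck k (\<lambda>x. frechet_derivative f (at x) v + frechet_derivative g (at x) v)" for v
      by (intro Suc.IH Ck_SucD(2)[OF Suc.prems(1)] Ck_SucD(2)[OF Suc.prems(2)])
  qed
qed

lemma Ck_bounded_bilinear: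
  assumes B: "bounded_bilinear B"
  shows "Ck k f \<Longrightarrow> Ck k g \<Longrightarrow> Ck k (\<lambda>x. B (f x) (g x))"
proof (induction k arbitrary: f g)
  case 0
  then show ?case
    using B by (auto intro: bounded_bilinear.continuous_on)
next
  case (Suc k)
  show ?case
  proof (rule Ck_SucI)
    show "((\<lambda>x. B (f x) (g x)) has_derivative
        (\<lambda>v. B (f x) (frechet_derivative g (at x) v) + B (frechet_derivative f (at x) v) (g x))) (at x)" for x
      by (intro bounded_bilinear.FDERIV[OF B] Ck_SucD(1)[OF Suc.prems(1)] Ck_SucD(1)[OF Suc.prems(2)])
    show "Ck k (\<lambda>x. B (f x) (frechet_derivative g (at x) v) + B (frechet_derivative f (at x) v) (g x))" for v
      by (intro Ck_add Suc.IH Ck_SucD(2)[OF Suc.prems(1)] Ck_SucD(2)[OF Suc.prems(2)]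
          Ck_Suc_imp_Ck[OF Suc.prems(1)] Ck_Suc_imp_Ck[OF Suc.prems(2)])
  qed
qed

lemmas Ck_mult = Ck_bounded_bilinear[OF bounded_bilinear_mult]
lemmas Ck_scaleR = Ck_bounded_bilinear[OF bounded_bilinear_scaleR]

lemma Ck_id: "Ck k (\<lambda>x. x)"
proof (cases k)
  case (Suc m)
  show ?thesis unfolding Suc
    by (rule Ck_SucI[where f' = "\<lambda>x v. v"]) (auto intro: Ck_const)
qed (simp add: continuous_on_id)

lemma Ck_inner: "Ck k f \<Longrightarrow> Ck k g \<Longrightarrow> Ck k (\<lambda>x. f x \<bullet> g x)"
  by (rule Ck_bounded_bilinear[OF bounded_bilinear_inner])

lemma Ck_power: "Ck k f \<Longrightarrow> Ck k (\<lambda>x. f x ^ m)" for f :: "_ \<Rightarrow> real"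
  by (induction m) (auto intro: Ck_const Ck_mult)

lemma Ck_sum: "(\<And>i. i \<in> I \<Longrightarrow> Ck k (f i)) \<Longrightarrow> Ck k (\<lambda>x. \<Sum>i\<in>I. f i x)"
  by (induction I rule: infinite_finite_induct) (auto intro: Ck_const Ck_add)

lemma Ck_comp_real:
  fixes h :: "real \<Rightarrow> real"
  shows "Ck k h \<Longrightarrow> Ck k f \<Longrightarrow> Ck k (\<lambda>x. h (f x))"
proof (induction k arbitrary: h f)
  case 0
  then show ?case by (auto intro: continuous_on_compose2)
next
  case (Suc k)
  let ?h' = "\<lambda>y. frechet_derivative h (at y) 1"
  show ?case
  proof (rule Ck_SucI)
    have "(h has_derivative (\<lambda>v. v * ?h' y)) (at y)" for y
    proof -
      have *: "(h has_derivative frechet_derivative h (at y)) (at y)"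
        by (rule Ck_SucD(1)[OF Suc.prems(1)])
      then have "linear (frechet_derivative h (at y))"
        by (rule has_derivative_linear)
      then have "frechet_derivative h (at y) v = v * ?h' y" for v
        using linear_cmul[of "frechet_derivative h (at y)" v 1] by simp
      then have "frechet_derivative h (at y) = (\<lambda>v. v * ?h' y)" by blast
      with * show ?thesis by simp
    qed
    then show "((\<lambda>x. h (f x)) has_derivative (\<lambda>v. frechet_derivative f (at x) v * ?h' (f x))) (at x)" for x
      using has_derivative_compose[OF Ck_SucD(1)[OF Suc.prems(2)]] by blast
    show "Ck k (\<lambda>x. frechet_derivative f (at x) v * ?h' (f x))" for v
      by (intro Ck_mult Suc.IH[OF Ck_SucD(2)[OF Suc.prems(1)]] Ck_SucD(2)[OF Suc.prems(2)]
          Ck_Suc_imp_Ck[OF Suc.prems(2)])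
  qed
qed

text \<open>
  Bootstrapping: the derivative of such a function is an expression in the function itself and in
  known smooth functions, so that each order of differentiability yields the next one.
\<close>

lemma smooth_bootstrap:
  assumes "\<And>x. (f has_derivative f' x) (at x)" and "\<And>k v. Ck k f \<Longrightarrow> Ck k (\<lambda>x. f' x v)"
  shows "Ck k f"
proof (induction k)
  case 0
  then show ?case
    using has_derivative_continuous[OF assms(1)] by (auto intro!: continuous_at_imp_continuous_on)
next
  case (Suc k)
  show ?case by (rule Ck_SucI[OF assms(1) assms(2)[OF Suc]])
qed

section \<open>The smooth cutoff\<close>

text \<open>
  The functions \<open>y\<^sup>-\<^sup>j exp (- 1 / y)\<close>, continued by zero to \<open>y \<le> 0\<close>, form a family that is closed
  under differentiation, up to linear combinations. This is why each of them is smooth.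
\<close>

definition cutoff :: "nat \<Rightarrow> real \<Rightarrow> real" where
  "cutoff j y = (if 0 < y then (1 / y) ^ j * exp (- (1 / y)) else 0)"

lemma power_le_fact_exp:
  assumes "0 \<le> z" shows "z ^ m \<le> fact m * exp (z :: real)"
proof -
  have "(\<Sum>k\<in>{m}. z ^ k /\<^sub>R fact k) \<le> (\<Sum>k. z ^ k /\<^sub>R fact k)"
    using assms by (intro sum_le_suminf summable_exp_generic) auto
  then have "z ^ m / fact m \<le> exp z"
    by (simp add: exp_def divide_inverse mult.commute)
  then show ?thesis
    by (simp add: pos_divide_le_eq mult.commute)
qed

text \<open>
  The case \<open>m = 2\<close> gives the vanishing derivative at the origin, the case \<open>m = 0\<close> boundedness.
\<close>

lemma cutoff_le_power:
  assumes "0 \<le> y" shows "cutoff j y \<le> fact (j + m) * y ^ m"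
proof (cases "0 < y")
  case True
  let ?z = "1 / y"
  have "?z ^ (j + m) \<le> fact (j + m) * exp ?z"
    using True by (intro power_le_fact_exp) simp
  then have "?z ^ (j + m) / exp ?z \<le> fact (j + m)"
    by (subst pos_divide_le_eq) simp_all
  then have "?z ^ (j + m) * exp (- ?z) \<le> fact (j + m)"
    by (simp only: exp_minus divide_inverse)
  then have "(?z ^ j * exp (- ?z)) * ?z ^ m \<le> fact (j + m)"
    by (simp add: power_add mult_ac)
  then have "(?z ^ j * exp (- ?z)) * (?z ^ m * y ^ m) \<le> fact (j + m) * y ^ m"
    using True by (metis mult.assoc mult_right_mono zero_le_power less_imp_le)
  moreover have "?z ^ m * y ^ m = 1"
    using True by (simp flip: power_mult_distrib)
  ultimately show ?thesis
    using True by (simp add: cutoff_def)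
qed (use assms in \<open>auto simp: cutoff_def\<close>)

lemma cutoff_nonneg: "0 \<le> cutoff j y"
  by (simp add: cutoff_def)

lemma cutoff_le_fact: "cutoff j y \<le> fact j"
  using cutoff_le_power[of y j 0] by (cases "0 \<le> y") (simp, simp add: cutoff_def)

lemma cutoff_deriv:
  "(cutoff j has_real_derivative (cutoff (j + 2) y - real j * cutoff (j + 1) y)) (at y)"
proof -
  consider "y < 0" | "0 < y" | "y = 0" by linarith
  then show ?thesis
  proof cases
    case 1
    have "((\<lambda>y. 0) has_real_derivative 0) (at y)" by simp
    then have "(cutoff j has_real_derivative 0) (at y)"
      by (rule DERIV_cong_ev[THEN iffD1, OF refl eventually_mono[OF eventually_nhds_in_open[of "{..<0}"]] refl, rotated 3])
         (use 1 in \<open>auto simp: cutoff_def\<close>)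
    with 1 show ?thesis by (simp add: cutoff_def)
  next
    case 2
    have "((\<lambda>y. (1 / y) ^ j * exp (- (1 / y))) has_real_derivative
        (cutoff (j + 2) y - real j * cutoff (j + 1) y)) (at y)"
      using 2
    proof (cases j)
      case (Suc m)
      with 2 show ?thesis
        by (auto intro!: derivative_eq_intros simp: cutoff_def power_one_over field_simps power2_eq_square)
           (cases m; simp)
    qed (auto intro!: derivative_eq_intros simp: cutoff_def field_simps power2_eq_square)
    then show ?thesis
      by (rule DERIV_cong_ev[THEN iffD1, OF refl eventually_mono[OF eventually_nhds_in_open[of "{0<..}"]] refl, rotated 3])
         (use 2 in \<open>auto simp: cutoff_def\<close>)
  next
    case 3
    have "((\<lambda>h. (cutoff j (0 + h) - cutoff j 0) / h) \<longlongrightarrow> 0) (at 0)"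
    proof (rule Lim_null_comparison)
      show "\<forall>\<^sub>F h in at 0. norm ((cutoff j (0 + h) - cutoff j 0) / h) \<le> fact (j + 2) * \<bar>h\<bar>"
      proof (rule always_eventually, rule allI)
        fix h :: real
        have *: "\<bar>cutoff j h\<bar> \<le> fact (j + 2) * h ^ 2"
        proof (cases "0 \<le> h")
          case True
          then show ?thesis using cutoff_le_power[of h j 2] cutoff_nonneg[of j h] by simp
        qed (simp add: cutoff_def)
        show "norm ((cutoff j (0 + h) - cutoff j 0) / h) \<le> fact (j + 2) * \<bar>h\<bar>"
        proof (cases "h = 0")
          case False
          have "\<bar>cutoff j h\<bar> / \<bar>h\<bar> \<le> (fact (j + 2) * \<bar>h\<bar> * \<bar>h\<bar>) / \<bar>h\<bar>"
            by (rule divide_right_mono) (use * in \<open>simp_all only: power2_eq_square abs_mult_self_eq mult.assoc abs_ge_zero\<close>)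
          also have "\<dots> = fact (j + 2) * \<bar>h\<bar>" using False by simp
          finally show ?thesis by (simp only: cutoff_def[of j 0] real_norm_def abs_divide) simp
        qed simp
      qed
      show "((\<lambda>h. fact (j + 2) * \<bar>h\<bar>) \<longlongrightarrow> 0) (at (0::real))"
        by (auto intro!: tendsto_eq_intros)
    qed
    with 3 show ?thesis by (simp add: DERIV_def cutoff_def)
  qed
qed

lemma Ck_cutoff: "Ck k (cutoff j)"
proof (induction k arbitrary: j)
  case 0
  show ?case using DERIV_isCont[OF cutoff_deriv] by (auto intro: continuous_at_imp_continuous_on)
next
  case (Suc k)
  show ?case
  proof (rule Ck_SucI)
    show "(cutoff j has_derivative (*) (cutoff (j + 2) y - real j * cutoff (j + 1) y)) (at y)" for y
      using cutoff_deriv by (simp add: has_field_derivative_def)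
    have "Ck k (\<lambda>y. (cutoff (j + 2) y + (- real j) * cutoff (j + 1) y) * v)" for v
      by (intro Ck_add Ck_mult Ck_const Suc.IH)
    then show "Ck k (\<lambda>y. (cutoff (j + 2) y - real j * cutoff (j + 1) y) * v)" for v
      by simp
  qed
qed

lemma cutoff_zero_tendsto: "(cutoff 0 \<longlongrightarrow> 1) at_top"
proof -
  have "((\<lambda>y::real. exp (- (1 / y))) \<longlongrightarrow> exp (- 0)) at_top"
    by (rule tendsto_exp, rule tendsto_minus, rule tendsto_divide_0[OF tendsto_const], rule filterlim_at_top_imp_at_infinity, rule filterlim_ident)
  moreover have "\<forall>\<^sub>F y in at_top. exp (- (1 / y)) = cutoff 0 y"
    using eventually_gt_at_top[of "0::real"] by (rule eventually_mono) (simp add: cutoff_def)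
  ultimately show ?thesis
    by (auto dest: tendsto_cong)
qed

lemma cutoff_pos_tendsto: assumes "0 < j" shows "(cutoff j \<longlongrightarrow> 0) at_top"
proof (rule Lim_null_comparison)
  show "\<forall>\<^sub>F y in at_top. norm (cutoff j y) \<le> 1 / y"
  proof (rule eventually_mono[OF eventually_gt_at_top[of 1]])
    fix y :: real assume "1 < y"
    then have "(1 / y) ^ j \<le> (1 / y) ^ 1"
      using assms by (intro power_decreasing) auto
    moreover have "exp (- (1 / y)) \<le> 1" using \<open>1 < y\<close> by simp
    ultimately have "(1 / y) ^ j * exp (- (1 / y)) \<le> (1 / y) ^ 1 * 1"
      using \<open>1 < y\<close> by (intro mult_mono) auto
    then show "norm (cutoff j y) \<le> 1 / y" using \<open>1 < y\<close> by (simp add: cutoff_def)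
  qed
  show "((\<lambda>y::real. 1 / y) \<longlongrightarrow> 0) at_top"
    by (rule tendsto_divide_0[OF tendsto_const], rule filterlim_at_top_imp_at_infinity, rule filterlim_ident)
qed

section \<open>Integration by parts without boundary terms\<close>

lemma lebesgue_on_eq_lborel:
  fixes f g :: "'a::euclidean_space \<Rightarrow> 'b::{banach, second_countable_topology}"
  assumes U: "U \<in> sets borel" and g: "g \<in> borel_measurable borel"
    and "\<And>x. x \<in> U \<Longrightarrow> g x = f x" and "\<And>x. x \<notin> U \<Longrightarrow> g x = 0"
  shows "integrable (lebesgue_on U) f \<longleftrightarrow> integrable lborel g"
    and "integral\<^sup>L (lebesgue_on U) f = integral\<^sup>L lborel g"
proof -
  have eq: "(\<lambda>x. indicator U x *\<^sub>R f x) = g"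
    using assms(3,4) by (auto simp: indicator_def)
  have U': "U \<inter> space lebesgue \<in> sets lebesgue"
    using U by simp
  show "integrable (lebesgue_on U) f \<longleftrightarrow> integrable lborel g"
    using g by (simp add: integrable_restrict_space[OF U'] eq integrable_completion)
  show "integral\<^sup>L (lebesgue_on U) f = integral\<^sup>L lborel g"
    using g by (simp add: integral_restrict_space[OF U'] eq integral_completion)
qed

lemma integral_lborel_translate:
  fixes f :: "'a::euclidean_space \<Rightarrow> 'b::{banach, second_countable_topology}"
  assumes "f \<in> borel_measurable borel"
  shows "(\<integral>x. f (x + c) \<partial>lborel) = (\<integral>x. f x \<partial>lborel)"
proof -
  have "(\<integral>x. f x \<partial>lborel) = (\<integral>x. f x \<partial>distr lborel borel ((+) c))"
    by (simp add: lborel_distr_plus)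
  also have "\<dots> = (\<integral>x. f (c + x) \<partial>lborel)"
    using assms by (subst integral_distr) auto
  finally show ?thesis by (simp add: add.commute)
qed

lemma nn_integral_lborel_translate:
  fixes f :: "'a::euclidean_space \<Rightarrow> ennreal"
  assumes "f \<in> borel_measurable borel"
  shows "(\<integral>\<^sup>+x. f (x + c) \<partial>lborel) = (\<integral>\<^sup>+x. f x \<partial>lborel)"
proof -
  have "(\<integral>\<^sup>+x. f x \<partial>lborel) = (\<integral>\<^sup>+x. f x \<partial>distr lborel borel ((+) c))"
    by (simp add: lborel_distr_plus)
  also have "\<dots> = (\<integral>\<^sup>+x. f (c + x) \<partial>lborel)"
    using assms by (subst nn_integral_distr) auto
  finally show ?thesis by (simp add: add.commute)
qed

text \<open>
  The difference quotients of \<open>h\<close> have integral zero because Lebesgue measure is translation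
  invariant. By the mean value theorem they are bounded, on a fixed ball, by the bound for the
  derivative, so their limit has integral zero as well.
\<close>

lemma integral_partial_derivative_zero:
  fixes h :: "'a::euclidean_space \<Rightarrow> 'b::euclidean_space"
  assumes der: "\<And>x. (h has_derivative h' x) (at x)"
    and bd: "\<And>x. norm (h' x e) \<le> B"
    and supp: "\<And>x. h x \<noteq> 0 \<Longrightarrow> norm x \<le> r"
  shows "integrable lborel (\<lambda>x. h' x e)" and "(\<integral>x. h' x e \<partial>lborel) = 0"
proof -
  have cont: "continuous_on UNIV h"
    using has_derivative_continuous[OF der] by (auto intro: continuous_at_imp_continuous_on)
  then have meas [measurable]: "h \<in> borel_measurable borel"
    by (rule borel_measurable_continuous_onI)
  define t :: "nat \<Rightarrow> real" where "t k = 1 / (real k + 1)" for k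
  define d where "d k x = (1 / t k) *\<^sub>R (h (x + t k *\<^sub>R e) - h x)" for k x
  have t: "0 < t k" "t k \<le> 1" for k by (auto simp: t_def)
  have t0: "t \<longlonglongrightarrow> 0"
    unfolding t_def using LIMSEQ_inverse_real_of_nat by (simp add: inverse_eq_divide add.commute)
  have line: "((\<lambda>s. h (x + s *\<^sub>R e)) has_derivative (\<lambda>w. w *\<^sub>R h' (x + s *\<^sub>R e) e)) (at s)" for x s
  proof -
    have "((\<lambda>s. x + s *\<^sub>R e) has_derivative (\<lambda>w. w *\<^sub>R e)) (at s)"
      by (auto intro!: derivative_eq_intros)
    then have "((\<lambda>s. h (x + s *\<^sub>R e)) has_derivative (\<lambda>w. h' (x + s *\<^sub>R e) (w *\<^sub>R e))) (at s)"
      by (rule has_derivative_compose[OF _ der])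
    then show ?thesis
      by (simp add: linear_cmul[OF has_derivative_linear[OF der]])
  qed
  have lim: "(\<lambda>k. d k x) \<longlonglongrightarrow> h' x e" for x
  proof -
    have "((\<lambda>s. norm (h (x + s *\<^sub>R e) - h x - s *\<^sub>R h' x e) / norm s) \<longlongrightarrow> 0) (at 0)"
      using line[of x 0] by (simp add: has_derivative_iff_norm)
    moreover have "filterlim t (at 0) sequentially"
      using t0 t by (auto simp: filterlim_at intro!: always_eventually) (metis less_irrefl)
    ultimately have "(\<lambda>k. norm (h (x + t k *\<^sub>R e) - h x - t k *\<^sub>R h' x e) / norm (t k)) \<longlonglongrightarrow> 0"
      by (rule filterlim_compose)
    moreover have "norm (h (x + t k *\<^sub>R e) - h x - t k *\<^sub>R h' x e) / norm (t k) = norm (d k x - h' x e)" for k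
    proof -
      have "d k x - h' x e = (1 / t k) *\<^sub>R (h (x + t k *\<^sub>R e) - h x - t k *\<^sub>R h' x e)"
        using t(1)[of k] by (simp add: d_def scaleR_diff_right)
      then show ?thesis using t(1)[of k] by simp
    qed
    ultimately have "(\<lambda>k. norm (d k x - h' x e)) \<longlonglongrightarrow> 0" by simp
    then show ?thesis by (simp add: LIM_zero_cancel tendsto_norm_zero_iff)
  qed
  have bnd: "norm (d k x) \<le> indicator (cball 0 (r + norm e)) x * B" for k x
  proof (cases "norm x \<le> r + norm e")
    case True
    have "norm (h (x + t k *\<^sub>R e) - h (x + 0 *\<^sub>R e)) \<le> B * norm (t k - 0)"
    proof (rule differentiable_bound[OF convex_UNIV])
      show "((\<lambda>s. h (x + s *\<^sub>R e)) has_derivative (\<lambda>w. w *\<^sub>R h' (x + s *\<^sub>R e) e)) (at s within UNIV)" for s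
        using line by simp
      show "onorm (\<lambda>w::real. w *\<^sub>R h' (x + s *\<^sub>R e) e) \<le> B" for s
        using bd by (intro onorm_le) (simp, subst mult.commute, simp add: mult_right_mono)
    qed auto
    then have "norm (d k x) \<le> (1 / t k) * (B * t k)"
      using t[of k] unfolding d_def by (simp add: divide_le_eq)
    then show ?thesis using True t[of k] by simp
  next
    case False
    have "norm (x + t k *\<^sub>R e) \<ge> norm x - norm e"
    proof -
      have "norm x - norm (t k *\<^sub>R e) \<le> norm (x + t k *\<^sub>R e)"
        using norm_triangle_ineq2[of x "- (t k *\<^sub>R e)"] by simp
      moreover have "norm (t k *\<^sub>R e) \<le> norm e"
        using t[of k] by (simp add: mult_left_le_one_le)
      ultimately show ?thesis by linarith
    qed
    then have "h (x + t k *\<^sub>R e) = 0" "h x = 0"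
      using supp[of "x + t k *\<^sub>R e"] supp[of x] False norm_ge_zero[of e] by (force, force)
    then show ?thesis using False by (simp add: d_def)
  qed
  have dmeas [measurable]: "d k \<in> borel_measurable borel" for k
    unfolding d_def by measurable
  have lmeas: "(\<lambda>x. h' x e) \<in> borel_measurable borel"
    using lim by (rule borel_measurable_LIMSEQ_metric[OF dmeas])
  have dom: "integrable lborel (\<lambda>x. indicator (cball 0 (r + norm e)) x * B)"
    using emeasure_bounded_finite[of "cball 0 (r + norm e)"] by (intro integrable_mult_left) auto
  have hint: "integrable lborel h"
  proof -
    have "integrable lborel (\<lambda>x. indicator (cball 0 r) x *\<^sub>R h x)"
      using cont by (intro borel_integrable_compact) (auto intro: continuous_on_subset)
    moreover have "(\<lambda>x. indicator (cball 0 r) x *\<^sub>R h x) = h"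
    proof (rule ext)
      show "indicator (cball 0 r) x *\<^sub>R h x = h x" for x
        using supp[of x] by (cases "h x = 0") auto
    qed
    ultimately show ?thesis by simp
  qed
  have "integrable lborel (\<lambda>x. h (x + c))" for c
  proof -
    have "integrable (distr lborel borel ((+) c)) h" using hint by (simp add: lborel_distr_plus)
    then show ?thesis by (subst (asm) integrable_distr_eq) (auto simp: add.commute)
  qed
  then have "integral\<^sup>L lborel (d k) = 0" for k
    using hint unfolding d_def by (simp add: integral_lborel_translate)
  moreover have "(\<lambda>k. integral\<^sup>L lborel (d k)) \<longlonglongrightarrow> (\<integral>x. h' x e \<partial>lborel)"
    using lim bnd lmeas by (intro integral_dominated_convergence[OF _ _ dom]) auto
  ultimately show "(\<integral>x. h' x e \<partial>lborel) = 0"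
    by (simp add: LIMSEQ_const_iff)
  show "integrable lborel (\<lambda>x. h' x e)"
    using lim bnd lmeas by (intro integrable_dominated_convergence[OF _ _ dom, where s = d]) auto
qed

lemma has_derivative_zero_off_support:
  assumes "closed K" "x \<notin> K" "\<And>y. y \<notin> K \<Longrightarrow> f y = 0" "(f has_derivative f') (at x)"
  shows "f' = (\<lambda>v. 0)"
proof -
  have "((\<lambda>x. 0) has_derivative (\<lambda>v. 0)) (at x)" by simp
  then have "(f has_derivative (\<lambda>v. 0)) (at x)"
    by (rule has_derivative_transform_within_open[of _ _ _ _ "- K"]) (use assms in auto)
  then show ?thesis using assms(4) has_derivative_unique by blast
qed

text \<open>
  The product \<open>a \<eta>\<close>, continued by zero to the whole space, is differentiable everywhere, because
  every point lies in \<open>U\<close> or in the complement of \<open>K\<close>, and both sets are open.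
\<close>

lemma integral_by_parts_zero:
  fixes a :: "'a::euclidean_space \<Rightarrow> real" and \<eta> :: "'a \<Rightarrow> 'b::euclidean_space"
  assumes U: "open U" and K: "compact K" "K \<subseteq> U"
    and a: "\<And>x. x \<in> U \<Longrightarrow> (a has_derivative a' x) (at x)"
    and \<eta>: "\<And>x. x \<in> U \<Longrightarrow> (\<eta> has_derivative \<eta>' x) (at x)"
    and supp: "\<And>x. x \<notin> K \<Longrightarrow> \<eta> x = 0"
    and A: "\<And>x. x \<in> K \<Longrightarrow> \<bar>a' x e\<bar> \<le> A" and B: "\<And>x. x \<in> K \<Longrightarrow> norm (\<eta>' x e) \<le> B"
  shows "integrable (lebesgue_on U) (\<lambda>x. a x *\<^sub>R \<eta>' x e + a' x e *\<^sub>R \<eta> x)"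
    and "(\<integral>x. a x *\<^sub>R \<eta>' x e + a' x e *\<^sub>R \<eta> x \<partial>lebesgue_on U) = 0"
proof -
  define h where "h x = (if x \<in> U then a x *\<^sub>R \<eta> x else 0)" for x
  define h' where "h' x v = (if x \<in> K then a x *\<^sub>R \<eta>' x v + a' x v *\<^sub>R \<eta> x else 0)" for x v
  have h0: "h x = 0" if "x \<notin> K" for x
    using that supp by (simp add: h_def)
  have der: "(h has_derivative h' x) (at x)" for x
  proof (cases "x \<in> K")
    case True
    then have "x \<in> U" using K by auto
    have "((\<lambda>x. a x *\<^sub>R \<eta> x) has_derivative h' x) (at x)"
      using True has_derivative_scaleR[OF a[OF \<open>x \<in> U\<close>] \<eta>[OF \<open>x \<in> U\<close>]]
      by (simp add: h'_def[abs_def])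
    then show ?thesis
      by (rule has_derivative_transform_within_open[OF _ U \<open>x \<in> U\<close>]) (simp add: h_def)
  next
    case False
    have "((\<lambda>x. 0) has_derivative h' x) (at x)"
      using False by (simp add: h'_def[abs_def])
    then show ?thesis
      by (rule has_derivative_transform_within_open[of _ _ _ _ "- K"])
         (use False K h0 in \<open>auto simp: compact_imp_closed open_Compl\<close>)
  qed
  have eq: "h' x e = a x *\<^sub>R \<eta>' x e + a' x e *\<^sub>R \<eta> x" if "x \<in> U" for x
  proof (cases "x \<in> K")
    case False
    have "\<eta>' x = (\<lambda>v. 0)"
      using K False supp \<eta>[OF that] by (intro has_derivative_zero_off_support[of K x \<eta>]) (auto simp: compact_imp_closed)
    with False supp show ?thesis by (simp add: h'_def)
  qed (simp add: h'_def)
  have "continuous_on K a"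
    using a K by (meson continuous_at_imp_continuous_on has_derivative_continuous subsetD)
  then obtain A0 where A0: "\<And>x. x \<in> K \<Longrightarrow> \<bar>a x\<bar> \<le> A0"
    using compact_imp_bounded[OF compact_continuous_image[OF _ K(1), of a]] by (auto simp: bounded_iff)
  have "continuous_on K \<eta>"
    using \<eta> K by (meson continuous_at_imp_continuous_on has_derivative_continuous subsetD)
  then obtain B0 where B0: "\<And>x. x \<in> K \<Longrightarrow> norm (\<eta> x) \<le> B0"
    using compact_imp_bounded[OF compact_continuous_image[OF _ K(1), of \<eta>]] by (auto simp: bounded_iff)
  have bd: "norm (h' x e) \<le> \<bar>A0\<bar> * \<bar>B\<bar> + \<bar>A\<bar> * \<bar>B0\<bar>" for x
  proof (cases "x \<in> K")
    case True
    have "norm (h' x e) \<le> \<bar>a x\<bar> * norm (\<eta>' x e) + \<bar>a' x e\<bar> * norm (\<eta> x)"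
      using True by (auto simp: h'_def intro!: norm_triangle_le)
    also have "\<dots> \<le> \<bar>A0\<bar> * \<bar>B\<bar> + \<bar>A\<bar> * \<bar>B0\<bar>"
      using A0[OF True] B0[OF True] A[OF True] B[OF True]
      by (intro add_mono mult_mono) auto
    finally show ?thesis .
  qed (simp add: h'_def)
  obtain r where "\<And>x. x \<in> K \<Longrightarrow> norm x \<le> r"
    using compact_imp_bounded[OF K(1)] by (auto simp: bounded_iff)
  then have r: "\<And>x. h x \<noteq> 0 \<Longrightarrow> norm x \<le> r" using h0 by blast
  note int = integral_partial_derivative_zero[OF der bd r]
  have off: "h' x e = 0" if "x \<notin> U" for x using that K by (auto simp: h'_def)
  have "(\<lambda>x. h' x e) \<in> borel_measurable borel" using int(1) by auto
  note tr = lebesgue_on_eq_lborel[OF _ this eq off]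
  show "integrable (lebesgue_on U) (\<lambda>x. a x *\<^sub>R \<eta>' x e + a' x e *\<^sub>R \<eta> x)"
    using tr(1) int(1) U by simp
  show "(\<integral>x. a x *\<^sub>R \<eta>' x e + a' x e *\<^sub>R \<eta> x \<partial>lebesgue_on U) = 0"
    using tr(2) int(2) U by simp
qed

lemma integrable_compact_support:
  fixes f :: "'a::euclidean_space \<Rightarrow> 'b::{banach, second_countable_topology}"
  assumes "open U" "compact K" "K \<subseteq> U" "continuous_on U f" "\<And>x. x \<in> U - K \<Longrightarrow> f x = 0"
  shows "integrable (lebesgue_on U) f"
proof -
  have "integrable lborel (\<lambda>x. indicator K x *\<^sub>R f x)"
    using assms by (intro borel_integrable_compact) (auto intro: continuous_on_subset)
  then show ?thesis
    using assms by (subst lebesgue_on_eq_lborel(1)[where g = "\<lambda>x. indicator K x *\<^sub>R f x"])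
      (auto simp: indicator_def)
qed

section \<open>The radial eigenvalue equation\<close>

text \<open>
  The weight \<open>exp V\<close> as a function of the radius.
\<close>

definition wt :: "real \<Rightarrow> real" where
  "wt r = exp (- sqrt (1 + r\<^sup>2))"

text \<open>
  For \<open>r > 0\<close> this is \<open>r\<^sup>-\<^sup>m\<close> times the integral of \<open>s\<^sup>m\<^sup>-\<^sup>1 wt s a s\<close> over \<open>[0, r]\<close>, by the
  substitution \<open>s = r t\<close>. In the form over \<open>[0, 1]\<close> it is visibly continuous at the origin.
\<close>

definition avg :: "nat \<Rightarrow> (real \<Rightarrow> real) \<Rightarrow> real \<Rightarrow> real" where
  "avg m a r = integral {0..1} (\<lambda>t. t ^ (m - 1) * wt (r * t) * a (r * t))"

text \<open>
  The equation \<open>(r\<^sup>m\<^sup>-\<^sup>1 wt f')' = - l r\<^sup>m\<^sup>-\<^sup>1 wt f\<close> with \<open>f 0 = 1\<close> and \<open>f' 0 = 0\<close>, integrated twice,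
  reads \<open>f = 1 - l volterra m f\<close>.
\<close>

definition volterra :: "nat \<Rightarrow> (real \<Rightarrow> real) \<Rightarrow> real \<Rightarrow> real" where
  "volterra m a r = integral {0..r} (\<lambda>s. s / wt s * avg m a s)"

lemma wt_pos [simp]: "0 < wt r" and wt_le_1: "wt r \<le> 1"
  by (auto simp: wt_def)

lemma wt_nonzero [simp]: "wt r \<noteq> 0"
  using wt_pos[of r] by linarith

lemma wt_antimono: "0 \<le> r \<Longrightarrow> r \<le> s \<Longrightarrow> wt s \<le> wt r"
  by (simp add: wt_def power_mono)

lemma wt_le_exp: "wt r \<le> exp (- r)"
proof -
  have "r \<le> sqrt (1 + r\<^sup>2)" by (rule real_le_rsqrt) simp
  then show ?thesis by (simp add: wt_def)
qed

lemma continuous_on_wt [continuous_intros]: "continuous_on S f \<Longrightarrow> continuous_on S (\<lambda>x. wt (f x))"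
  unfolding wt_def by (intro continuous_intros)

lemma avg_integrand_cont:
  assumes "continuous_on {0..S} a"
  shows "continuous_on ({0..S} \<times> {0..1}) (\<lambda>(r, t). t ^ (m - 1) * wt (r * t) * a (r * t))"
proof -
  have "continuous_on ({0..S} \<times> {0..1}) (\<lambda>z. a (fst z * snd z))"
    by (rule continuous_on_compose2[OF assms])
       (auto intro!: continuous_intros mult_nonneg_nonneg mult_left_le order_trans[OF mult_left_le])
  then show ?thesis
    unfolding split_beta by (intro continuous_intros)
qed

lemma avg_integrand_cont':
  assumes "continuous_on {0..S} a" "r \<in> {0..S}"
  shows "continuous_on {0..1} (\<lambda>t. t ^ (m - 1) * wt (r * t) * a (r * t))"
proof -
  have "continuous_on {0..1} (\<lambda>t. a (r * t))"
    by (rule continuous_on_compose2[OF assms(1)])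
       (use assms(2) in \<open>auto intro!: continuous_intros order_trans[OF mult_left_le]\<close>)
  then show ?thesis by (intro continuous_intros)
qed

lemma avg_cont: "continuous_on {0..S} a \<Longrightarrow> continuous_on {0..S} (avg m a)"
  unfolding avg_def
  using integral_continuous_on_param[of "{0..S}" 0 1 "\<lambda>r t. t ^ (m - 1) * wt (r * t) * a (r * t)"]
    avg_integrand_cont[of S a m]
  by (simp only: cbox_interval)

lemma volterra_integrand_cont:
  "continuous_on {0..S} a \<Longrightarrow> continuous_on {0..S} (\<lambda>s. s / wt s * avg m a s)"
  by (intro continuous_intros avg_cont) auto

lemma volterra_cont: "continuous_on {0..S} a \<Longrightarrow> continuous_on {0..S} (volterra m a)"
  unfolding volterra_def
  by (intro indefinite_integral_continuous_1 integrable_continuous_real volterra_integrand_cont)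

lemma volterra_deriv:
  assumes "continuous_on {0..S} a" "0 < r" "r < S"
  shows "(volterra m a has_real_derivative r / wt r * avg m a r) (at r)"
proof -
  have "(volterra m a has_real_derivative r / wt r * avg m a r) (at r within {0..S})"
    unfolding volterra_def
    by (rule integral_has_real_derivative[OF volterra_integrand_cont]) (use assms in auto)
  moreover have "at r within {0..S} = at r"
    using assms by (intro at_within_interior) auto
  ultimately show ?thesis by simp
qed

lemma has_integral_power:
  fixes r :: real
  assumes "0 \<le> r"
  shows "((\<lambda>s. s ^ k) has_integral r ^ (k + 1) / real (k + 1)) {0..r}"
proof -
  have "((\<lambda>s. s ^ k) has_integral r ^ (k + 1) / real (k + 1) - 0 ^ (k + 1) / real (k + 1)) {0..r}"
  proof (rule fundamental_theorem_of_calculus[OF assms])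
    fix s :: real
    have "((\<lambda>s. s ^ Suc k / real (Suc k)) has_real_derivative (real (Suc k) * s ^ k) / real (Suc k)) (at s within {0..r})"
      using DERIV_pow[of "Suc k" s "{0..r}"] by (intro DERIV_cdivide) simp
    then show "((\<lambda>s. s ^ (k + 1) / real (k + 1)) has_vector_derivative s ^ k) (at s within {0..r})"
      by (simp del: power_Suc add: has_real_derivative_iff_has_vector_derivative)
  qed
  then show ?thesis by simp
qed

lemma avg_bound:
  assumes "continuous_on {0..S} a" "r \<in> {0..S}" "0 \<le> M"
    and "\<And>s. s \<in> {0..S} \<Longrightarrow> \<bar>a s\<bar> \<le> M * s ^ k"
  shows "\<bar>avg m a r\<bar> \<le> M * r ^ k"
proof -
  have "norm (integral {0..1} (\<lambda>t. t ^ (m - 1) * wt (r * t) * a (r * t))) \<le> (M * r ^ k) * (1 - 0)"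
  proof (rule integral_bound)
    fix t :: real assume t: "t \<in> {0..1}"
    have rt: "0 \<le> r * t" "r * t \<le> r" "r * t \<in> {0..S}"
      using t assms(2) by (auto intro: mult_left_le order_trans[OF mult_left_le])
    have "\<bar>a (r * t)\<bar> \<le> M * (r * t) ^ k" using assms(4) rt by blast
    also have "\<dots> \<le> M * r ^ k" using rt assms(3) by (intro mult_left_mono power_mono)
    finally have "\<bar>a (r * t)\<bar> \<le> M * r ^ k" .
    moreover have "t ^ (m - 1) \<le> 1" "0 \<le> t ^ (m - 1)" using t by (auto intro: power_le_one)
    ultimately have "(t ^ (m - 1) * wt (r * t)) * \<bar>a (r * t)\<bar> \<le> (1 * 1) * (M * r ^ k)"
      using wt_le_1[of "r * t"] less_imp_le[OF wt_pos[of "r * t"]] by (intro mult_mono) auto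
    then show "norm (t ^ (m - 1) * wt (r * t) * a (r * t)) \<le> M * r ^ k"
      using \<open>0 \<le> t ^ (m - 1)\<close> less_imp_le[OF wt_pos[of "r * t"]]
      by (simp only: real_norm_def abs_mult abs_of_nonneg)
  qed (use avg_integrand_cont'[OF assms(1,2)] in auto)
  then show ?thesis by (simp add: avg_def)
qed

lemma volterra_bound:
  assumes a: "continuous_on {0..S} a" and r: "r \<in> {0..S}" and M: "0 \<le> M"
    and bd: "\<And>s. s \<in> {0..S} \<Longrightarrow> \<bar>a s\<bar> \<le> M * s ^ k"
  shows "\<bar>volterra m a r\<bar> \<le> S / wt S * M / real (k + 1) * r ^ (k + 1)"
proof -
  have int: "((\<lambda>s. S / wt S * M * s ^ k) has_integral
      S / wt S * M / real (k + 1) * r ^ (k + 1)) {0..r}"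
    using has_integral_mult_right[OF has_integral_power, of r "S / wt S * M" k] r by simp
  have "norm (integral {0..r} (\<lambda>s. s / wt s * avg m a s)) \<le> integral {0..r} (\<lambda>s. S / wt S * M * s ^ k)"
  proof (rule integral_norm_bound_integral)
    show "(\<lambda>s. s / wt s * avg m a s) integrable_on {0..r}"
      using r by (intro integrable_continuous_real continuous_on_subset[OF volterra_integrand_cont[OF a]]) auto
    fix s assume "s \<in> {0..r}"
    then have s: "0 \<le> s" "s \<le> S" "s \<in> {0..S}" using r by auto
    have "\<bar>avg m a s\<bar> \<le> M * s ^ k" by (rule avg_bound[OF a s(3) M bd])
    moreover have "s / wt s \<le> S / wt S"
      using s wt_antimono[of s S] by (intro frac_le) auto
    ultimately have "(s / wt s) * \<bar>avg m a s\<bar> \<le> (S / wt S) * (M * s ^ k)"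
      using s M wt_pos[of s] wt_pos[of S] by (intro mult_mono) (auto intro!: divide_nonneg_pos)
    moreover have "0 \<le> s / wt s" using s wt_pos[of s] by (intro divide_nonneg_pos)
    ultimately show "norm (s / wt s * avg m a s) \<le> S / wt S * M * s ^ k"
      by (simp only: real_norm_def abs_mult abs_of_nonneg mult.assoc)
  qed (use int in auto)
  then show ?thesis
    using integral_unique[OF int] by (simp add: volterra_def)
qed

lemma avg_lin:
  assumes a: "continuous_on {0..S} a" and b: "continuous_on {0..S} b" and r: "r \<in> {0..S}"
  shows "avg m (\<lambda>s. a s + c * b s) r = avg m a r + c * avg m b r"
proof -
  let ?h = "\<lambda>a t. t ^ (m - 1) * wt (r * t) * a (r * t)"
  have "integral {0..1} (\<lambda>t. ?h a t + c * ?h b t) = integral {0..1} (?h a) + c * integral {0..1} (?h b)"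
  proof (subst integral_add)
    show "?h a integrable_on {0..1}" "(\<lambda>t. c * ?h b t) integrable_on {0..1}"
      by (intro integrable_continuous_real continuous_on_mult_left avg_integrand_cont'[OF a r]
          avg_integrand_cont'[OF b r])+
  qed (simp only: integral_mult_right)
  then show ?thesis by (simp add: avg_def algebra_simps)
qed

lemma volterra_lin:
  assumes a: "continuous_on {0..S} a" and b: "continuous_on {0..S} b" and r: "r \<in> {0..S}"
  shows "volterra m (\<lambda>s. a s + c * b s) r = volterra m a r + c * volterra m b r"
proof -
  let ?h = "\<lambda>a s. s / wt s * avg m a s"
  have ic: "continuous_on {0..r} (?h a)" if "continuous_on {0..S} a" for a
    using r by (intro continuous_on_subset[OF volterra_integrand_cont[OF that]]) auto
  have "volterra m (\<lambda>s. a s + c * b s) r = integral {0..r} (\<lambda>s. ?h a s + c * ?h b s)"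
    unfolding volterra_def
  proof (rule integral_cong)
    show "s / wt s * avg m (\<lambda>s. a s + c * b s) s = s / wt s * avg m a s + c * (s / wt s * avg m b s)"
      if "s \<in> {0..r}" for s
      using that r by (subst avg_lin[OF a b]) (auto simp: algebra_simps)
  qed
  also have "\<dots> = volterra m a r + c * volterra m b r"
    unfolding volterra_def
  proof (subst integral_add)
    show "?h a integrable_on {0..r}" "(\<lambda>t. c * ?h b t) integrable_on {0..r}"
      by (intro integrable_continuous_real continuous_on_mult_left ic a b)+
  qed (simp only: integral_mult_right)
  finally show ?thesis .
qed

text \<open>
  The chain rule shows that the integrand over \<open>[0, 1]\<close>, multiplied by \<open>r\<^sup>m\<close>, is the derivative of
  \<open>t \<mapsto> N (r t)\<close>, where \<open>N\<close> is the primitive on the right.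
\<close>

lemma avg_primitive:
  assumes m: "1 \<le> m" and a: "continuous_on {0..S} a" and r: "r \<in> {0..S}"
  shows "r ^ m * avg m a r = integral {0..r} (\<lambda>s. s ^ (m - 1) * wt s * a s)"
proof -
  let ?N = "\<lambda>r. integral {0..r} (\<lambda>s. s ^ (m - 1) * wt s * a s)"
  have c: "continuous_on {0..S} (\<lambda>s. s ^ (m - 1) * wt s * a s)"
    by (intro continuous_intros a)
  have "((\<lambda>t. r ^ m * (t ^ (m - 1) * wt (r * t) * a (r * t))) has_integral ?N (r * 1) - ?N (r * 0)) {0..1}"
  proof (rule fundamental_theorem_of_calculus)
    fix t :: real assume t: "t \<in> {0..1}"
    have rt: "r * t \<in> {0..S}" using r t by (auto intro: order_trans[OF mult_left_le])
    have N: "(?N has_real_derivative (r * t) ^ (m - 1) * wt (r * t) * a (r * t)) (at (r * t) within {0..S})"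
      by (rule integral_has_real_derivative[OF c rt])
    have "(\<lambda>t. r * t) ` {0..1} \<subseteq> {0..S}"
      using r by (auto intro: order_trans[OF mult_left_le])
    then have "(?N has_real_derivative (r * t) ^ (m - 1) * wt (r * t) * a (r * t))
        (at (r * t) within (\<lambda>t. r * t) ` {0..1})"
      by (rule DERIV_subset[OF N])
    moreover have "((\<lambda>t. r * t) has_real_derivative r) (at t within {0..1})"
      by (auto intro!: derivative_eq_intros)
    ultimately have "((\<lambda>t. ?N (r * t)) has_real_derivative
        ((r * t) ^ (m - 1) * wt (r * t) * a (r * t)) * r) (at t within {0..1})"
      by (rule DERIV_image_chain[unfolded o_def])
    moreover have "((r * t) ^ (m - 1) * wt (r * t) * a (r * t)) * r
        = r ^ m * (t ^ (m - 1) * wt (r * t) * a (r * t))"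
      using m by (cases m) (auto simp: power_mult_distrib)
    ultimately show "((\<lambda>t. ?N (r * t)) has_vector_derivative
        r ^ m * (t ^ (m - 1) * wt (r * t) * a (r * t))) (at t within {0..1})"
      by (simp only: has_real_derivative_iff_has_vector_derivative)
  qed simp
  then have "((\<lambda>t. r ^ m * (t ^ (m - 1) * wt (r * t) * a (r * t))) has_integral ?N r) {0..1}"
    by simp
  from integral_unique[OF this] show ?thesis
    by (simp add: avg_def)
qed

lemma avg_deriv:
  assumes m: "1 \<le> m" and a: "continuous_on {0..S} a" and r: "0 < r" "r < S"
  shows "(avg m a has_real_derivative (wt r * a r - real m * avg m a r) / r) (at r)"
proof -
  let ?N = "\<lambda>r. integral {0..r} (\<lambda>s. s ^ (m - 1) * wt s * a s)"
  have c: "continuous_on {0..S} (\<lambda>s. s ^ (m - 1) * wt s * a s)"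
    by (intro continuous_intros a)
  have "(?N has_real_derivative r ^ (m - 1) * wt r * a r) (at r within {0..S})"
    by (rule integral_has_real_derivative[OF c]) (use r in auto)
  moreover have "at r within {0..S} = at r"
    using r by (intro at_within_interior) auto
  ultimately have N: "(?N has_real_derivative r ^ (m - 1) * wt r * a r) (at r)" by simp
  have eq: "?N s / s ^ m = avg m a s" if "0 < s" "s < S" for s
    using avg_primitive[OF m a, of s] that by (auto simp: field_simps)
  have "((\<lambda>s. ?N s / s ^ m) has_real_derivative
      (r ^ (m - 1) * wt r * a r * r ^ m - ?N r * (real m * r ^ (m - 1))) / (r ^ m * r ^ m)) (at r)"
    using r by (intro DERIV_divide[OF N]) (auto intro!: derivative_eq_intros)
  moreover have "(r ^ (m - 1) * wt r * a r * r ^ m - ?N r * (real m * r ^ (m - 1))) / (r ^ m * r ^ m)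
      = (wt r * a r - real m * avg m a r) / r"
  proof -
    have "?N r = r ^ m * avg m a r" using avg_primitive[OF m a, of r] r by simp
    then show ?thesis using r m by (cases m) (auto simp: field_simps)
  qed
  ultimately have "((\<lambda>s. ?N s / s ^ m) has_real_derivative (wt r * a r - real m * avg m a r) / r) (at r)"
    by simp
  then show ?thesis
    by (rule has_field_derivative_transform_within_open[of _ _ _ "{0<..<S}"]) (use r eq in auto)
qed

lemma avg_at_0: "1 \<le> m \<Longrightarrow> real m * avg m a 0 = wt 0 * a 0"
proof -
  assume m: "1 \<le> m"
  have "((\<lambda>t::real. t ^ (m - 1)) has_integral 1 ^ m / real m - 0 ^ m / real m) {0..1}"
    using m by (intro fundamental_theorem_of_calculus)
      (auto intro!: derivative_eq_intros simp flip: has_real_derivative_iff_has_vector_derivative)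
  then have "integral {0..1} (\<lambda>t::real. t ^ (m - 1)) = 1 / real m"
    using m by (auto simp: integral_unique power_0_left)
  then show ?thesis using m by (simp add: avg_def mult.assoc)
qed

lemma avg_pos:
  assumes a: "continuous_on {0..S} a" and r: "r \<in> {0..S}"
    and nn: "\<And>s. s \<in> {0..S} \<Longrightarrow> 0 \<le> a s" and "0 < a 0"
  shows "0 < avg m a r"
proof -
  let ?h = "\<lambda>t. t ^ (m - 1) * wt (r * t) * a (r * t)"
  have c: "continuous_on {0..1} ?h" by (rule avg_integrand_cont'[OF a r])
  have rt: "r * t \<in> {0..S}" if "t \<in> {0..1}" for t
    using r that by (auto intro: order_trans[OF mult_left_le])
  have nn': "0 \<le> ?h t" if "t \<in> {0..1}" for t
    using nn[OF rt[OF that]] that less_imp_le[OF wt_pos] by (intro mult_nonneg_nonneg) auto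
  have "continuous_on {0..1} (\<lambda>t. a (r * t))"
    by (rule continuous_on_compose2[OF a]) (use rt in \<open>auto intro!: continuous_intros\<close>)
  then have "((\<lambda>t. a (r * t)) \<longlongrightarrow> a (r * 0)) (at 0 within {0..1})"
    unfolding continuous_on_def by (rule bspec) simp
  then have "\<forall>\<^sub>F t in at 0 within {0..1}. 0 < a (r * t)"
    using assms(4) by (intro order_tendstoD(1)) auto
  moreover have "\<forall>\<^sub>F t in at 0 within {0..1::real}. t \<in> {0..1} \<and> t \<noteq> 0"
    by (auto simp: eventually_at_filter)
  ultimately have "\<forall>\<^sub>F t in at 0 within {0..1}. t \<in> {0..1} \<and> t \<noteq> 0 \<and> 0 < a (r * t)"
    by eventually_elim auto
  moreover have "at 0 within {0..1::real} \<noteq> bot"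
    by (simp add: trivial_limit_within islimpt_Icc)
  ultimately obtain t where "t \<in> {0..1}" "t \<noteq> 0" "0 < a (r * t)"
    using eventually_happens by blast
  then have "?h t \<noteq> 0" "t \<in> {0..1}" by auto
  then have "integral {0..1} ?h \<noteq> 0"
    using integral_eq_0_iff[OF c _ nn'] by auto
  moreover have "0 \<le> integral {0..1} ?h"
    by (intro integral_nonneg integrable_continuous_real c nn')
  ultimately show ?thesis by (simp add: avg_def)
qed

definition iterate :: "nat \<Rightarrow> nat \<Rightarrow> real \<Rightarrow> real" where
  "iterate m k = (volterra m ^^ k) (\<lambda>_. 1)"

text \<open>
  The Neumann series of the Volterra equation.
\<close>

definition sol :: "nat \<Rightarrow> real \<Rightarrow> real \<Rightarrow> real" where
  "sol m l r = (\<Sum>k. (- l) ^ k * iterate m k r)"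

lemma iterate_Suc: "iterate m (Suc k) = volterra m (iterate m k)"
  by (simp add: iterate_def)

lemma iterate_cont: "continuous_on {0..S} (iterate m k)"
  by (induction k) (auto simp: iterate_Suc volterra_cont, simp add: iterate_def)

text \<open>
  Each application of \<open>volterra\<close> integrates once more, which produces the factorial. The series
  therefore converges for every \<open>l\<close>, and uniformly on compact sets of pairs \<open>(r, l)\<close>.
\<close>

lemma iterate_bound:
  assumes "0 \<le> S" "r \<in> {0..S}"
  shows "\<bar>iterate m k r\<bar> \<le> (S / wt S) ^ k / fact k * r ^ k"
  using assms(2)
proof (induction k arbitrary: r)
  case 0
  then show ?case by (simp add: iterate_def)
next
  case (Suc k)
  have "0 \<le> S / wt S" using assms(1) by (simp add: less_imp_le)
  then have "\<bar>volterra m (iterate m k) r\<bar> \<le> S / wt S * ((S / wt S) ^ k / fact k) / real (k + 1) * r ^ (k + 1)"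
    using Suc by (intro volterra_bound iterate_cont) auto
  then show ?case by (simp add: iterate_Suc field_simps)
qed

lemma sol_terms_bound:
  assumes "0 \<le> S" "r \<in> {0..S}" "l \<in> {0..L}"
  shows "norm ((- l) ^ k * iterate m k r) \<le> (L * (S / wt S) * S) ^ k / fact k"
proof -
  have S: "0 \<le> S / wt S" using assms(1) by (simp add: less_imp_le)
  have "norm ((- l) ^ k * iterate m k r) = l ^ k * \<bar>iterate m k r\<bar>"
    using assms(3) by (simp add: abs_mult power_abs)
  also have "\<dots> \<le> L ^ k * ((S / wt S) ^ k / fact k * S ^ k)"
  proof (rule mult_mono)
    have "(S / wt S) ^ k / fact k * r ^ k \<le> (S / wt S) ^ k / fact k * S ^ k"
      using assms(2) S by (intro mult_left_mono power_mono divide_nonneg_pos zero_le_power) auto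
    then show "\<bar>iterate m k r\<bar> \<le> (S / wt S) ^ k / fact k * S ^ k"
      using iterate_bound[OF assms(1,2), of m k] by linarith
  qed (use assms in \<open>auto intro: power_mono\<close>)
  also have "\<dots> = (L * (S / wt S) * S) ^ k / fact k"
    by (simp add: power_mult_distrib power_divide)
  finally show ?thesis .
qed

lemma sol_uniform_limit:
  assumes "0 \<le> S"
  shows "uniform_limit ({0..S} \<times> {0..L}) (\<lambda>n (r, l). \<Sum>k<n. (- l) ^ k * iterate m k r)
    (\<lambda>(r, l). sol m l r) sequentially"
proof -
  have "summable (\<lambda>k. (L * (S / wt S) * S) ^ k / fact k)"
    using summable_exp_generic[of "L * (S / wt S) * S"] by (simp add: divide_inverse mult.commute)
  then have "uniform_limit ({0..S} \<times> {0..L}) (\<lambda>n z. \<Sum>k<n. (- snd z) ^ k * iterate m k (fst z))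
      (\<lambda>z. \<Sum>k. (- snd z) ^ k * iterate m k (fst z)) sequentially"
    using sol_terms_bound[OF assms] by (intro Weierstrass_m_test) force+
  then show ?thesis by (simp add: case_prod_unfold sol_def)
qed

lemma sol_cont2:
  assumes "0 \<le> S" shows "continuous_on ({0..S} \<times> {0..L}) (\<lambda>(r, l). sol m l r)"
proof (rule uniform_limit_theorem[OF _ sol_uniform_limit[OF assms]])
  have "continuous_on ({0..S} \<times> {0..L}) (\<lambda>z. iterate m k (fst z))" for k
    by (rule continuous_on_compose2[OF iterate_cont]) (auto intro!: continuous_intros)
  then have "continuous_on ({0..S} \<times> {0..L}) (\<lambda>z. \<Sum>k<n. (- snd z) ^ k * iterate m k (fst z))" for n
    by (intro continuous_intros)
  then show "\<forall>\<^sub>F n in sequentially.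
      continuous_on ({0..S} \<times> {0..L}) (\<lambda>(r, l). \<Sum>k<n. (- l) ^ k * iterate m k r)"
    by (simp add: case_prod_unfold)
qed simp

lemma sol_cont:
  assumes "0 \<le> l" shows "continuous_on {0..S} (sol m l)"
proof (cases "0 \<le> S")
  case True
  have "continuous_on {0..S} (\<lambda>r. (\<lambda>(r, l). sol m l r) (r, l))"
    by (rule continuous_on_compose2[OF sol_cont2[OF True, of l]])
       (use assms in \<open>auto intro!: continuous_intros\<close>)
  then show ?thesis by simp
qed simp

lemma volterra_sum:
  assumes "r \<in> {0..S}"
  shows "volterra m (\<lambda>s. \<Sum>k<n. c k * iterate m k s) r = (\<Sum>k<n. c k * iterate m (Suc k) r)"
proof (induction n)
  case 0
  show ?case by (simp add: volterra_def avg_def)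
next
  case (Suc n)
  have "continuous_on {0..S} (\<lambda>s. \<Sum>k<n. c k * iterate m k s)"
    by (intro continuous_intros iterate_cont)
  then show ?case
    using volterra_lin[OF _ iterate_cont assms] Suc by (simp add: iterate_Suc)
qed

text \<open>
  \<open>volterra\<close> is continuous with respect to uniform convergence on \<open>[0, S]\<close>, so it may be applied
  term by term, where it shifts the index of the iterates.
\<close>

lemma sol_fixpoint:
  assumes l: "0 \<le> l" and r: "r \<in> {0..S}"
  shows "sol m l r = 1 - l * volterra m (sol m l) r"
proof -
  have S: "0 \<le> S" using r by auto
  define P where "P n s = (\<Sum>k<n. (- l) ^ k * iterate m k s)" for n s
  have Pc: "continuous_on {0..S} (P n)" for n
    unfolding P_def by (intro continuous_intros iterate_cont)
  have P: "\<forall>\<^sub>F n in sequentially. \<forall>s\<in>{0..S}. \<bar>P n s - sol m l s\<bar> < e" if "0 < e" for e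
    using uniform_limitD[OF sol_uniform_limit[OF S, where L = l and m = m] that]
    by (rule eventually_mono) (use l in \<open>auto simp: P_def dist_real_def\<close>)
  have "(\<lambda>n. volterra m (P n) r) \<longlonglongrightarrow> volterra m (sol m l) r"
  proof (rule tendstoI)
    fix e :: real assume "0 < e"
    have pos: "0 < S / wt S * S + 1"
      using S by (intro add_nonneg_pos mult_nonneg_nonneg divide_nonneg_pos) auto
    have "\<forall>\<^sub>F n in sequentially. \<forall>s\<in>{0..S}. \<bar>P n s - sol m l s\<bar> < e / (S / wt S * S + 1)"
      using \<open>0 < e\<close> pos by (intro P divide_pos_pos)
    then show "\<forall>\<^sub>F n in sequentially. dist (volterra m (P n) r) (volterra m (sol m l) r) < e"
    proof eventually_elim
      case (elim n)
      let ?d = "e / (S / wt S * S + 1)"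
      have c: "continuous_on {0..S} (\<lambda>s. P n s + (- 1) * sol m l s)"
        by (intro continuous_intros Pc sol_cont l)
      have "\<bar>volterra m (\<lambda>s. P n s + (- 1) * sol m l s) r\<bar> \<le> S / wt S * ?d / real (0 + 1) * r ^ (0 + 1)"
        by (rule volterra_bound[OF c r]) (use elim \<open>0 < e\<close> pos in \<open>force+\<close>)
      also have "\<dots> \<le> S / wt S * ?d * S"
      proof -
        have "0 \<le> S / wt S * ?d"
          using S \<open>0 < e\<close> pos by (intro mult_nonneg_nonneg divide_nonneg_pos) auto
        then show ?thesis
          using mult_left_mono[of r S "S / wt S * ?d"] r
          by (simp only: power_one_right add_0 of_nat_1 div_by_1 atLeastAtMost_iff)
      qed
      also have "\<dots> = e * ((S / wt S * S) / (S / wt S * S + 1))"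
        by simp
      also have "\<dots> < e * 1"
      proof (rule mult_strict_left_mono[OF _ \<open>0 < e\<close>])
        show "S / wt S * S / (S / wt S * S + 1) < 1"
          by (subst divide_less_eq_1_pos[OF pos]) simp
      qed
      finally show ?case
        using volterra_lin[OF Pc[of n] sol_cont[OF l, where m = m] r, where m = m and c = "- 1"] by (simp add: dist_real_def)
    qed
  qed
  then have "(\<lambda>n. \<Sum>k<n. (- l) ^ k * iterate m (Suc k) r) \<longlonglongrightarrow> volterra m (sol m l) r"
    unfolding P_def volterra_sum[OF r] .
  then have "(\<lambda>k. (- l) ^ k * iterate m (Suc k) r) sums volterra m (sol m l) r"
    by (simp add: sums_def)
  then have "(\<lambda>k. (- l) * ((- l) ^ k * iterate m (Suc k) r)) sums ((- l) * volterra m (sol m l) r)"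
    by (rule sums_mult)
  then have "(\<lambda>k. (- l) ^ Suc k * iterate m (Suc k) r) sums ((- l) * volterra m (sol m l) r)"
    by (simp add: mult.assoc)
  then have "(\<lambda>k. (- l) ^ k * iterate m k r) sums ((- l) * volterra m (sol m l) r + (- l) ^ 0 * iterate m 0 r)"
    by (subst (asm) sums_Suc_iff) simp
  then show ?thesis by (simp add: sol_def sums_iff iterate_def)
qed

lemma sol_at_0: "0 \<le> l \<Longrightarrow> sol m l 0 = 1"
  using sol_fixpoint[of l 0 0 m] by (simp add: volterra_def)

lemma sol_deriv:
  assumes l: "0 \<le> l" and r: "0 < r" "r < S"
  shows "(sol m l has_real_derivative - l * r / wt r * avg m (sol m l) r) (at r)"
proof -
  have "(volterra m (sol m l) has_real_derivative r / wt r * avg m (sol m l) r) (at r)"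
    by (rule volterra_deriv[OF sol_cont[OF l] r])
  then have "((\<lambda>r. 1 - l * volterra m (sol m l) r) has_real_derivative - l * r / wt r * avg m (sol m l) r) (at r)"
    by (auto intro!: derivative_eq_intros)
  then show ?thesis
    by (rule has_field_derivative_transform_within_open[of _ _ _ "{0<..<S}"])
       (use r sol_fixpoint[OF l, of _ S m] in auto)
qed

definition eigenvalue_bound :: "nat \<Rightarrow> real \<Rightarrow> real" where
  "eigenvalue_bound m R = 2 * real m / (wt (1/2) * (1/2) ^ m) * R ^ m / (R\<^sup>2 * exp (R / 2))"

lemma sol_decreasing:
  assumes l: "0 \<le> l" and nn: "\<And>s. s \<in> {0..R} \<Longrightarrow> 0 \<le> sol m l s" and rs: "0 \<le> r" "r \<le> s" "s \<le> R"
  shows "sol m l s \<le> sol m l r"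
proof (rule DERIV_nonpos_imp_decreasing_open[OF rs(2)])
  show "continuous_on {r..s} (sol m l)"
    using rs by (intro continuous_on_subset[OF sol_cont[OF l, of R]]) auto
  fix x assume x: "r < x" "x < s"
  have "0 \<le> avg m (sol m l) x"
  proof (rule less_imp_le, rule avg_pos[OF sol_cont[OF l]])
    show "x \<in> {0..R}" using x rs by simp
  qed (simp_all add: nn sol_at_0[OF l])
  then have "- l * x / wt x * avg m (sol m l) x \<le> 0"
    using l x rs by (simp add: divide_nonneg_pos)
  then show "\<exists>y. (sol m l has_real_derivative y) (at x) \<and> y \<le> 0"
    using sol_deriv[OF l, of x R m] x rs by auto
qed

text \<open>
  A positive solution decreases. The mass that it has collected on \<open>[0, 1/2]\<close> forces it to drop,
  between \<open>R / 2\<close> and \<open>R\<close>, by at least a constant times \<open>l exp (R / 2) R\<^sup>2\<^sup>-\<^sup>m\<close> times its value at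
  \<open>R / 2\<close>, because the inverse weight is exponentially large there. The drop cannot exceed that
  value.
\<close>

lemma positive_sol_imp_bound:
  assumes m: "1 \<le> m" and l: "0 \<le> l" and R: "1 \<le> R"
    and nn: "\<And>s. s \<in> {0..R} \<Longrightarrow> 0 \<le> sol m l s" and pos: "0 < sol m l (R / 2)"
  shows "l \<le> eigenvalue_bound m R"
proof -
  let ?f = "sol m l"
  note c = sol_cont[OF l, where m = m]
  \<comment> \<open>The drop is the length of the interval times the slope at some intermediate \<open>x\<close>.\<close>
  obtain x where x: "R / 2 < x" "x < R"
    and "?f R - ?f (R / 2) = (R - R / 2) * (- l * x / wt x * avg m ?f x)"
  proof -
    have "\<exists>z>R / 2. z < R \<and> ?f R - ?f (R / 2) = (R - R / 2) * (- l * z / wt z * avg m ?f z)"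
    proof (rule MVT2)
      show "R / 2 < R" using R by simp
      fix y assume "R / 2 \<le> y" "y \<le> R"
      then show "(?f has_real_derivative - l * y / wt y * avg m ?f y) (at y)"
        using sol_deriv[OF l, of y "R + 1" m] R by simp
    qed
    then show ?thesis using that by blast
  qed
  then have drop: "R / 2 * (l * x / wt x * avg m ?f x) \<le> ?f (R / 2)"
    using nn[of R] R by simp
  \<comment> \<open>The mass on \<open>[0, x]\<close> is at least the mass on \<open>[0, 1/2]\<close>, where the decreasing \<open>f\<close> is
      at least \<open>f (1/2) \<ge> f (R / 2)\<close>; the condition \<open>R \<ge> 1\<close> ensures \<open>1/2 \<le> R / 2\<close>.\<close>
  let ?N = "\<lambda>r. integral {0..r} (\<lambda>s. s ^ (m - 1) * wt s * ?f s)"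
  have cN: "continuous_on {0..R} (\<lambda>s. s ^ (m - 1) * wt s * ?f s)"
    by (intro continuous_intros c)
  have "?N (1/2) \<le> ?N x"
  proof (rule integral_subset_le)
    show "(\<lambda>s. s ^ (m - 1) * wt s * ?f s) integrable_on {0..1/2}"
      "(\<lambda>s. s ^ (m - 1) * wt s * ?f s) integrable_on {0..x}"
      by (intro integrable_continuous_real continuous_on_subset[OF cN]; use x R in auto)+
    show "\<forall>s\<in>{0..x}. 0 \<le> s ^ (m - 1) * wt s * ?f s"
      using nn x by (auto intro!: mult_nonneg_nonneg less_imp_le[OF wt_pos])
  qed (use x R in auto)
  moreover have "wt (1/2) * ?f (1/2) * ((1/2) ^ m / real m) \<le> ?N (1/2)"
  proof -
    have "((\<lambda>s. s ^ (m - 1)) has_integral (1/2) ^ m / real m) {0..1/2::real}"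
      using has_integral_power[of "1/2" "m - 1"] m by simp
    then have i: "((\<lambda>s. wt (1/2) * ?f (1/2) * s ^ (m - 1)) has_integral wt (1/2) * ?f (1/2) * ((1/2) ^ m / real m)) {0..1/2::real}"
      by (rule has_integral_mult_right)
    have "integral {0..1/2} (\<lambda>s. wt (1/2) * ?f (1/2) * s ^ (m - 1)) \<le> ?N (1/2)"
    proof (rule integral_le)
      show "(\<lambda>s. s ^ (m - 1) * wt s * ?f s) integrable_on {0..1/2}"
        by (intro integrable_continuous_real continuous_on_subset[OF cN]; use R in auto)
      fix s :: real assume s: "s \<in> {0..1/2}"
      then have "wt (1/2) * ?f (1/2) \<le> wt s * ?f s"
        using sol_decreasing[OF l nn, where R = R and r = s and s = "1/2"] R nn[of "1/2"]
        by (intro mult_mono wt_antimono less_imp_le[OF wt_pos]) auto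
      then have "s ^ (m - 1) * (wt (1/2) * ?f (1/2)) \<le> s ^ (m - 1) * (wt s * ?f s)"
        using s by (intro mult_left_mono) auto
      then show "wt (1/2) * ?f (1/2) * s ^ (m - 1) \<le> s ^ (m - 1) * wt s * ?f s"
        by (simp only: mult_ac)
    qed (use i in auto)
    then show ?thesis using integral_unique[OF i] by simp
  qed
  moreover have "?f (R / 2) \<le> ?f (1/2)"
    using sol_decreasing[OF l nn, where R = R and r = "1/2" and s = "R / 2"] R by auto
  then have "wt (1/2) * ((1/2) ^ m / real m) * ?f (R / 2) \<le> wt (1/2) * ?f (1/2) * ((1/2) ^ m / real m)"
    using less_imp_le[OF wt_pos[of "1/2"]] by (simp add: mult_left_mono mult_right_mono mult.assoc mult.left_commute divide_right_mono)
  moreover have "x ^ m * avg m ?f x = ?N x"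
    by (rule avg_primitive[OF m c, of x R]) (use x R in auto)
  ultimately have mass: "wt (1/2) * ((1/2) ^ m / real m) * ?f (R / 2) \<le> x ^ m * avg m ?f x"
    by linarith
  have "exp (R / 2) * wt x \<le> exp x * exp (- x)"
    using x wt_le_exp[of x] by (intro mult_mono) (auto simp: less_imp_le)
  then have e: "exp (R / 2) \<le> 1 / wt x"
    by (simp add: exp_minus field_simps)
  have xm: "x ^ m = x * x ^ (m - 1)" using m by (cases m) auto
  have "x ^ (m - 1) \<le> R ^ (m - 1)" using x R by (intro power_mono) auto
  have av: "0 \<le> avg m ?f x"
  proof (rule less_imp_le, rule avg_pos[OF c])
    show "x \<in> {0..R}" using x R by simp
  qed (simp_all add: nn sol_at_0[OF l])
  have "0 \<le> wt (1/2) * ((1/2) ^ m / real m) * ?f (R / 2)"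
    using pos by (intro mult_nonneg_nonneg divide_nonneg_nonneg less_imp_le[OF wt_pos]) auto
  then have "0 \<le> x ^ m * avg m ?f x" using mass by linarith
  then have "l * (wt (1/2) * ((1/2) ^ m / real m) * ?f (R / 2)) * exp (R / 2)
      \<le> l * (x ^ m * avg m ?f x) * (1 / wt x)"
    by (intro mult_mono[OF mult_left_mono[OF mass l] e] mult_nonneg_nonneg[OF l]) (assumption, rule exp_ge_zero)
  also have "\<dots> = x ^ (m - 1) * (l * x / wt x * avg m ?f x)"
    unfolding xm by (simp only: mult_ac times_divide_eq_right times_divide_eq_left mult_1_right)
  also have "\<dots> \<le> R ^ (m - 1) * (l * x / wt x * avg m ?f x)"
    using \<open>x ^ (m - 1) \<le> R ^ (m - 1)\<close> l x R av
    by (intro mult_right_mono mult_nonneg_nonneg divide_nonneg_pos) auto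
  finally have "R / 2 * (l * (wt (1/2) * ((1/2) ^ m / real m) * ?f (R / 2)) * exp (R / 2))
      \<le> R / 2 * (R ^ (m - 1) * (l * x / wt x * avg m ?f x))"
    using R by (intro mult_left_mono) auto
  also have "\<dots> = R ^ (m - 1) * (R / 2 * (l * x / wt x * avg m ?f x))"
    by simp
  also have "\<dots> \<le> R ^ (m - 1) * ?f (R / 2)"
    using drop R by (intro mult_left_mono) auto
  finally have "(R / 2 * (l * (wt (1/2) * ((1/2) ^ m / real m)) * exp (R / 2))) * ?f (R / 2) \<le> R ^ (m - 1) * ?f (R / 2)"
    by (simp only: mult_ac)
  then have "R / 2 * (l * (wt (1/2) * ((1/2) ^ m / real m)) * exp (R / 2)) \<le> R ^ (m - 1)"
    using pos by (simp only: mult_le_cancel_right_pos)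
  then have "R * (R / 2 * (l * (wt (1/2) * ((1/2) ^ m / real m)) * exp (R / 2))) \<le> R * R ^ (m - 1)"
    by (rule mult_left_mono) (use R in linarith)
  moreover have "R * R ^ (m - 1) = R ^ m" using m by (cases m) auto
  ultimately have "R * (R / 2 * (l * (wt (1/2) * ((1/2) ^ m / real m)) * exp (R / 2))) \<le> R ^ m"
    by (simp only:)
  then have le: "R * (R / 2 * (l * (wt (1/2) * ((1/2) ^ m / real m)) * exp (R / 2))) * (2 * real m)
      \<le> R ^ m * (2 * real m)"
    by (rule mult_right_mono) (rule mult_nonneg_nonneg, simp_all)
  have eq: "R * (R / 2 * (l * (wt (1/2) * ((1/2) ^ m / real m)) * exp (R / 2))) * (2 * real m)
      = l * (wt (1/2) * (1/2) ^ m * (R\<^sup>2 * exp (R / 2)))"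
  proof -
    have "R * (R / 2 * (l * (w * (h / M)) * E)) * (2 * M) = l * (w * h * (R\<^sup>2 * E))"
      if "M \<noteq> 0" for w h M E :: real
      using that by (simp add: power2_eq_square)
    note * = this
    show ?thesis by (rule *) (use m in simp)
  qed
  have "l * (wt (1/2) * (1/2) ^ m * (R\<^sup>2 * exp (R / 2))) \<le> 2 * real m * R ^ m"
    using le unfolding eq by (simp only: mult.commute)
  moreover have "0 < wt (1/2) * (1/2) ^ m * (R\<^sup>2 * exp (R / 2))"
    using R by (intro mult_pos_pos) auto
  ultimately have "l \<le> 2 * real m * R ^ m / (wt (1/2) * (1/2) ^ m * (R\<^sup>2 * exp (R / 2)))"
    by (simp only: pos_le_divide_eq)
  then show ?thesis
    by (simp only: eigenvalue_bound_def times_divide_eq_left divide_divide_eq_left)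
qed

lemma sol_cont_param:
  assumes "r \<in> {0..S}" shows "continuous_on {0..L} (\<lambda>l. sol m l r)"
proof -
  have "continuous_on {0..L} (\<lambda>l. (\<lambda>(r, l). sol m l r) (r, l))"
    by (rule continuous_on_compose2[OF sol_cont2[of S L m]])
       (use assms in \<open>auto intro!: continuous_intros\<close>)
  then show ?thesis by simp
qed

lemma nonvanishing_imp_pos:
  fixes f :: "real \<Rightarrow> real"
  assumes c: "continuous_on {a..b} f" and "0 < f a" and nz: "\<And>s. s \<in> {a..b} \<Longrightarrow> f s \<noteq> 0"
    and r: "r \<in> {a..b}"
  shows "0 < f r"
proof (rule ccontr)
  assume "\<not> 0 < f r"
  then have "\<exists>x\<ge>a. x \<le> r \<and> f x = 0"
    using assms by (intro IVT2') (auto intro: continuous_on_subset)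
  then show False using nz r by auto
qed

text \<open>
  Shooting. The zero set of \<open>(r, l) \<mapsto> sol m l r\<close> is compact, so it has a point with minimal \<open>l\<close>.
  For this \<open>l\<close> the solution is nonnegative: at a point with a negative value, a smaller \<open>l\<close> would
  give a zero, since \<open>l = 0\<close> gives the value \<open>1\<close>. It is also strictly decreasing; its only zero on \<open>[0, R]\<close> is therefore the end point.
\<close>

theorem radial_eigenvalue_exists:
  assumes m: "1 \<le> m" and R: "1 \<le> R"
  shows "\<exists>l>0. l \<le> eigenvalue_bound m R \<and> sol m l R = 0 \<and>
    (\<forall>r. 0 \<le> r \<longrightarrow> r < R \<longrightarrow> 0 < sol m l r) \<and> (\<forall>r\<in>{0..R}. 0 \<le> sol m l r)"
proof -
  define L where "L = eigenvalue_bound m R + 1"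
  have "0 \<le> eigenvalue_bound m R"
    unfolding eigenvalue_bound_def using R
    by (intro divide_nonneg_nonneg mult_nonneg_nonneg less_imp_le[OF wt_pos]) auto
  then have L: "0 < L" by (simp add: L_def)
  have pos: "0 < sol m l r" if "0 \<le> l" "\<And>s. s \<in> {0..R} \<Longrightarrow> sol m l s \<noteq> 0" "r \<in> {0..R}" for l r
    by (rule nonvanishing_imp_pos[OF sol_cont]) (use that sol_at_0 in auto)
  let ?F = "\<lambda>(r, l). sol m l r"
  define Z where "Z = ({0..R} \<times> {0..L}) \<inter> ?F -` {0}"
  have "compact Z"
  proof -
    have "closed Z"
      unfolding Z_def using R
      by (intro continuous_closed_preimage sol_cont2 closed_Times) auto
    moreover have "compact ({0..R} \<times> {0..L})" by (intro compact_Times) auto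
    ultimately have "compact (({0..R} \<times> {0..L}) \<inter> Z)" by (intro compact_Int_closed)
    then show ?thesis by (simp add: Z_def)
  qed
  moreover have "Z \<noteq> {}"
  proof
    assume "Z = {}"
    then have "sol m L s \<noteq> 0" if "s \<in> {0..R}" for s
    proof -
      have "(s, L) \<notin> Z" using \<open>Z = {}\<close> by simp
      then show ?thesis using that L by (simp add: Z_def)
    qed
    then have p: "0 < sol m L s" if "s \<in> {0..R}" for s
      using pos[of L s] L that by simp
    then have "L \<le> eigenvalue_bound m R"
      using L R by (intro positive_sol_imp_bound m) (auto intro: less_imp_le)
    then show False by (simp add: L_def)
  qed
  moreover have "continuous_on Z snd" by (intro continuous_intros)
  ultimately obtain z where z: "z \<in> Z" "\<And>y. y \<in> Z \<Longrightarrow> snd z \<le> snd y"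
    using continuous_attains_inf by metis
  obtain r0 l where zrl: "z = (r0, l)" by (cases z)
  have rl: "r0 \<in> {0..R}" "0 \<le> l" "l \<le> L" "sol m l r0 = 0"
    using z(1) by (auto simp: zrl Z_def)
  have min: "l \<le> l'" if "0 \<le> l'" "l' \<le> L" "r \<in> {0..R}" "sol m l' r = 0" for l' r
    using z(2)[of "(r, l')"] that by (auto simp: zrl Z_def)
  have sol0: "sol m 0 r = 1" if "r \<in> {0..R}" for r
    using sol_fixpoint[of 0 r R m] that by simp
  have "l \<noteq> 0" using rl sol0 by fastforce
  then have lpos: "0 < l" using rl by simp
  have nn: "0 \<le> sol m l r" if r: "r \<in> {0..R}" for r
  proof (rule ccontr)
    assume neg: "\<not> 0 \<le> sol m l r"
    have "\<exists>l'\<ge>0. l' \<le> l \<and> sol m l' r = 0"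
      using neg sol0[OF r] rl by (intro IVT2' sol_cont_param[OF r]) auto
    then obtain l' where "0 \<le> l'" "l' \<le> l" "sol m l' r = 0" by blast
    with min[OF _ _ r, of l'] rl neg show False by auto
  qed
  have dec: "sol m l s < sol m l r" if rs: "0 \<le> r" "r < s" "s \<le> R" for r s
  proof (rule DERIV_neg_imp_decreasing_open[OF rs(2)])
    show "continuous_on {r..s} (sol m l)"
      using rs by (intro continuous_on_subset[OF sol_cont[OF rl(2), of R]]) auto
    fix x assume x: "r < x" "x < s"
    have "0 < avg m (sol m l) x"
      by (rule avg_pos[OF sol_cont[OF rl(2), of R]]) (use x rs nn sol_at_0[OF rl(2)] in auto)
    then have "0 < l * x / wt x * avg m (sol m l) x"
      using lpos x rs by (intro mult_pos_pos divide_pos_pos) auto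
    then show "\<exists>y. (sol m l has_real_derivative y) (at x) \<and> y < 0"
      using sol_deriv[OF rl(2), of x R m] x rs by (intro exI[of _ "- l * x / wt x * avg m (sol m l) x"]) auto
  qed
  have p: "0 < sol m l r" if "0 \<le> r" "r < R" for r
    using dec[OF that] nn[of R] R by fastforce
  have "sol m l R = 0"
    using p[of r0] rl by (cases "r0 = R") auto
  moreover have "l \<le> eigenvalue_bound m R"
    using p[of "R / 2"] nn R rl by (intro positive_sol_imp_bound m) auto
  ultimately show ?thesis using lpos p nn by blast
qed

section \<open>The ground state in a ball\<close>

lemma real_vector_sum_square: "(\<Sum>i\<in>UNIV. (x $ i)\<^sup>2) = (norm x)\<^sup>2" for x :: "real^'n"
  by (simp add: norm_vec_def L2_set_def sum_nonneg)

text \<open>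
  A radial ground state, described by its profile \<open>f\<close> and by \<open>g\<close>, the function \<open>avg\<close> of \<open>f\<close>. The
  second order equation appears as the first order system for \<open>f\<close> and \<open>g\<close>, together with the value
  of \<open>g\<close> at the singular point \<open>r = 0\<close>. The set \<open>U\<close> is a parameter because it fixes the dimension.
\<close>

locale ground_state =
  fixes R l :: real and f g :: "real \<Rightarrow> real" and U :: "(real^'n) set"
  assumes R: "1 \<le> R" and l: "0 < l" and U_def: "U = ball 0 R"
    and f_cont: "continuous_on {0..R} f" and g_cont: "continuous_on {0..R} g"
    and f_pos: "\<And>r. 0 \<le> r \<Longrightarrow> r < R \<Longrightarrow> 0 < f r" and f_R: "f R = 0"
    and f_0: "f 0 = 1" and f_mono: "\<And>r s. 0 \<le> r \<Longrightarrow> r \<le> s \<Longrightarrow> s \<le> R \<Longrightarrow> f s \<le> f r"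
    and f_deriv: "\<And>r. 0 < r \<Longrightarrow> r < R \<Longrightarrow> (f has_real_derivative - l * r / wt r * g r) (at r)"
    and g_deriv: "\<And>r. 0 < r \<Longrightarrow> r < R \<Longrightarrow>
      (g has_real_derivative (wt r * f r - real CARD('n) * g r) / r) (at r)"
    and g_0: "real CARD('n) * g 0 = wt 0 * f 0"
begin

abbreviation M :: "(real^'n) measure" where "M \<equiv> lebesgue_on U"

definition u :: "real^'n \<Rightarrow> real" where "u x = f (norm x)"

definition W :: "real^'n \<Rightarrow> real" where "W x = wt (norm x)"

definition du :: "real^'n \<Rightarrow> real^'n" where "du x = (- l / W x * g (norm x)) *\<^sub>R x"

lemma U_open [simp]: "open U" and U_bounded: "bounded U" and U_convex: "convex U"
  by (auto simp: U_def)

lemma in_U: "x \<in> U \<longleftrightarrow> norm x < R"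
  by (simp add: U_def)

lemma u_pos: "x \<in> U \<Longrightarrow> 0 < u x"
  by (simp add: in_U u_def f_pos)

lemma u_le_1: "x \<in> U \<Longrightarrow> u x \<le> 1"
  using f_mono[of 0 "norm x"] by (simp add: in_U u_def f_0)

lemma W_pos [simp]: "0 < W x" and W_nonzero [simp]: "W x \<noteq> 0" and W_le_1: "W x \<le> 1"
  by (simp_all add: W_def wt_le_1)

lemma W_cont: "continuous_on S W"
  unfolding W_def by (intro continuous_intros)

lemma radial_cont:
  "continuous_on {0..R} h \<Longrightarrow> continuous_on (cball 0 R) (\<lambda>x. h (norm x))"
  by (rule continuous_on_compose2[of "{0..R}"]) (auto intro!: continuous_intros)

lemma radial_cont_U: "continuous_on {0..R} h \<Longrightarrow> continuous_on U (\<lambda>x. h (norm x))"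
  by (rule continuous_on_subset[OF radial_cont]) (auto simp: U_def)

lemma u_cont_U: "continuous_on U u"
  unfolding u_def by (rule radial_cont_U[OF f_cont])

lemma du_cont: "continuous_on (cball 0 R) du"
  unfolding du_def by (intro continuous_intros W_cont radial_cont[OF g_cont]) simp

lemma du_cont_U: "continuous_on U du"
  by (rule continuous_on_subset[OF du_cont]) (auto simp: U_def)

lemma g_bounded: obtains B where "0 < B" "\<And>r. 0 \<le> r \<Longrightarrow> r \<le> R \<Longrightarrow> \<bar>g r\<bar> \<le> B"
proof -
  have "bounded (g ` {0..R})"
    by (intro compact_imp_bounded compact_continuous_image g_cont) simp
  then obtain B where "0 < B" "\<And>r. r \<in> {0..R} \<Longrightarrow> \<bar>g r\<bar> \<le> B"
    by (auto simp: bounded_pos)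
  then show thesis by (intro that[of B]) auto
qed

lemma norm_has_derivative:
  "x \<noteq> 0 \<Longrightarrow> (norm has_derivative (\<lambda>v. (x \<bullet> v) / norm x)) (at x)" for x :: "real^'n"
  using has_derivative_norm[of x]
  by (simp add: sgn_div_norm inner_commute divide_inverse mult.commute)

lemma u_deriv:
  assumes "x \<in> U" shows "(u has_derivative (\<lambda>v. du x \<bullet> v)) (at x)"
proof (cases "x = 0")
  case False
  then have x: "0 < norm x" "norm x < R" using assms by (auto simp: in_U)
  have "(f has_derivative (\<lambda>h. (- l * norm x / wt (norm x) * g (norm x)) * h)) (at (norm x))"
    using f_deriv[OF x] by (simp only: has_field_derivative_def)
  from has_derivative_compose[OF norm_has_derivative[OF False] this]
  have "(u has_derivative (\<lambda>v. (- l * norm x / wt (norm x) * g (norm x)) * ((x \<bullet> v) / norm x))) (at x)"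
    unfolding u_def .
  moreover have "(- l * norm x / wt (norm x) * g (norm x)) * ((x \<bullet> v) / norm x) = du x \<bullet> v" for v
    using x(1) by (simp add: du_def W_def)
  ultimately show ?thesis by simp
next
  case True
  \<comment> \<open>The slope of \<open>f\<close> at \<open>r\<close> is at most \<open>C r\<close>, so \<open>f\<close> differs from \<open>f 0\<close> by at most \<open>C r\<^sup>2\<close>.\<close>
  obtain B where B: "0 < B" "\<And>r. 0 \<le> r \<Longrightarrow> r \<le> R \<Longrightarrow> \<bar>g r\<bar> \<le> B" using g_bounded by blast
  let ?C = "l / wt R * B"
  have C: "0 \<le> ?C" using l B less_imp_le[OF wt_pos[of R]] by simp
  have bd: "\<bar>f r - f 0\<bar> \<le> ?C * r\<^sup>2" if r: "0 < r" "r < R" for r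
  proof -
    have cont: "continuous_on {0..r} f"
      using r by (intro continuous_on_subset[OF f_cont]) auto
    have "\<exists>z. 0 < z \<and> z < r \<and> f r - f 0 = (r - 0) * (- l * z / wt z * g z)"
    proof -
      have "\<And>x. 0 < x \<Longrightarrow> x < r \<Longrightarrow> f differentiable (at x)"
        using f_deriv r by (metis less_trans real_differentiable_def)
      from MVT[OF r(1) cont this] obtain D z where z: "0 < z" "z < r"
        "(f has_real_derivative D) (at z)" "f r - f 0 = (r - 0) * D" by blast
      moreover have "(f has_real_derivative - l * z / wt z * g z) (at z)"
        using z r by (intro f_deriv) auto
      ultimately have "D = - l * z / wt z * g z"
        using DERIV_unique by blast
      with z show ?thesis by blast
    qed
    then obtain z where z: "0 < z" "z < r" "f r - f 0 = r * (- l * z / wt z * g z)" by auto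
    have "\<bar>f r - f 0\<bar> = r * (l / wt z * \<bar>g z\<bar> * z)"
      using z(1,3) r l by (simp add: abs_mult abs_of_pos[OF wt_pos] mult_ac)
    also have "\<dots> \<le> r * (?C * r)"
    proof (intro mult_left_mono mult_mono)
      show "l / wt z \<le> l / wt R"
        using z r l wt_antimono[of z R] by (intro divide_left_mono) auto
    qed (use z r l B C in \<open>auto simp: less_imp_le\<close>)
    finally show ?thesis by (simp add: power2_eq_square mult_ac)
  qed
  have "((\<lambda>y. norm (u y - u 0) / norm y) \<longlongrightarrow> 0) (at 0)"
  proof (rule Lim_null_comparison)
    have "\<forall>\<^sub>F y in at 0. y \<in> U \<and> y \<noteq> 0"
      using R eventually_at_in_open[of U 0] by (simp add: in_U)
    then show "\<forall>\<^sub>F y in at 0. norm (norm (u y - u 0) / norm y) \<le> ?C * norm y"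
    proof eventually_elim
      case (elim y)
      then have "\<bar>u y - u 0\<bar> \<le> ?C * (norm y)\<^sup>2"
        using bd[of "norm y"] by (simp add: u_def in_U)
      then have "\<bar>u y - u 0\<bar> / norm y \<le> ?C * (norm y)\<^sup>2 / norm y"
        by (rule divide_right_mono) simp
      then show ?case using elim by (simp add: power2_eq_square)
    qed
    show "((\<lambda>y::real^'n. ?C * norm y) \<longlongrightarrow> 0) (at 0)"
      by (auto intro!: tendsto_eq_intros)
  qed
  then show ?thesis using True by (simp add: has_derivative_iff_norm du_def)
qed

text \<open>
  The vector field \<open>x \<mapsto> g \<bar>x\<bar> x\<close> is \<open>- W du / l\<close>. Its divergence is \<open>W u\<close>; this is the eigenvalue
  equation in divergence form.
\<close>

definition X :: "'n \<Rightarrow> real^'n \<Rightarrow> real" where "X i x = g (norm x) * x $ i"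

definition X' :: "'n \<Rightarrow> real^'n \<Rightarrow> real^'n \<Rightarrow> real" where
  "X' i x v = (W x * u x - real CARD('n) * g (norm x)) * (x \<bullet> v) / (norm x)\<^sup>2 * x $ i + g (norm x) * v $ i"

lemma X_deriv:
  assumes "x \<in> U" shows "(X i has_derivative X' i x) (at x)"
proof (cases "x = 0")
  case False
  then have x: "0 < norm x" "norm x < R" using assms by (auto simp: in_U)
  let ?D = "(wt (norm x) * f (norm x) - real CARD('n) * g (norm x)) / norm x"
  have "(g has_derivative (\<lambda>h. ?D * h)) (at (norm x))"
    using g_deriv[OF x] by (simp only: has_field_derivative_def)
  from has_derivative_compose[OF norm_has_derivative[OF False] this]
  have "((\<lambda>x. g (norm x) * x $ i) has_derivative
      (\<lambda>v. g (norm x) * v $ i + ?D * ((x \<bullet> v) / norm x) * x $ i)) (at x)"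
    by (rule has_derivative_mult)
       (rule bounded_linear.has_derivative[OF bounded_linear_vec_nth has_derivative_ident])
  moreover have "g (norm x) * v $ i + ?D * ((x \<bullet> v) / norm x) * x $ i = X' i x v" for v
    by (simp add: X'_def W_def u_def power2_eq_square)
  ultimately show ?thesis by (simp add: X_def[abs_def])
next
  case True
  have "((\<lambda>y. g (norm y) - g 0) \<longlongrightarrow> 0) (at (0::real^'n))"
  proof -
    have "isCont (\<lambda>y::real^'n. g (norm y)) 0"
      using radial_cont_U[OF g_cont] R by (simp add: continuous_on_eq_continuous_at in_U)
    then show ?thesis by (simp add: isCont_def LIM_zero)
  qed
  then have "((\<lambda>y. norm (X i y - X i 0 - g 0 * y $ i) / norm y) \<longlongrightarrow> 0) (at 0)"
  proof (rule Lim_null_comparison[rotated, OF tendsto_norm_zero])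
    have "norm (norm (X i y - X i 0 - g 0 * y $ i) / norm y) \<le> norm (g (norm y) - g 0)" for y
    proof (cases "y = 0")
      case False
      have "norm (X i y - X i 0 - g 0 * y $ i) = \<bar>g (norm y) - g 0\<bar> * \<bar>y $ i\<bar>"
        by (simp add: X_def left_diff_distrib flip: abs_mult)
      also have "\<dots> \<le> \<bar>g (norm y) - g 0\<bar> * norm y"
        by (intro mult_left_mono component_le_norm_cart) simp
      finally show ?thesis using False by (simp add: divide_le_eq)
    qed simp
    then show "\<forall>\<^sub>F y in at 0. norm (norm (X i y - X i 0 - g 0 * y $ i) / norm y) \<le> norm (g (norm y) - g 0)"
      by simp
  qed
  moreover have "bounded_linear (\<lambda>v::real^'n. g 0 * v $ i)"
    by (intro bounded_linear_const_mult bounded_linear_vec_nth)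
  ultimately show ?thesis
    using True by (simp add: has_derivative_iff_norm X'_def[abs_def])
qed

lemma X_divergence: "x \<in> U \<Longrightarrow> (\<Sum>i\<in>UNIV. X' i x (axis i 1)) = W x * u x"
proof (cases "x = 0")
  case True
  then show ?thesis using g_0 by (simp add: X'_def W_def u_def)
next
  case False
  let ?c = "W x * u x - real CARD('n) * g (norm x)"
  have "X' i x (axis i 1) = ?c / (norm x)\<^sup>2 * (x $ i)\<^sup>2 + g (norm x)" for i
    by (simp add: X'_def inner_axis power2_eq_square)
  then have "(\<Sum>i\<in>UNIV. X' i x (axis i 1)) = ?c / (norm x)\<^sup>2 * (norm x)\<^sup>2 + real CARD('n) * g (norm x)"
    by (simp only: sum.distrib real_vector_sum_square sum_distrib_left[symmetric] sum_constant)
  then show ?thesis using False by simp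
qed

lemma X'_bounded: obtains B where "\<And>i x. x \<in> U \<Longrightarrow> \<bar>X' i x (axis i 1)\<bar> \<le> B"
proof -
  obtain B where B: "0 < B" "\<And>r. 0 \<le> r \<Longrightarrow> r \<le> R \<Longrightarrow> \<bar>g r\<bar> \<le> B" using g_bounded by blast
  show thesis
  proof (rule that)
    fix i :: 'n and x assume x: "x \<in> U"
    let ?c = "W x * u x - real CARD('n) * g (norm x)"
    have gB: "\<bar>g (norm x)\<bar> \<le> B" using B(2)[of "norm x"] x by (simp add: in_U)
    have "W x * u x \<le> 1 * 1"
      using u_pos[OF x] u_le_1[OF x] W_le_1 by (intro mult_mono) (auto simp: less_imp_le)
    moreover have "0 \<le> W x * u x" using u_pos[OF x] by (simp add: less_imp_le)
    moreover have "\<bar>real CARD('n) * g (norm x)\<bar> \<le> real CARD('n) * B"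
      using gB by (simp add: abs_mult mult_left_mono)
    ultimately have c: "\<bar>?c\<bar> \<le> 1 + real CARD('n) * B" by linarith
    have "(x $ i)\<^sup>2 \<le> (norm x)\<^sup>2"
      using component_le_norm_cart[of x i] abs_le_square_iff[of "x $ i" "norm x"] by simp
    then have q: "(x $ i)\<^sup>2 / (norm x)\<^sup>2 \<le> 1" by (simp add: divide_le_eq)
    have "X' i x (axis i 1) = ?c * ((x $ i)\<^sup>2 / (norm x)\<^sup>2) + g (norm x)"
      by (simp add: X'_def inner_axis power2_eq_square)
    also have "\<bar>\<dots>\<bar> \<le> \<bar>?c\<bar> * ((x $ i)\<^sup>2 / (norm x)\<^sup>2) + \<bar>g (norm x)\<bar>"
      by (rule order_trans[OF abs_triangle_ineq]) (simp add: abs_mult)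
    also have "\<dots> \<le> (1 + real CARD('n) * B) * 1 + B"
      using c q gB B by (intro add_mono mult_mono) auto
    finally show "\<bar>X' i x (axis i 1)\<bar> \<le> (1 + real CARD('n) * B) * 1 + B" .
  qed
qed

text \<open>
  The divergence of \<open>\<eta> X\<close> is \<open>X \<bullet> \<nabla>\<eta> + W u \<eta>\<close>, and its integral vanishes.
\<close>

lemma weak_equation:
  fixes \<eta> :: "real^'n \<Rightarrow> complex"
  assumes K: "compact K" "K \<subseteq> U"
    and \<eta>: "\<And>x. x \<in> U \<Longrightarrow> (\<eta> has_derivative \<eta>' x) (at x)"
    and \<eta>'_cont: "\<And>i. continuous_on U (\<lambda>x. \<eta>' x (axis i 1))"
    and supp: "\<And>x. x \<notin> K \<Longrightarrow> \<eta> x = 0"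
  shows "(\<integral>x. (\<Sum>i\<in>UNIV. of_real (W x * du x $ i) * \<eta>' x (axis i 1)) \<partial>M)
    = of_real l * (\<integral>x. of_real (W x * u x) * \<eta> x \<partial>M)"
proof -
  obtain A where A: "\<And>i x. x \<in> U \<Longrightarrow> \<bar>X' i x (axis i 1)\<bar> \<le> A" using X'_bounded by blast
  have \<eta>0: "\<eta>' x (axis i 1) = 0" if "x \<in> U - K" for x i
    using has_derivative_zero_off_support[of K x \<eta> "\<eta>' x"] that K supp \<eta> by (auto simp: compact_imp_closed)
  have part: "integrable M (\<lambda>x. X i x *\<^sub>R \<eta>' x (axis i 1) + X' i x (axis i 1) *\<^sub>R \<eta> x)"
    "(\<integral>x. X i x *\<^sub>R \<eta>' x (axis i 1) + X' i x (axis i 1) *\<^sub>R \<eta> x \<partial>M) = 0" for i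
  proof -
    have "bounded ((\<lambda>x. \<eta>' x (axis i 1)) ` K)"
      using K by (intro compact_imp_bounded compact_continuous_image continuous_on_subset[OF \<eta>'_cont])
    then obtain B where B: "\<And>x. x \<in> K \<Longrightarrow> norm (\<eta>' x (axis i 1)) \<le> B"
      by (auto simp: bounded_iff)
    have A': "\<bar>X' i x (axis i 1)\<bar> \<le> A" if "x \<in> K" for x using A K that by blast
    show "integrable M (\<lambda>x. X i x *\<^sub>R \<eta>' x (axis i 1) + X' i x (axis i 1) *\<^sub>R \<eta> x)"
      "(\<integral>x. X i x *\<^sub>R \<eta>' x (axis i 1) + X' i x (axis i 1) *\<^sub>R \<eta> x \<partial>M) = 0"
      using integral_by_parts_zero[OF U_open K X_deriv \<eta> supp A' B] by auto
  qed
  have Xc: "continuous_on U (X i)" for i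
    unfolding X_def[abs_def] by (intro continuous_intros radial_cont_U[OF g_cont])
  have \<eta>_cont: "continuous_on U \<eta>"
    using \<eta> by (meson continuous_at_imp_continuous_on has_derivative_continuous)
  have int1: "integrable M (\<lambda>x. \<Sum>i\<in>UNIV. X i x *\<^sub>R \<eta>' x (axis i 1))"
    by (rule integrable_compact_support[OF U_open K])
       (auto intro!: continuous_intros Xc \<eta>'_cont simp: \<eta>0)
  have int2: "integrable M (\<lambda>x. of_real (W x * u x) * \<eta> x)"
    by (rule integrable_compact_support[OF U_open K])
       (auto intro!: continuous_intros W_cont u_cont_U \<eta>_cont simp: supp)
  have "0 = (\<integral>x. (\<Sum>i\<in>UNIV. X i x *\<^sub>R \<eta>' x (axis i 1) + X' i x (axis i 1) *\<^sub>R \<eta> x) \<partial>M)"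
    using part by (simp add: integral_sum)
  also have "\<dots> = (\<integral>x. (\<Sum>i\<in>UNIV. X i x *\<^sub>R \<eta>' x (axis i 1)) + of_real (W x * u x) * \<eta> x \<partial>M)"
  proof (rule Bochner_Integration.integral_cong[OF refl])
    fix x assume "x \<in> space M"
    then have "x \<in> U" by simp
    then show "(\<Sum>i\<in>UNIV. X i x *\<^sub>R \<eta>' x (axis i 1) + X' i x (axis i 1) *\<^sub>R \<eta> x)
        = (\<Sum>i\<in>UNIV. X i x *\<^sub>R \<eta>' x (axis i 1)) + of_real (W x * u x) * \<eta> x"
      using X_divergence[OF \<open>x \<in> U\<close>]
      by (simp add: sum.distrib flip: scaleR_sum_left scaleR_conv_of_real)
  qed
  also have "\<dots> = (\<integral>x. (\<Sum>i\<in>UNIV. X i x *\<^sub>R \<eta>' x (axis i 1)) \<partial>M) + (\<integral>x. of_real (W x * u x) * \<eta> x \<partial>M)"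
    using int1 int2 by simp
  finally have *: "(\<integral>x. (\<Sum>i\<in>UNIV. X i x *\<^sub>R \<eta>' x (axis i 1)) \<partial>M) = - (\<integral>x. of_real (W x * u x) * \<eta> x \<partial>M)"
    by (simp add: eq_neg_iff_add_eq_0)
  have "W x * du x $ i = - l * X i x" for i x
    by (simp add: du_def X_def)
  then have "(\<integral>x. (\<Sum>i\<in>UNIV. of_real (W x * du x $ i) * \<eta>' x (axis i 1)) \<partial>M)
      = (\<integral>x. of_real (- l) * (\<Sum>i\<in>UNIV. X i x *\<^sub>R \<eta>' x (axis i 1)) \<partial>M)"
    by (simp add: sum_distrib_left scaleR_conv_of_real mult.assoc)
  also have "\<dots> = of_real l * (\<integral>x. of_real (W x * u x) * \<eta> x \<partial>M)"
    using * by simp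
  finally show ?thesis .
qed

end

section \<open>The drift and its weight\<close>

text \<open>
  The gradient of \<open>V x = - sqrt (1 + \<bar>x\<bar>\<^sup>2)\<close>.
\<close>

definition drift :: "real^'n \<Rightarrow> real^'n" where
  "drift x = - ((1 / sqrt (1 + (norm x)\<^sup>2)) *\<^sub>R x)"

lemma sqrt_one_plus_norm_deriv:
  "((\<lambda>x. sqrt (1 + (norm x)\<^sup>2)) has_derivative (\<lambda>v. (x \<bullet> v) / sqrt (1 + (norm x)\<^sup>2))) (at x)"
  for x :: "'a::real_inner"
proof -
  have pos: "0 < 1 + x \<bullet> x" by (simp add: add_pos_nonneg)
  have "((\<lambda>x. 1 + x \<bullet> x) has_derivative (\<lambda>v. 2 * (x \<bullet> v))) (at x)"
    by (auto intro!: derivative_eq_intros simp: inner_commute)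
  moreover have "(sqrt has_derivative (\<lambda>h. inverse (sqrt (1 + x \<bullet> x)) / 2 * h)) (at (1 + x \<bullet> x))"
    using DERIV_real_sqrt[OF pos] by (simp only: has_field_derivative_def)
  ultimately have "((\<lambda>x. sqrt (1 + x \<bullet> x)) has_derivative
      (\<lambda>v. inverse (sqrt (1 + x \<bullet> x)) / 2 * (2 * (x \<bullet> v)))) (at x)"
    by (rule has_derivative_compose)
  moreover have "inverse s / 2 * (2 * a) = a / s" for s a :: real
    by (simp add: field_simps)
  ultimately show ?thesis by (simp only: power2_norm_eq_inner)
qed

lemma Ck_inverse_sqrt: "Ck k (\<lambda>x::real^'n. 1 / sqrt (1 + (norm x)\<^sup>2))"
proof (rule smooth_bootstrap)
  let ?s = "\<lambda>x::real^'n. sqrt (1 + (norm x)\<^sup>2)"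
  fix x :: "real^'n"
  have pos: "0 < ?s x" by (simp add: add_pos_nonneg)
  have "((\<lambda>x. inverse (?s x)) has_derivative
      (\<lambda>v. - (inverse (?s x) * ((x \<bullet> v) / ?s x) * inverse (?s x)))) (at x)"
    using pos by (intro Deriv.has_derivative_inverse sqrt_one_plus_norm_deriv) simp
  then show "((\<lambda>x. 1 / ?s x) has_derivative (\<lambda>v. (- 1) * (x \<bullet> v) * (1 / ?s x) ^ 3)) (at x)"
    by (simp add: inverse_eq_divide power3_eq_cube)
next
  fix k and v :: "real^'n"
  assume "Ck k (\<lambda>x::real^'n. 1 / sqrt (1 + (norm x)\<^sup>2))"
  then show "Ck k (\<lambda>x::real^'n. (- 1) * (x \<bullet> v) * (1 / sqrt (1 + (norm x)\<^sup>2)) ^ 3)"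
    by (intro Ck_mult Ck_const Ck_inner Ck_id Ck_power)
qed

lemma smooth_drift: "smooth (drift :: real^'n \<Rightarrow> real^'n)"
proof -
  have "Ck k (\<lambda>x::real^'n. (- 1) *\<^sub>R ((1 / sqrt (1 + (norm x)\<^sup>2)) *\<^sub>R x))" for k
    by (intro Ck_scaleR Ck_const Ck_inverse_sqrt Ck_id)
  then show ?thesis by (simp add: smooth_def drift_def[abs_def])
qed

lemma drift_deriv_potential:
  "((\<lambda>x. - sqrt (1 + (norm x)\<^sup>2)) has_derivative (\<lambda>v. drift x \<bullet> v)) (at x)" for x :: "real^'n"
  using has_derivative_minus[OF sqrt_one_plus_norm_deriv[of x]] by (simp add: drift_def)

lemma weight_deriv:
  "((\<lambda>x. wt (norm x)) has_derivative (\<lambda>v. wt (norm x) * (drift x \<bullet> v))) (at x)" for x :: "real^'n"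
  using has_derivative_exp[OF drift_deriv_potential] by (simp add: wt_def mult.commute)

lemma weight_inverse_deriv:
  "((\<lambda>x. 1 / wt (norm x)) has_derivative (\<lambda>v. - (drift x \<bullet> v) / wt (norm x))) (at x)" for x :: "real^'n"
proof -
  have "((\<lambda>x. exp (- (- sqrt (1 + (norm x)\<^sup>2)))) has_derivative
      (\<lambda>v. (- (drift x \<bullet> v)) * exp (- (- sqrt (1 + (norm x)\<^sup>2))))) (at x)"
    by (intro has_derivative_exp has_derivative_minus drift_deriv_potential)
  then show ?thesis by (simp add: wt_def exp_minus inverse_eq_divide)
qed

lemma Ck_drift_inner: "Ck k (\<lambda>x::real^'n. drift x \<bullet> v)"
  by (intro Ck_inner Ck_const smooth_drift[unfolded smooth_def, rule_format])

lemma Ck_weight: "Ck k (\<lambda>x::real^'n. wt (norm x))"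
  by (rule smooth_bootstrap[OF weight_deriv]) (intro Ck_mult Ck_drift_inner)

lemma norm_drift: "norm (drift x) = norm x / sqrt (1 + (norm x)\<^sup>2)"
  by (simp add: drift_def)

lemma norm_drift_le: "norm (drift x) \<le> 1"
proof -
  have "norm x \<le> sqrt (1 + (norm x)\<^sup>2)" by (rule real_le_rsqrt) simp
  moreover have "0 < sqrt (1 + (norm x)\<^sup>2)" by (simp add: add_pos_nonneg)
  ultimately show ?thesis by (simp add: norm_drift divide_le_eq)
qed

section \<open>Test functions\<close>

lemma grad_nth: "grad \<psi> x $ i = frechet_derivative \<psi> (at x) (axis i 1)"
  by (simp add: grad_def)

lemma grad_eqI:
  assumes "(\<psi> has_derivative D) (at x)" shows "grad \<psi> x $ i = D (axis i 1)"
  using frechet_derivative_at[OF assms] by (simp add: grad_nth)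

lemma test_fun_deriv:
  assumes "test_fun U \<psi>" shows "(\<psi> has_derivative frechet_derivative \<psi> (at x)) (at x)"
  using assms Ck_SucD(1)[of 0 \<psi>] by (simp add: test_fun_def smooth_def del: Ck.simps)

lemma test_fun_cont: "test_fun U \<psi> \<Longrightarrow> continuous_on S \<psi>"
  using has_derivative_continuous[OF test_fun_deriv] by (intro continuous_at_imp_continuous_on) blast

lemma test_fun_grad_cont:
  assumes "test_fun U \<psi>" shows "continuous_on S (\<lambda>x. grad \<psi> x $ i)"
proof -
  have "Ck 0 (\<lambda>x. frechet_derivative \<psi> (at x) (axis i 1))"
    using assms Ck_SucD(2)[of 0 \<psi>] by (simp add: test_fun_def smooth_def del: Ck.simps)
  then show ?thesis by (auto simp: grad_nth intro: continuous_on_subset)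
qed

lemma test_fun_support:
  assumes "test_fun U \<psi>"
  shows "\<exists>K. compact K \<and> K \<subseteq> U \<and> (\<forall>x. x \<notin> K \<longrightarrow> \<psi> x = 0 \<and> grad \<psi> x = 0)"
proof (intro exI conjI allI impI)
  let ?K = "closure {x. \<psi> x \<noteq> 0}"
  show "compact ?K" "?K \<subseteq> U" using assms by (auto simp: test_fun_def)
  have *: "\<psi> x = 0" if "x \<notin> ?K" for x
    using that closure_subset[of "{x. \<psi> x \<noteq> 0}"] by auto
  then show "x \<notin> ?K \<Longrightarrow> \<psi> x = 0" for x .
  show "grad \<psi> x = 0" if "x \<notin> ?K" for x
    using has_derivative_zero_off_support[OF closed_closure that * test_fun_deriv[OF assms]]
    by (simp add: vec_eq_iff grad_nth)
qed

lemma test_funI: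
  assumes "\<And>k. Ck k \<psi>" "compact K" "K \<subseteq> U" "\<And>x. \<psi> x \<noteq> 0 \<Longrightarrow> x \<in> K"
  shows "test_fun U \<psi>"
proof -
  have sub: "closure {x. \<psi> x \<noteq> 0} \<subseteq> K"
    using assms by (intro closure_minimal) (auto simp: compact_imp_closed)
  then have "compact (closure {x. \<psi> x \<noteq> 0})"
    using assms(2) by (metis closed_closure compact_Int_closed inf.absorb_iff2)
  with sub assms show ?thesis by (auto simp: test_fun_def smooth_def)
qed

lemma test_fun_Ck: "test_fun U \<psi> \<Longrightarrow> Ck k \<psi>"
  by (simp add: test_fun_def smooth_def)

lemma test_fun_mult:
  assumes h: "\<And>k. Ck k h" and \<psi>: "test_fun U \<psi>" shows "test_fun U (\<lambda>x. h x * \<psi> x)"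
proof -
  obtain K where K: "compact K" "K \<subseteq> U" "\<forall>x. x \<notin> K \<longrightarrow> \<psi> x = 0 \<and> grad \<psi> x = 0"
    using test_fun_support[OF \<psi>] by blast
  have "x \<in> K" if "h x * \<psi> x \<noteq> 0" for x using K(3) that by auto
  with K(1,2) Ck_mult[OF h test_fun_Ck[OF \<psi>]] show ?thesis by (intro test_funI)
qed

lemma test_fun_cnj:
  assumes \<psi>: "test_fun U \<psi>" shows "test_fun U (\<lambda>x. cnj (\<psi> x))"
proof -
  obtain K where K: "compact K" "K \<subseteq> U" "\<forall>x. x \<notin> K \<longrightarrow> \<psi> x = 0 \<and> grad \<psi> x = 0"
    using test_fun_support[OF \<psi>] by blast
  have "x \<in> K" if "cnj (\<psi> x) \<noteq> 0" for x using K(3) that by auto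
  with K(1,2) Ck_bounded_linear_comp[OF bounded_linear_cnj test_fun_Ck[OF \<psi>]]
  show ?thesis by (intro test_funI)
qed

lemma grad_cnj: "test_fun U \<psi> \<Longrightarrow> grad (\<lambda>x. cnj (\<psi> x)) x $ i = cnj (grad \<psi> x $ i)"
  using grad_eqI[OF bounded_linear.has_derivative[OF bounded_linear_cnj test_fun_deriv]]
  by (simp add: grad_nth)

lemma test_fun_weighted:
  assumes "test_fun U \<psi>" shows "test_fun U (\<lambda>x. of_real (wt (norm x)) * \<psi> x)"
  by (intro test_fun_mult Ck_bounded_linear_comp[OF bounded_linear_of_real] Ck_weight assms)

lemma grad_weighted:
  assumes "test_fun U \<psi>"
  shows "grad (\<lambda>x. of_real (wt (norm x)) * \<psi> x) x $ i
    = of_real (wt (norm x)) * (grad \<psi> x $ i + of_real (drift x $ i) * \<psi> x)"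
proof -
  have "((\<lambda>x. complex_of_real (wt (norm x))) has_derivative
      (\<lambda>v. of_real (wt (norm x) * (drift x \<bullet> v)))) (at x)"
    by (rule bounded_linear.has_derivative[OF bounded_linear_of_real weight_deriv])
  from grad_eqI[OF has_derivative_mult[OF this test_fun_deriv[OF assms]]]
  show ?thesis by (simp add: grad_nth inner_axis algebra_simps)
qed

text \<open>
  Testing with \<open>e\<^sup>V \<psi>\<close>, where the drift is the gradient of \<open>V\<close>, removes the first order term: the
  operator is symmetric with respect to the weight \<open>e\<^sup>V\<close>.
\<close>

lemma dirichlet_sol_weighted:
  assumes "dirichlet_sol drift U v h"
  shows "\<exists>G. H10 U v G \<and> (\<forall>\<psi>. test_fun U \<psi> \<longrightarrow>
      (\<integral>x. (\<Sum>i\<in>UNIV. of_real (wt (norm x)) * G x $ i * grad \<psi> x $ i) \<partial>lebesgue_on U)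
      = (\<integral>x. of_real (wt (norm x)) * h x * \<psi> x \<partial>lebesgue_on U))"
proof -
  obtain G where G: "H10 U v G" and eq: "\<And>\<psi>. test_fun U \<psi> \<Longrightarrow>
     (\<integral>x. (\<Sum>i\<in>UNIV. (G x $ i) * (grad \<psi> x $ i))
          - (\<Sum>i\<in>UNIV. of_real (drift x $ i) * (G x $ i)) * \<psi> x \<partial>lebesgue_on U)
     = (\<integral>x. h x * \<psi> x \<partial>lebesgue_on U)"
    using assms unfolding dirichlet_sol_def by blast
  show ?thesis
  proof (intro exI conjI allI impI)
    show "H10 U v G" by (rule G)
    fix \<psi> assume \<psi>: "test_fun U \<psi>"
    have "(\<Sum>i\<in>UNIV. of_real (wt (norm x)) * G x $ i * grad \<psi> x $ i)
      = (\<Sum>i\<in>UNIV. (G x $ i) * (grad (\<lambda>x. of_real (wt (norm x)) * \<psi> x) x $ i))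
          - (\<Sum>i\<in>UNIV. of_real (drift x $ i) * (G x $ i)) * (of_real (wt (norm x)) * \<psi> x)" for x
      unfolding grad_weighted[OF \<psi>] sum_distrib_right sum_subtractf[symmetric]
      by (intro sum.cong) (auto simp: algebra_simps)
    then show "(\<integral>x. (\<Sum>i\<in>UNIV. of_real (wt (norm x)) * G x $ i * grad \<psi> x $ i) \<partial>lebesgue_on U)
      = (\<integral>x. of_real (wt (norm x)) * h x * \<psi> x \<partial>lebesgue_on U)"
      using eq[OF test_fun_weighted[OF \<psi>]] by (simp add: mult_ac)
  qed
qed

section \<open>Square integrable functions\<close>

lemma emeasure_lebesgue_on_bounded:
  assumes "bounded U" "open U" shows "emeasure (lebesgue_on U) (space (lebesgue_on U)) < \<infinity>"
  using emeasure_bounded_finite[OF assms(1)] assms(2)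
  by (simp add: emeasure_restrict_space)

lemma borel_measurable_lebesgue_on_cont:
  "open U \<Longrightarrow> continuous_on U f \<Longrightarrow> f \<in> borel_measurable (lebesgue_on U)"
  by (intro continuous_imp_measurable_on_sets_lebesgue) auto

lemma L2_sq_tendsto_0:
  fixes d :: "nat \<Rightarrow> real^'n \<Rightarrow> 'b::{real_normed_vector, second_countable_topology}"
  assumes U: "bounded U" "open U" and m: "\<And>k. d k \<in> borel_measurable (lebesgue_on U)"
    and bd: "\<And>k x. x \<in> U \<Longrightarrow> norm (d k x) \<le> B"
    and lim: "\<And>x. x \<in> U \<Longrightarrow> (\<lambda>k. d k x) \<longlonglongrightarrow> 0"
  shows "(\<lambda>k. L2_sq U (d k)) \<longlonglongrightarrow> 0"
proof -
  have "(\<lambda>k. \<integral>\<^sup>+x. ennreal ((norm (d k x))\<^sup>2) \<partial>lebesgue_on U) \<longlonglongrightarrow> (\<integral>\<^sup>+x. 0 \<partial>lebesgue_on U)"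
  proof (rule nn_integral_dominated_convergence[where w = "\<lambda>_. ennreal (B\<^sup>2)"])
    show "(\<integral>\<^sup>+x. ennreal (B\<^sup>2) \<partial>lebesgue_on U) < \<infinity>"
      using emeasure_lebesgue_on_bounded[OF U] by (simp add: ennreal_mult_less_top)
    show "AE x in lebesgue_on U. ennreal ((norm (d k x))\<^sup>2) \<le> ennreal (B\<^sup>2)" for k
      using bd by (intro AE_I2 ennreal_leI power_mono) auto
    show "AE x in lebesgue_on U. (\<lambda>k. ennreal ((norm (d k x))\<^sup>2)) \<longlonglongrightarrow> 0"
    proof (rule AE_I2)
      fix x assume "x \<in> space (lebesgue_on U)"
      then have "(\<lambda>k. (norm (d k x))\<^sup>2) \<longlonglongrightarrow> 0\<^sup>2"
        by (intro tendsto_power tendsto_norm_zero lim) simp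
      then show "(\<lambda>k. ennreal ((norm (d k x))\<^sup>2)) \<longlonglongrightarrow> 0"
        using tendsto_ennrealI by fastforce
    qed
  qed (use m in measurable)
  then show ?thesis by (simp add: L2_sq_def)
qed

lemma L2_bounded:
  fixes f :: "real^'n \<Rightarrow> 'b::{real_normed_vector, second_countable_topology}"
  assumes U: "bounded U" "open U" and m: "f \<in> borel_measurable (lebesgue_on U)"
    and bd: "\<And>x. x \<in> U \<Longrightarrow> norm (f x) \<le> B"
  shows "L2 U f"
proof -
  have "L2_sq U f \<le> (\<integral>\<^sup>+x. ennreal (B\<^sup>2) \<partial>lebesgue_on U)"
    unfolding L2_sq_def using bd by (intro nn_integral_mono ennreal_leI power_mono) auto
  also have "\<dots> < \<infinity>"
    using emeasure_lebesgue_on_bounded[OF U] by (simp add: ennreal_mult_less_top)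
  finally show ?thesis using m by (simp add: L2_def)
qed

section \<open>The ground state is an eigenfunction\<close>

definition cvec :: "real^'n \<Rightarrow> complex^'n" where "cvec x = (\<chi> i. of_real (x $ i))"

lemma cvec_nth [simp]: "cvec x $ i = of_real (x $ i)"
  by (simp add: cvec_def)

lemma norm_cvec: "norm (cvec x) = norm x"
  by (simp add: norm_vec_def L2_set_def)

lemma continuous_on_cvec: "continuous_on S f \<Longrightarrow> continuous_on S (\<lambda>x. cvec (f x))"
  unfolding cvec_def by (intro continuous_on_vec_lambda continuous_intros)

lemma polynomial_primitive:
  assumes "real_polynomial_function q"
  shows "\<exists>p. (\<forall>s. (p has_real_derivative q s) (at s)) \<and> p b = 0 \<and> (\<forall>k. Ck k p)"
proof -
  obtain a n where q: "q = (\<lambda>x. \<Sum>i\<le>n. a i * x ^ i)"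
    using assms by (auto simp: real_polynomial_function_iff_sum)
  define P where "P s = (\<Sum>i\<le>n. a i / real (i + 1) * s ^ (i + 1))" for s :: real
  have P: "(P has_real_derivative q s) (at s)" for s
  proof -
    have "((\<lambda>s. a i / real (i + 1) * s ^ (i + 1)) has_real_derivative a i * s ^ i) (at s)" for i
      using DERIV_cmult[OF DERIV_pow[of "Suc i" s UNIV], of "a i / real (i + 1)"]
      by (simp del: of_nat_Suc power_Suc)
    then show ?thesis unfolding P_def[abs_def] q by (intro DERIV_sum)
  qed
  show ?thesis
  proof (intro exI[of _ "\<lambda>s. P s + (- P b)"] conjI allI)
    show "((\<lambda>s. P s + - P b) has_real_derivative q s) (at s)" for s
      using DERIV_add[OF P DERIV_const[of "- P b"]] by simp
    show "Ck k (\<lambda>s. P s + - P b)" for k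
      unfolding P_def by (intro Ck_add Ck_sum Ck_mult Ck_power Ck_id Ck_const)
  qed simp
qed

lemma bounded_derivative_imp_small:
  fixes p :: "real \<Rightarrow> real"
  assumes "continuous_on {a..b} p" "p b = 0" "s \<in> {a..b}" "a \<le> b"
    and der: "\<And>t. a < t \<Longrightarrow> t < b \<Longrightarrow> (p has_real_derivative q t) (at t)"
    and bd: "\<And>t. t \<in> {a..b} \<Longrightarrow> \<bar>q t\<bar> \<le> Q"
  shows "\<bar>p s\<bar> \<le> Q * (b - s)"
proof (cases "s < b")
  case True
  have c: "continuous_on {s..b} p"
    using assms(3) by (intro continuous_on_subset[OF assms(1)]) auto
  have d: "p differentiable (at t)" if "s < t" "t < b" for t
    using der[of t] that assms(3) by (auto simp: real_differentiable_def)
  obtain D z where z: "s < z" "z < b" "(p has_real_derivative D) (at z)" "p b - p s = (b - s) * D"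
    using MVT[OF True c d] by blast
  have "(p has_real_derivative q z) (at z)" using der z assms(3) by auto
  then have "D = q z" using z(3) DERIV_unique by blast
  then have "\<bar>p s\<bar> = (b - s) * \<bar>q z\<bar>"
    using z(4) assms(2) True by (metis abs_minus_cancel abs_mult abs_of_pos diff_0 diff_gt_0_iff_gt)
  also have "\<dots> \<le> (b - s) * Q"
    using bd[of z] z assms(3) True by (intro mult_left_mono) auto
  finally show ?thesis by (simp add: mult.commute)
next
  case False
  then show ?thesis using assms(2,3) by simp
qed

context ground_state
begin

abbreviation cu :: "real^'n \<Rightarrow> complex" where "cu x \<equiv> of_real (u x)"
abbreviation cdu :: "real^'n \<Rightarrow> complex^'n" where "cdu x \<equiv> cvec (du x)"

text \<open>
  The ground state as a function of \<open>s = \<bar>x\<bar>\<^sup>2\<close>, and its derivative. This variable is chosen because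
  polynomials in \<open>s\<close> are smooth functions of \<open>x\<close>, at the origin too.
\<close>

definition F :: "real \<Rightarrow> real" where "F s = f (sqrt s)"
definition \<kappa> :: "real \<Rightarrow> real" where "\<kappa> s = - l * g (sqrt s) / (2 * wt (sqrt s))"

lemma sqrt_in: "s \<in> {0..R\<^sup>2} \<Longrightarrow> sqrt s \<in> {0..R}"
  using R real_sqrt_le_mono[of s "R\<^sup>2"] by simp

lemma F_cont: "continuous_on {0..R\<^sup>2} F"
  unfolding F_def by (rule continuous_on_compose2[OF f_cont]) (auto intro!: continuous_intros dest: sqrt_in)

lemma \<kappa>_cont: "continuous_on {0..R\<^sup>2} \<kappa>"
proof -
  have "continuous_on {0..R\<^sup>2} (\<lambda>s. g (sqrt s))"
    by (rule continuous_on_compose2[OF g_cont]) (auto intro!: continuous_intros dest: sqrt_in)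
  then show ?thesis unfolding \<kappa>_def by (intro continuous_intros) auto
qed

lemma F_deriv:
  assumes "0 < s" "s < R\<^sup>2" shows "(F has_real_derivative \<kappa> s) (at s)"
proof -
  have "sqrt s < R" using assms R by (simp add: real_less_lsqrt)
  then have "(f has_real_derivative - l * sqrt s / wt (sqrt s) * g (sqrt s)) (at (sqrt s))"
    using assms by (intro f_deriv) auto
  from DERIV_chain2[OF this DERIV_real_sqrt[OF assms(1)]]
  have "((\<lambda>s. f (sqrt s)) has_real_derivative
      (- l * sqrt s / wt (sqrt s) * g (sqrt s)) * (inverse (sqrt s) / 2)) (at s)" .
  moreover have "(- l * sqrt s / wt (sqrt s) * g (sqrt s)) * (inverse (sqrt s) / 2) = \<kappa> s"
    using assms(1) by (simp add: \<kappa>_def field_simps)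
  ultimately show ?thesis by (simp only: F_def[abs_def])
qed

lemma u_eq_F: "u x = F (x \<bullet> x)"
  by (simp add: u_def F_def norm_eq_sqrt_inner)

lemma du_eq_\<kappa>: "du x = (2 * \<kappa> (x \<bullet> x)) *\<^sub>R x"
  by (simp add: du_def \<kappa>_def W_def norm_eq_sqrt_inner)

lemma inner_in: "x \<in> U \<Longrightarrow> x \<bullet> x \<in> {0..<R\<^sup>2}"
  using R by (simp add: in_U dot_square_norm power_strict_mono)

text \<open>
  The approximating test functions. By Weierstrass, \<open>F' = \<kappa>\<close> is a uniform limit of polynomials
  \<open>q\<close>; their primitives \<open>p\<close> that vanish at \<open>R\<^sup>2\<close> approximate \<open>F\<close>. They are made to vanish near
  the sphere by a cutoff on the scale \<open>1 / (k + 1)\<close>. The derivative of the cutoff grows like \<open>k\<close>, but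
  only in a layer where \<open>p\<close> is of size \<open>1 / k\<close>, so the gradients stay bounded, and they
  converge pointwise.
\<close>

lemma ground_state_approx:
  "\<exists>\<phi>. (\<forall>k::nat. test_fun U (\<phi> k)) \<and>
    (\<lambda>k. L2_sq U (\<lambda>x. \<phi> k x - cu x)) \<longlonglongrightarrow> 0 \<and>
    (\<lambda>k. L2_sq U (\<lambda>x. grad (\<phi> k) x - cdu x)) \<longlonglongrightarrow> 0"
proof -
  let ?b = "R\<^sup>2"
  have b: "0 < ?b" using R by simp
  have "\<exists>p q. (\<forall>s. (p has_real_derivative q s) (at s)) \<and> p ?b = 0 \<and> (\<forall>j. Ck j p) \<and>
      (\<forall>s\<in>{0..?b}. \<bar>\<kappa> s - q s\<bar> \<le> 1 / (real k + 1))" for k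
  proof -
    obtain q where q: "real_polynomial_function q" "\<And>s. s \<in> {0..?b} \<Longrightarrow> \<bar>\<kappa> s - q s\<bar> < 1 / (real k + 1)"
      using Stone_Weierstrass_real_polynomial_function[OF compact_Icc \<kappa>_cont, of "1 / (real k + 1)"] by auto
    obtain p where "\<forall>s. (p has_real_derivative q s) (at s)" "p ?b = 0" "\<forall>j. Ck j p"
      using polynomial_primitive[OF q(1)] by blast
    then show ?thesis using q(2) by (metis less_imp_le)
  qed
  then obtain p q where p': "\<And>k s. (p k has_real_derivative q k s) (at s)" and pb: "\<And>k. p k ?b = 0"
    and pC: "\<And>j k. Ck j (p k)" and q: "\<And>k s. s \<in> {0..?b} \<Longrightarrow> \<bar>\<kappa> s - q k s\<bar> \<le> 1 / (real k + 1)"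
    by metis
  have "bounded (\<kappa> ` {0..?b})"
    by (intro compact_imp_bounded compact_continuous_image \<kappa>_cont) simp
  then obtain Q0 where Q0: "\<forall>s\<in>{0..?b}. \<bar>\<kappa> s\<bar> \<le> Q0" by (auto simp: bounded_iff)
  define Q where "Q = Q0 + 1"
  have k1: "1 / (real k + 1) \<le> 1" for k by (simp add: divide_le_eq)
  have Q: "\<bar>\<kappa> s\<bar> \<le> Q" "\<bar>q k s\<bar> \<le> Q" if "s \<in> {0..?b}" for s k
    unfolding Q_def using bspec[OF Q0 that] q[OF that, of k] k1[of k] by linarith+
  have Qpos: "0 \<le> Q" using Q(1)[of 0] b by auto
  have pc: "continuous_on S (p k)" for S k
    using DERIV_isCont[OF p'] by (intro continuous_at_imp_continuous_on) blast
  have pbound: "\<bar>p k s\<bar> \<le> Q * (?b - s)" if "s \<in> {0..?b}" for k s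
    by (rule bounded_derivative_imp_small[OF pc pb that _ p' Q(2)]) (use b in auto)
  have pF: "\<bar>p k s - F s\<bar> \<le> 1 / (real k + 1) * (?b - s)" if "s \<in> {0..?b}" for k s
  proof (rule bounded_derivative_imp_small[where p = "\<lambda>s. p k s - F s" and q = "\<lambda>s. q k s - \<kappa> s"])
    show "continuous_on {0..?b} (\<lambda>s. p k s - F s)" by (intro continuous_intros pc F_cont)
    show "p k ?b - F ?b = 0" using pb R f_R by (simp add: F_def)
    show "((\<lambda>s. p k s - F s) has_real_derivative q k t - \<kappa> t) (at t)" if "0 < t" "t < ?b" for t
      by (intro DERIV_diff p' F_deriv that)
    show "\<bar>q k t - \<kappa> t\<bar> \<le> 1 / (real k + 1)" if "t \<in> {0..?b}" for t
      using q[OF that, of k] by (simp add: abs_minus_commute)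
  qed (use b that in auto)
  define y where "y k s = (real k + 1) * (?b - s) - 1" for k :: nat and s :: real
  have y_top: "filterlim (\<lambda>k. y k s) at_top sequentially" if "s < ?b" for s
  proof -
    have "filterlim (\<lambda>k. - 1 + (?b - s) * (real k + 1)) at_top sequentially"
    proof (rule filterlim_tendsto_add_at_top[OF tendsto_const], rule filterlim_tendsto_pos_mult_at_top[OF tendsto_const])
      show "filterlim (\<lambda>k. real k + 1) at_top sequentially"
        using filterlim_tendsto_add_at_top[OF tendsto_const[of 1] filterlim_real_sequentially]
        by (simp add: add.commute)
    qed (use that in simp)
    then show ?thesis by (simp add: y_def algebra_simps)
  qed
  \<comment> \<open>The factor \<open>k + 1\<close> from the derivative of the cutoff is absorbed by \<open>R\<^sup>2 - s\<close>, which bounds \<open>p\<close>: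
      since \<open>(k + 1) (R\<^sup>2 - s) = y + 1\<close>, the product is again a combination of cutoff functions.\<close>
  have c2: "(real k + 1) * (?b - s) * cutoff 2 (y k s) = cutoff 1 (y k s) + cutoff 2 (y k s)" for k s
  proof -
    have "y k s * cutoff 2 (y k s) = cutoff 1 (y k s)"
      by (simp add: cutoff_def power2_eq_square)
    then show ?thesis by (simp add: y_def algebra_simps)
  qed
  define \<Phi> where "\<Phi> k x = p k (x \<bullet> x) * cutoff 0 (y k (x \<bullet> x))" for k and x :: "real^'n"
  define A where "A k s = q k s * cutoff 0 (y k s) - p k s * ((real k + 1) * cutoff 2 (y k s))" for k s
  have \<Phi>': "(\<Phi> k has_derivative (\<lambda>v. A k (x \<bullet> x) * (2 * (x \<bullet> v)))) (at x)" for k x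
  proof -
    have c': "((\<lambda>s. cutoff 0 (y k s)) has_real_derivative (cutoff 2 (y k s) * (- (real k + 1)))) (at s)" for s
    proof -
      have "(y k has_real_derivative - (real k + 1)) (at s)"
        unfolding y_def by (auto intro!: derivative_eq_intros)
      from DERIV_chain2[OF cutoff_deriv[of 0] this] show ?thesis by (simp add: numeral_2_eq_2)
    qed
    have "((\<lambda>s. p k s * cutoff 0 (y k s)) has_real_derivative A k s) (at s)" for s
      using DERIV_mult[OF p'[of k s] c'[of s]] by (rule DERIV_cong) (simp add: A_def algebra_simps)
    then have "((\<lambda>s. p k s * cutoff 0 (y k s)) has_derivative (\<lambda>h. A k (x \<bullet> x) * h)) (at (x \<bullet> x))"
      by (simp only: has_field_derivative_def)
    moreover have "((\<lambda>x. x \<bullet> x) has_derivative (\<lambda>v. 2 * (x \<bullet> v))) (at x)"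
      by (auto intro!: derivative_eq_intros simp: inner_commute)
    ultimately show ?thesis
      unfolding \<Phi>_def by (rule has_derivative_compose[rotated])
  qed
  define \<phi> where "\<phi> k x = complex_of_real (\<Phi> k x)" for k x
  have grad_\<phi>: "grad (\<phi> k) x = (2 * A k (x \<bullet> x)) *\<^sub>R cvec x" for k x
  proof -
    have "(\<phi> k has_derivative (\<lambda>v. of_real (A k (x \<bullet> x) * (2 * (x \<bullet> v))))) (at x)"
      unfolding \<phi>_def by (rule bounded_linear.has_derivative[OF bounded_linear_of_real \<Phi>'])
    from grad_eqI[OF this] have "grad (\<phi> k) x $ i = ((2 * A k (x \<bullet> x)) *\<^sub>R cvec x) $ i" for i
      by (simp only: vector_scaleR_component) (simp add: inner_axis scaleR_conv_of_real)
    then show ?thesis by (simp add: vec_eq_iff)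
  qed
  have test: "test_fun U (\<phi> k)" for k
  proof (rule test_funI[where K = "cball 0 (sqrt (?b - 1 / (real k + 1)))"])
    have "Ck j (\<lambda>x::real^'n. x \<bullet> x)" for j by (intro Ck_inner Ck_id)
    moreover have "Ck j (\<lambda>x::real^'n. y k (x \<bullet> x))" for j
    proof -
      have "Ck j (\<lambda>x::real^'n. ((real k + 1) * ?b - 1) + (- (real k + 1)) * (x \<bullet> x))"
        by (intro Ck_add Ck_mult Ck_const Ck_inner Ck_id)
      moreover have "((real k + 1) * ?b - 1) + (- (real k + 1)) * s = y k s" for s
        by (simp add: y_def algebra_simps)
      ultimately show ?thesis by (simp only:)
    qed
    ultimately show "Ck j (\<phi> k)" for j
      unfolding \<phi>_def[abs_def] \<Phi>_def
      by (intro Ck_bounded_linear_comp[OF bounded_linear_of_real] Ck_mult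
          Ck_comp_real[OF pC] Ck_comp_real[OF Ck_cutoff])
    have "sqrt (?b - 1 / (real k + 1)) < sqrt ?b" by (intro real_sqrt_less_mono) simp
    then show "cball 0 (sqrt (?b - 1 / (real k + 1))) \<subseteq> U"
      using R by (auto simp: in_U)
    fix x assume "\<phi> k x \<noteq> 0"
    then have "0 < y k (x \<bullet> x)"
      by (auto simp: \<phi>_def \<Phi>_def cutoff_def split: if_splits)
    then have "x \<bullet> x \<le> ?b - 1 / (real k + 1)"
      by (simp add: y_def field_simps)
    then show "x \<in> cball 0 (sqrt (?b - 1 / (real k + 1)))"
      by (simp add: norm_eq_sqrt_inner)
  qed simp
  have c_bounds: "\<bar>cutoff 0 t\<bar> \<le> 1" "\<bar>cutoff 1 t\<bar> \<le> 1" "\<bar>cutoff 2 t\<bar> \<le> 2" for t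
    using cutoff_le_fact[of 0 t] cutoff_le_fact[of 1 t] cutoff_le_fact[of 2 t] cutoff_nonneg by auto
  have second: "\<bar>p k s * ((real k + 1) * cutoff 2 (y k s))\<bar> \<le> Q * (cutoff 1 (y k s) + cutoff 2 (y k s))"
    if s: "s \<in> {0..?b}" for k s
  proof -
    have "\<bar>p k s * ((real k + 1) * cutoff 2 (y k s))\<bar> = \<bar>p k s\<bar> * ((real k + 1) * cutoff 2 (y k s))"
      using cutoff_nonneg[of 2 "y k s"] by (simp add: abs_mult)
    also have "\<dots> \<le> (Q * (?b - s)) * ((real k + 1) * cutoff 2 (y k s))"
      using pbound[OF s] cutoff_nonneg[of 2 "y k s"] by (intro mult_right_mono) auto
    also have "\<dots> = Q * ((real k + 1) * (?b - s) * cutoff 2 (y k s))" by simp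
    finally show ?thesis by (simp only: c2)
  qed
  have A_bound: "\<bar>A k s\<bar> \<le> 4 * Q" if s: "s \<in> {0..?b}" for k s
  proof -
    have "\<bar>q k s * cutoff 0 (y k s)\<bar> \<le> Q * 1"
      unfolding abs_mult using Q(2)[OF s] c_bounds Qpos by (intro mult_mono) auto
    moreover have "Q * (cutoff 1 (y k s) + cutoff 2 (y k s)) \<le> Q * 3"
      using c_bounds(2)[of "y k s"] c_bounds(3)[of "y k s"] Qpos by (intro mult_left_mono) auto
    ultimately show ?thesis using second[OF s, of k] unfolding A_def by linarith
  qed
  have inv0: "(\<lambda>k. 1 / (real k + 1)) \<longlonglongrightarrow> 0"
    using LIMSEQ_inverse_real_of_nat by (simp add: inverse_eq_divide add.commute)
  have q_lim: "(\<lambda>k. q k s) \<longlonglongrightarrow> \<kappa> s" if "s \<in> {0..?b}" for s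
  proof (rule LIM_zero_cancel, rule Lim_null_comparison[OF _ inv0])
    show "\<forall>\<^sub>F k in sequentially. norm (q k s - \<kappa> s) \<le> 1 / (real k + 1)"
      using q[OF that] by (simp add: abs_minus_commute)
  qed
  have p_lim: "(\<lambda>k. p k s) \<longlonglongrightarrow> F s" if "s \<in> {0..?b}" for s
  proof (rule LIM_zero_cancel, rule Lim_null_comparison)
    show "\<forall>\<^sub>F k in sequentially. norm (p k s - F s) \<le> 1 / (real k + 1) * (?b - s)"
      using pF[OF that] by simp
    show "(\<lambda>k. 1 / (real k + 1) * (?b - s)) \<longlonglongrightarrow> 0"
      using tendsto_mult_right[OF inv0, of "?b - s"] by simp
  qed
  have c_lim: "(\<lambda>k. cutoff 0 (y k s)) \<longlonglongrightarrow> 1" "(\<lambda>k. cutoff 1 (y k s)) \<longlonglongrightarrow> 0" "(\<lambda>k. cutoff 2 (y k s)) \<longlonglongrightarrow> 0"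
    if "s < ?b" for s
    using filterlim_compose[OF cutoff_zero_tendsto y_top[OF that]]
      filterlim_compose[OF cutoff_pos_tendsto[of 1] y_top[OF that]]
      filterlim_compose[OF cutoff_pos_tendsto[of 2] y_top[OF that]] by auto
  have A_lim: "(\<lambda>k. A k s) \<longlonglongrightarrow> \<kappa> s" if s: "s \<in> {0..<?b}" for s
  proof -
    have s': "s \<in> {0..?b}" "s < ?b" using s by auto
    have "(\<lambda>k. p k s * ((real k + 1) * cutoff 2 (y k s))) \<longlonglongrightarrow> 0"
    proof (rule Lim_null_comparison)
      show "\<forall>\<^sub>F k in sequentially. norm (p k s * ((real k + 1) * cutoff 2 (y k s)))
          \<le> Q * (cutoff 1 (y k s) + cutoff 2 (y k s))"
        using second[OF s'(1)] by simp
      show "(\<lambda>k. Q * (cutoff 1 (y k s) + cutoff 2 (y k s))) \<longlonglongrightarrow> 0"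
        using tendsto_mult_left[OF tendsto_add[OF c_lim(2,3)[OF s'(2)]], of Q] by simp
    qed
    then show ?thesis
      unfolding A_def using tendsto_diff[OF tendsto_mult[OF q_lim[OF s'(1)] c_lim(1)[OF s'(2)]]] by fastforce
  qed
  have meas: "\<phi> k \<in> borel_measurable M" "grad (\<phi> k) \<in> borel_measurable M" for k
  proof -
    show "\<phi> k \<in> borel_measurable M"
      by (intro borel_measurable_lebesgue_on_cont test_fun_cont[OF test] U_open)
    have "continuous_on U (\<lambda>x. \<chi> i. grad (\<phi> k) x $ i)"
      by (intro continuous_on_vec_lambda test_fun_grad_cont[OF test])
    then show "grad (\<phi> k) \<in> borel_measurable M"
      by (intro borel_measurable_lebesgue_on_cont U_open) simp
  qed
  have meas_u: "cu \<in> borel_measurable M" "cdu \<in> borel_measurable M"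
    by (intro borel_measurable_lebesgue_on_cont U_open continuous_on_of_real u_cont_U continuous_on_cvec du_cont_U)+
  show ?thesis
  proof (intro exI[of _ \<phi>] conjI allI test)
    show "(\<lambda>k. L2_sq U (\<lambda>x. \<phi> k x - cu x)) \<longlonglongrightarrow> 0"
    proof (rule L2_sq_tendsto_0[OF U_bounded U_open])
      show "(\<lambda>x. \<phi> k x - cu x) \<in> borel_measurable M" for k
        using meas meas_u by (intro borel_measurable_diff)
      show "norm (\<phi> k x - cu x) \<le> Q * ?b + 1" if x: "x \<in> U" for k x
      proof -
        have s: "x \<bullet> x \<in> {0..?b}" using inner_in[OF x] by auto
        have "\<bar>\<Phi> k x\<bar> \<le> (Q * (?b - x \<bullet> x)) * 1"
          unfolding \<Phi>_def abs_mult using pbound[OF s] c_bounds(1) s Qpos by (intro mult_mono) auto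
        also have "\<dots> \<le> Q * ?b" using Qpos by (simp add: mult_left_mono)
        finally have "norm (\<phi> k x) \<le> Q * ?b" by (simp add: \<phi>_def)
        moreover have "norm (cu x) \<le> 1" using u_pos[OF x] u_le_1[OF x] by simp
        ultimately show ?thesis using norm_triangle_ineq4[of "\<phi> k x" "cu x"] by linarith
      qed
      show "(\<lambda>k. \<phi> k x - cu x) \<longlonglongrightarrow> 0" if x: "x \<in> U" for x
      proof -
        have s: "x \<bullet> x \<in> {0..?b}" "x \<bullet> x < ?b" using inner_in[OF x] by auto
        have "(\<lambda>k. \<Phi> k x) \<longlonglongrightarrow> F (x \<bullet> x) * 1"
          unfolding \<Phi>_def by (intro tendsto_mult p_lim c_lim s)
        then have "(\<lambda>k. \<phi> k x) \<longlonglongrightarrow> cu x"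
          unfolding \<phi>_def u_eq_F by (intro tendsto_of_real) simp
        then show ?thesis by (rule LIM_zero)
      qed
    qed
    show "(\<lambda>k. L2_sq U (\<lambda>x. grad (\<phi> k) x - cdu x)) \<longlonglongrightarrow> 0"
    proof (rule L2_sq_tendsto_0[OF U_bounded U_open])
      show "(\<lambda>x. grad (\<phi> k) x - cdu x) \<in> borel_measurable M" for k
        using meas meas_u by (intro borel_measurable_diff)
      have eq: "grad (\<phi> k) x - cdu x = (2 * (A k (x \<bullet> x) - \<kappa> (x \<bullet> x))) *\<^sub>R cvec x" for k x
      proof -
        have "((2 * A k (x \<bullet> x)) *\<^sub>R cvec x) $ i - cdu x $ i = ((2 * (A k (x \<bullet> x) - \<kappa> (x \<bullet> x))) *\<^sub>R cvec x) $ i" for i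
          by (simp only: vector_scaleR_component cvec_nth du_eq_\<kappa>) (simp add: scaleR_conv_of_real algebra_simps)
        then show ?thesis by (simp only: grad_\<phi> vec_eq_iff vector_minus_component) simp
      qed
      show "norm (grad (\<phi> k) x - cdu x) \<le> 2 * (4 * Q + Q) * R" if x: "x \<in> U" for k x
      proof -
        have s: "x \<bullet> x \<in> {0..?b}" using inner_in[OF x] by auto
        have "\<bar>A k (x \<bullet> x) - \<kappa> (x \<bullet> x)\<bar> \<le> 4 * Q + Q"
          using A_bound[OF s, of k] Q(1)[OF s] by linarith
        then have "\<bar>2 * (A k (x \<bullet> x) - \<kappa> (x \<bullet> x))\<bar> \<le> 2 * (4 * Q + Q)"
          by (simp only: abs_mult) simp
        then have "\<bar>2 * (A k (x \<bullet> x) - \<kappa> (x \<bullet> x))\<bar> * norm x \<le> 2 * (4 * Q + Q) * R"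
          using x Qpos by (intro mult_mono) (auto simp: in_U)
        then show ?thesis unfolding eq norm_scaleR norm_cvec .
      qed
      show "(\<lambda>k. grad (\<phi> k) x - cdu x) \<longlonglongrightarrow> 0" if x: "x \<in> U" for x
      proof -
        have "(\<lambda>k. A k (x \<bullet> x) - \<kappa> (x \<bullet> x)) \<longlonglongrightarrow> 0"
          using A_lim[OF inner_in[OF x]] by (rule LIM_zero)
        then have "(\<lambda>k. (2 * (A k (x \<bullet> x) - \<kappa> (x \<bullet> x))) *\<^sub>R cvec x) \<longlonglongrightarrow> (2 * 0) *\<^sub>R cvec x"
          by (intro tendsto_intros)
        then show ?thesis unfolding eq by simp
      qed
    qed
  qed
qed

lemma ground_state_H10: "H10 U cu cdu"
  unfolding H10_def
proof (intro conjI ground_state_approx)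
  have "bounded (du ` cball 0 R)"
    by (intro compact_imp_bounded compact_continuous_image du_cont) simp
  then obtain B where "\<forall>x\<in>cball 0 R. norm (du x) \<le> B"
    by (auto simp: bounded_iff)
  then have B: "\<And>x. x \<in> U \<Longrightarrow> norm (du x) \<le> B" by (simp add: in_U)
  show "L2 U cu"
    by (rule L2_bounded[OF U_bounded U_open, where B = 1])
       (use u_pos u_le_1 in \<open>auto intro!: borel_measurable_lebesgue_on_cont continuous_on_of_real u_cont_U simp: less_imp_le abs_of_pos\<close>)
  show "L2 U cdu"
    by (rule L2_bounded[OF U_bounded U_open, where B = B])
       (use B in \<open>auto intro!: borel_measurable_lebesgue_on_cont continuous_on_cvec du_cont_U simp: norm_cvec\<close>)
  show "weak_gradient U cu cdu"
    unfolding weak_gradient_def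
  proof (intro allI impI)
    fix \<psi> :: "real^'n \<Rightarrow> complex" and i assume \<psi>: "test_fun U \<psi>"
    obtain K where K: "compact K" "K \<subseteq> U" and supp: "\<forall>x. x \<notin> K \<longrightarrow> \<psi> x = 0 \<and> grad \<psi> x = 0"
      using test_fun_support[OF \<psi>] by blast
    have "bounded ((\<lambda>x. grad \<psi> x $ i) ` K)"
      using K by (intro compact_imp_bounded compact_continuous_image test_fun_grad_cont[OF \<psi>])
    then obtain C where C: "\<And>x. x \<in> K \<Longrightarrow> norm (grad \<psi> x $ i) \<le> C" by (auto simp: bounded_iff)
    have Bi: "\<bar>du x \<bullet> axis i 1\<bar> \<le> B" if "x \<in> K" for x
      using B[of x] component_le_norm_cart[of "du x" i] K that by (force simp: inner_axis)
    have "(\<integral>x. u x *\<^sub>R frechet_derivative \<psi> (at x) (axis i 1) + (du x \<bullet> axis i 1) *\<^sub>R \<psi> x \<partial>M) = 0"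
      by (rule integral_by_parts_zero(2)[OF U_open K u_deriv test_fun_deriv[OF \<psi>] _ Bi])
         (use supp C in \<open>auto simp: grad_nth\<close>)
    then have "(\<integral>x. cu x * (grad \<psi> x $ i) + cdu x $ i * \<psi> x \<partial>M) = 0"
      by (simp add: grad_nth inner_axis scaleR_conv_of_real)
    moreover have "integrable M (\<lambda>x. cu x * (grad \<psi> x $ i))"
      by (rule integrable_compact_support[OF U_open K])
         (use supp in \<open>auto intro!: continuous_intros u_cont_U test_fun_grad_cont[OF \<psi>]\<close>)
    moreover have "integrable M (\<lambda>x. cdu x $ i * \<psi> x)"
      by (rule integrable_compact_support[OF U_open K])
         (use supp in \<open>auto intro!: continuous_intros du_cont_U test_fun_cont[OF \<psi>]\<close>)
    ultimately show "(\<integral>x. cu x * (grad \<psi> x $ i) \<partial>M) = - (\<integral>x. cdu x $ i * \<psi> x \<partial>M)"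
      by (simp add: eq_neg_iff_add_eq_0)
  qed
qed

text \<open>
  The weak equation, tested with \<open>\<psi> / W\<close>: differentiating \<open>1 / W\<close> restores the first order term.
\<close>

lemma ground_state_dirichlet_sol: "dirichlet_sol drift U cu (\<lambda>x. of_real l * cu x)"
  unfolding dirichlet_sol_def
proof (intro exI[of _ cdu] conjI ground_state_H10 allI impI)
  fix \<psi> assume \<psi>: "test_fun U \<psi>"
  obtain K where K: "compact K" "K \<subseteq> U" and supp: "\<forall>x. x \<notin> K \<longrightarrow> \<psi> x = 0 \<and> grad \<psi> x = 0"
    using test_fun_support[OF \<psi>] by blast
  let ?\<eta> = "\<lambda>x. of_real (1 / W x) * \<psi> x"
  let ?\<eta>' = "\<lambda>x v. of_real (1 / W x) * frechet_derivative \<psi> (at x) v + of_real (- (drift x \<bullet> v) / W x) * \<psi> x"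
  have \<eta>': "?\<eta>' x (axis i 1) = of_real (1 / W x) * (grad \<psi> x $ i - of_real (drift x $ i) * \<psi> x)" for x i
    by (simp add: grad_nth inner_axis algebra_simps)
  have drift_cont: "continuous_on S drift" for S :: "(real^'n) set"
    using smooth_drift[unfolded smooth_def, rule_format, of 0] by (auto intro: continuous_on_subset)
  have "(\<integral>x. (\<Sum>i\<in>UNIV. of_real (W x * du x $ i) * ?\<eta>' x (axis i 1)) \<partial>M)
    = of_real l * (\<integral>x. of_real (W x * u x) * ?\<eta> x \<partial>M)"
  proof (rule weak_equation[OF K])
    fix x assume "x \<in> U"
    have "((\<lambda>x. complex_of_real (1 / W x)) has_derivative (\<lambda>v. of_real (- (drift x \<bullet> v) / W x))) (at x)"
      unfolding W_def by (rule bounded_linear.has_derivative[OF bounded_linear_of_real weight_inverse_deriv])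
    from has_derivative_mult[OF this test_fun_deriv[OF \<psi>]]
    show "(?\<eta> has_derivative ?\<eta>' x) (at x)" .
  next
    show "continuous_on U (\<lambda>x. ?\<eta>' x (axis i 1))" for i
      unfolding \<eta>' by (intro continuous_intros W_cont drift_cont test_fun_cont[OF \<psi>] test_fun_grad_cont[OF \<psi>]) simp
  qed (use supp in simp)
  then show "(\<integral>x. (\<Sum>i\<in>UNIV. (cdu x $ i) * (grad \<psi> x $ i))
          - (\<Sum>i\<in>UNIV. of_real (drift x $ i) * (cdu x $ i)) * \<psi> x \<partial>M)
     = (\<integral>x. of_real l * cu x * \<psi> x \<partial>M)"
    unfolding \<eta>' by (simp add: sum_subtractf sum_distrib_right right_diff_distrib mult.assoc mult.left_commute)
qed

lemma ground_state_not_AE_zero: "\<not> (AE x in M. cu x = 0)"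
proof
  assume "AE x in M. cu x = 0"
  moreover have "AE x in M. x \<in> U"
    using AE_space[of "M"] by simp
  ultimately have "AE x in M. False"
    by eventually_elim (use u_pos in force)
  then have "U \<in> null_sets M"
    by (subst (asm) AE_iff_null) auto
  then have "negligible U"
    by (simp add: null_sets_restrict_space negligible_iff_null_sets)
  moreover have "0 \<in> U" using R by (simp add: in_U)
  ultimately show False using open_not_negligible[OF U_open] by blast
qed

end

section \<open>Limits in the energy space\<close>

lemma L2_measurable: "L2 U f \<Longrightarrow> f \<in> borel_measurable (lebesgue_on U)"
  by (simp add: L2_def)

lemma L2_integrable_norm_square:
  fixes f :: "real^'n \<Rightarrow> 'b::{real_normed_vector, second_countable_topology}"
  assumes "L2 U f" shows "integrable (lebesgue_on U) (\<lambda>x. (norm (f x))\<^sup>2)"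
proof (rule integrableI_bounded)
  show "(\<lambda>x. (norm (f x))\<^sup>2) \<in> borel_measurable (lebesgue_on U)"
    using L2_measurable[OF assms] by measurable
  show "(\<integral>\<^sup>+x. ennreal (norm ((norm (f x))\<^sup>2)) \<partial>lebesgue_on U) < \<infinity>"
    using assms by (simp add: L2_def L2_sq_def)
qed

lemma L2_sq_eq_integral:
  fixes f :: "real^'n \<Rightarrow> 'b::{real_normed_vector, second_countable_topology}"
  assumes "L2 U f" shows "L2_sq U f = ennreal (\<integral>x. (norm (f x))\<^sup>2 \<partial>lebesgue_on U)"
  unfolding L2_sq_def by (rule nn_integral_eq_integral[OF L2_integrable_norm_square[OF assms]]) simp

lemma L2I_integrable:
  fixes f :: "real^'n \<Rightarrow> 'b::{real_normed_vector, second_countable_topology}"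
  assumes "f \<in> borel_measurable (lebesgue_on U)"
    and "integrable (lebesgue_on U) (\<lambda>x. (norm (f x))\<^sup>2)"
  shows "L2 U f"
  using assms nn_integral_eq_integral[OF assms(2)] by (simp add: L2_def L2_sq_def)

lemma L2_mono:
  fixes f :: "real^'n \<Rightarrow> 'b::{real_normed_vector, second_countable_topology}"
    and g :: "real^'n \<Rightarrow> 'c::{real_normed_vector, second_countable_topology}"
  assumes "f \<in> borel_measurable (lebesgue_on U)" "L2 U g" "\<And>x. norm (f x) \<le> norm (g x)"
  shows "L2 U f"
proof -
  have "L2_sq U f \<le> L2_sq U g"
    unfolding L2_sq_def using assms(3) by (intro nn_integral_mono ennreal_leI power_mono) auto
  with assms(1,2) show ?thesis by (auto simp: L2_def)
qed

lemma L2_add: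
  fixes f g :: "real^'n \<Rightarrow> 'b::{real_normed_vector, second_countable_topology}"
  assumes "L2 U f" "L2 U g" shows "L2 U (\<lambda>x. f x + g x)"
proof (rule L2I_integrable)
  show m: "(\<lambda>x. f x + g x) \<in> borel_measurable (lebesgue_on U)"
    using L2_measurable[OF assms(1)] L2_measurable[OF assms(2)] by measurable
  have "integrable (lebesgue_on U) (\<lambda>x. 2 * (norm (f x))\<^sup>2 + 2 * (norm (g x))\<^sup>2)"
    by (intro Bochner_Integration.integrable_add integrable_mult_right L2_integrable_norm_square assms)
  then show "integrable (lebesgue_on U) (\<lambda>x. (norm (f x + g x))\<^sup>2)"
  proof (rule Bochner_Integration.integrable_bound)
    show "(\<lambda>x. (norm (f x + g x))\<^sup>2) \<in> borel_measurable (lebesgue_on U)" using m by measurable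
    have "(norm (f x + g x))\<^sup>2 \<le> 2 * (norm (f x))\<^sup>2 + 2 * (norm (g x))\<^sup>2" for x
    proof -
      have "(norm (f x + g x))\<^sup>2 \<le> (norm (f x) + norm (g x))\<^sup>2"
        by (intro power_mono norm_triangle_ineq) simp
      also have "\<dots> \<le> 2 * (norm (f x))\<^sup>2 + 2 * (norm (g x))\<^sup>2"
        using zero_le_power2[of "norm (f x) - norm (g x)"] by (simp add: power2_sum power2_diff)
      finally show ?thesis .
    qed
    then show "AE x in lebesgue_on U. norm ((norm (f x + g x))\<^sup>2) \<le> norm (2 * (norm (f x))\<^sup>2 + 2 * (norm (g x))\<^sup>2)"
      by simp
  qed
qed

lemma L2_scale:
  fixes f :: "real^'n \<Rightarrow> 'b::{real_normed_algebra, second_countable_topology}"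
  assumes "L2 U f" shows "L2 U (\<lambda>x. c * f x)"
proof (rule L2I_integrable)
  show m: "(\<lambda>x. c * f x) \<in> borel_measurable (lebesgue_on U)"
    using L2_measurable[OF assms] by measurable
  have "integrable (lebesgue_on U) (\<lambda>x. (norm c)\<^sup>2 * (norm (f x))\<^sup>2)"
    by (intro integrable_mult_right L2_integrable_norm_square assms)
  then show "integrable (lebesgue_on U) (\<lambda>x. (norm (c * f x))\<^sup>2)"
  proof (rule Bochner_Integration.integrable_bound)
    show "(\<lambda>x. (norm (c * f x))\<^sup>2) \<in> borel_measurable (lebesgue_on U)" using m by measurable
    have "(norm (c * f x))\<^sup>2 \<le> (norm c)\<^sup>2 * (norm (f x))\<^sup>2" for x
      unfolding power_mult_distrib[symmetric] by (intro power_mono norm_mult_ineq) simp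
    then show "AE x in lebesgue_on U. norm ((norm (c * f x))\<^sup>2) \<le> norm ((norm c)\<^sup>2 * (norm (f x))\<^sup>2)"
      by (simp add: power_mult_distrib)
  qed
qed

lemma L2_diff:
  fixes f g :: "real^'n \<Rightarrow> 'b::{real_normed_vector, second_countable_topology}"
  assumes "L2 U f" "L2 U g" shows "L2 U (\<lambda>x. f x - g x)"
proof -
  have "L2 U (\<lambda>x. - g x)"
    using L2_measurable[OF assms(2)] by (intro L2_mono[OF _ assms(2)]) (auto, measurable)
  from L2_add[OF assms(1) this] show ?thesis by simp
qed

lemma L2_cnj: "L2 U f \<Longrightarrow> L2 U (\<lambda>x. cnj (f x))"
proof (rule L2_mono)
  assume "L2 U f"
  from L2_measurable[OF this] show "(\<lambda>x. cnj (f x)) \<in> borel_measurable (lebesgue_on U)"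
    by (rule borel_measurable_continuous_on[OF continuous_on_cnj[OF continuous_on_id]])
qed auto

lemma borel_measurable_component:
  fixes G :: "'a \<Rightarrow> complex^'n"
  shows "G \<in> borel_measurable M \<Longrightarrow> (\<lambda>x. G x $ i) \<in> borel_measurable M"
  by (rule borel_measurable_continuous_on[where f = "\<lambda>v. v $ i"])
     (auto intro!: continuous_intros)

lemma L2_component:
  fixes G :: "real^'n \<Rightarrow> complex^'m"
  assumes "L2 U G" shows "L2 U (\<lambda>x. G x $ i)"
  using borel_measurable_component[OF L2_measurable[OF assms]] assms
  by (rule L2_mono) (rule Finite_Cartesian_Product.norm_nth_le)

lemma L2_integrable_mult:
  fixes a b :: "real^'n \<Rightarrow> complex"
  assumes "L2 U a" "L2 U b" shows "integrable (lebesgue_on U) (\<lambda>x. a x * b x)"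
proof (rule Bochner_Integration.integrable_bound)
  show "integrable (lebesgue_on U) (\<lambda>x. (norm (a x))\<^sup>2 + (norm (b x))\<^sup>2)"
    by (intro Bochner_Integration.integrable_add L2_integrable_norm_square assms)
  show "(\<lambda>x. a x * b x) \<in> borel_measurable (lebesgue_on U)"
    using L2_measurable[OF assms(1)] L2_measurable[OF assms(2)] by measurable
  have "norm (a x) * norm (b x) \<le> (norm (a x))\<^sup>2 + (norm (b x))\<^sup>2" for x
    using zero_le_power2[of "norm (a x) - norm (b x)"] zero_le_power2[of "norm (a x)"]
      zero_le_power2[of "norm (b x)"] unfolding power2_diff by linarith
  then show "AE x in lebesgue_on U. norm (a x * b x) \<le> norm ((norm (a x))\<^sup>2 + (norm (b x))\<^sup>2)"
    by (simp add: norm_mult)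
qed

lemma L2_Cauchy_Schwarz:
  fixes a b :: "real^'n \<Rightarrow> complex"
  assumes "L2 U a" "L2 U b"
  shows "norm (\<integral>x. a x * b x \<partial>lebesgue_on U)
    \<le> sqrt (\<integral>x. (norm (a x))\<^sup>2 \<partial>lebesgue_on U) * sqrt (\<integral>x. (norm (b x))\<^sup>2 \<partial>lebesgue_on U)"
proof -
  let ?M = "lebesgue_on U"
  let ?I = "\<integral>x. norm (a x) * norm (b x) \<partial>?M"
  have int: "integrable ?M (\<lambda>x. norm (a x) * norm (b x))"
    using integrable_norm[OF L2_integrable_mult[OF assms]] by (simp add: norm_mult)
  have "(\<integral>\<^sup>+x. ennreal (norm (a x)) * ennreal (norm (b x)) \<partial>?M)\<^sup>2
      \<le> (\<integral>\<^sup>+x. ennreal (norm (a x)) ^ 2 \<partial>?M) * (\<integral>\<^sup>+x. ennreal (norm (b x)) ^ 2 \<partial>?M)"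
    using L2_measurable[OF assms(1)] L2_measurable[OF assms(2)] by (intro Cauchy_Schwarz_nn_integral; measurable)
  moreover have "(\<integral>\<^sup>+x. ennreal (norm (a x)) * ennreal (norm (b x)) \<partial>?M) = ennreal ?I"
    using nn_integral_eq_integral[OF int] by (simp add: ennreal_mult)
  moreover have "(\<integral>\<^sup>+x. ennreal (norm (f x)) ^ 2 \<partial>?M) = ennreal (\<integral>x. (norm (f x))\<^sup>2 \<partial>?M)"
    if "L2 U f" for f :: "real^'n \<Rightarrow> complex"
    using L2_sq_eq_integral[OF that] by (simp add: L2_sq_def ennreal_power)
  ultimately have "ennreal ?I ^ 2 \<le> ennreal (\<integral>x. (norm (a x))\<^sup>2 \<partial>?M) * ennreal (\<integral>x. (norm (b x))\<^sup>2 \<partial>?M)"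
    using assms by simp
  then have "?I\<^sup>2 \<le> (\<integral>x. (norm (a x))\<^sup>2 \<partial>?M) * (\<integral>x. (norm (b x))\<^sup>2 \<partial>?M)"
    by (simp add: ennreal_power flip: ennreal_mult)
  then have "?I \<le> sqrt ((\<integral>x. (norm (a x))\<^sup>2 \<partial>?M) * (\<integral>x. (norm (b x))\<^sup>2 \<partial>?M))"
    by (rule real_le_rsqrt)
  moreover have "norm (\<integral>x. a x * b x \<partial>?M) \<le> ?I"
    using integral_norm_bound[of ?M "\<lambda>x. a x * b x"] by (simp add: norm_mult)
  ultimately show ?thesis by (simp add: real_sqrt_mult)
qed

lemma L2_norm_tendsto_0:
  fixes d :: "nat \<Rightarrow> real^'n \<Rightarrow> 'b::{real_normed_vector, second_countable_topology}"
  assumes "\<And>k. L2 U (d k)" "(\<lambda>k. L2_sq U (d k)) \<longlonglongrightarrow> 0"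
  shows "(\<lambda>k. sqrt (\<integral>x. (norm (d k x))\<^sup>2 \<partial>lebesgue_on U)) \<longlonglongrightarrow> 0"
proof -
  have "(\<lambda>k. ennreal (\<integral>x. (norm (d k x))\<^sup>2 \<partial>lebesgue_on U)) \<longlonglongrightarrow> ennreal 0"
    using assms L2_sq_eq_integral[OF assms(1)] by simp
  then have "(\<lambda>k. \<integral>x. (norm (d k x))\<^sup>2 \<partial>lebesgue_on U) \<longlonglongrightarrow> 0"
    by (subst (asm) tendsto_ennreal_iff) auto
  from tendsto_real_sqrt[OF this] show ?thesis by simp
qed

lemma L2_pairing_limit:
  fixes a b :: "real^'n \<Rightarrow> complex"
  assumes a: "L2 U a" "\<And>k. L2 U (ak k)" "(\<lambda>k. L2_sq U (\<lambda>x. ak k x - a x)) \<longlonglongrightarrow> 0"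
    and b: "L2 U b" "\<And>k. L2 U (bk k)" "(\<lambda>k. L2_sq U (\<lambda>x. bk k x - b x)) \<longlonglongrightarrow> 0"
  shows "(\<lambda>k. \<integral>x. ak k x * bk k x \<partial>lebesgue_on U) \<longlonglongrightarrow> (\<integral>x. a x * b x \<partial>lebesgue_on U)"
proof -
  let ?M = "lebesgue_on U"
  let ?N = "\<lambda>f. sqrt (\<integral>x. (norm (f x :: complex))\<^sup>2 \<partial>?M)"
  let ?da = "\<lambda>k x. ak k x - a x" and ?db = "\<lambda>k x. bk k x - b x"
  have d: "L2 U (?da k)" "L2 U (?db k)" for k using a b by (auto intro: L2_diff)
  have lim: "(\<lambda>k. ?N (?da k)) \<longlonglongrightarrow> 0" "(\<lambda>k. ?N (?db k)) \<longlonglongrightarrow> 0"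
    using L2_norm_tendsto_0[OF d(1) a(3)] L2_norm_tendsto_0[OF d(2) b(3)] by auto
  show ?thesis
  proof (rule LIM_zero_cancel, rule Lim_null_comparison)
    show "\<forall>\<^sub>F k in sequentially. norm ((\<integral>x. ak k x * bk k x \<partial>?M) - (\<integral>x. a x * b x \<partial>?M))
        \<le> ?N (?da k) * ?N (?db k) + (?N a * ?N (?db k) + ?N (?da k) * ?N b)"
    proof (rule always_eventually, rule allI)
      fix k
      have "(\<integral>x. ak k x * bk k x \<partial>?M) - (\<integral>x. a x * b x \<partial>?M)
          = (\<integral>x. ak k x * bk k x - a x * b x \<partial>?M)"
        using a b by (intro Bochner_Integration.integral_diff[symmetric] L2_integrable_mult)
      also have "\<dots> = (\<integral>x. ?da k x * ?db k x + (a x * ?db k x + ?da k x * b x) \<partial>?M)"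
        by (rule Bochner_Integration.integral_cong) (auto simp: algebra_simps)
      also have "\<dots> = (\<integral>x. ?da k x * ?db k x \<partial>?M) + ((\<integral>x. a x * ?db k x \<partial>?M) + (\<integral>x. ?da k x * b x \<partial>?M))"
        using L2_integrable_mult[OF d] L2_integrable_mult[OF a(1) d(2)] L2_integrable_mult[OF d(1) b(1)]
        by (subst Bochner_Integration.integral_add) (auto intro: Bochner_Integration.integrable_add)
      finally show "norm ((\<integral>x. ak k x * bk k x \<partial>?M) - (\<integral>x. a x * b x \<partial>?M))
        \<le> ?N (?da k) * ?N (?db k) + (?N a * ?N (?db k) + ?N (?da k) * ?N b)"
        using L2_Cauchy_Schwarz[OF d, of k] L2_Cauchy_Schwarz[OF a(1) d(2)] L2_Cauchy_Schwarz[OF d(1) b(1)]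
        by (auto intro!: norm_triangle_le add_mono)
    qed
    show "(\<lambda>k. ?N (?da k) * ?N (?db k) + (?N a * ?N (?db k) + ?N (?da k) * ?N b)) \<longlonglongrightarrow> 0"
      using tendsto_add[OF tendsto_mult[OF lim] tendsto_add[OF tendsto_mult[OF tendsto_const lim(2)]
          tendsto_mult[OF lim(1) tendsto_const]]] by simp
  qed
qed

lemma L2_sq_mono:
  "(\<And>x. norm (f x) \<le> norm (g x)) \<Longrightarrow> L2_sq U f \<le> L2_sq U g"
  unfolding L2_sq_def by (intro nn_integral_mono ennreal_leI power_mono) auto

lemma L2_sq_squeeze:
  assumes "(\<lambda>k. L2_sq U (g k)) \<longlonglongrightarrow> 0" "\<And>k x. norm (f k x) \<le> norm (g k x)"
  shows "(\<lambda>k. L2_sq U (f k)) \<longlonglongrightarrow> 0"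
  by (rule tendsto_sandwich[OF _ _ tendsto_const assms(1)]) (auto intro!: always_eventually L2_sq_mono assms(2))

text \<open>
  Membership of \<open>(w, G)\<close> in the closure of the pairs \<open>(\<phi>, \<nabla>\<phi>)\<close>, with the approximating sequence made
  explicit, so that identities and inequalities for test functions pass to the limit.
\<close>

definition grad_limit ::
    "(real^'n) set \<Rightarrow> (real^'n \<Rightarrow> complex) \<Rightarrow> (real^'n \<Rightarrow> complex^'n) \<Rightarrow> (nat \<Rightarrow> real^'n \<Rightarrow> complex) \<Rightarrow> bool" where
  "grad_limit U w G \<phi> \<longleftrightarrow> L2 U w \<and> L2 U G \<and> (\<forall>k. test_fun U (\<phi> k)) \<and>
     (\<lambda>k. L2_sq U (\<lambda>x. \<phi> k x - w x)) \<longlonglongrightarrow> 0 \<and>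
     (\<lambda>k. L2_sq U (\<lambda>x. grad (\<phi> k) x - G x)) \<longlonglongrightarrow> 0"

lemma H10_grad_limit: "H10 U w G \<Longrightarrow> \<exists>\<phi>. grad_limit U w G \<phi>"
  by (auto simp: H10_def grad_limit_def)

lemma grad_limit_component:
  assumes "grad_limit U w G \<phi>"
  shows "(\<lambda>k. L2_sq U (\<lambda>x. grad (\<phi> k) x $ i - G x $ i)) \<longlonglongrightarrow> 0"
proof (rule L2_sq_squeeze)
  show "(\<lambda>k. L2_sq U (\<lambda>x. grad (\<phi> k) x - G x)) \<longlonglongrightarrow> 0" using assms by (simp add: grad_limit_def)
  show "norm (grad (\<phi> k) x $ i - G x $ i) \<le> norm (grad (\<phi> k) x - G x)" for k x
    using Finite_Cartesian_Product.norm_nth_le[of "grad (\<phi> k) x - G x" i] by simp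
qed

lemma grad_limit_cnj:
  assumes "grad_limit U w G \<phi>"
  shows "grad_limit U (\<lambda>x. cnj (w x)) (\<lambda>x. \<chi> i. cnj (G x $ i)) (\<lambda>k x. cnj (\<phi> k x))"
  unfolding grad_limit_def
proof (intro conjI allI)
  have t: "test_fun U (\<phi> k)" for k using assms by (simp add: grad_limit_def)
  have n: "norm (\<chi> i. cnj (v $ i)) = norm v" for v :: "complex^'a"
    by (simp add: norm_vec_def L2_set_def)
  show "L2 U (\<lambda>x. cnj (w x))" using assms by (auto simp: grad_limit_def intro: L2_cnj)
  have G: "L2 U G" using assms by (simp add: grad_limit_def)
  show "L2 U (\<lambda>x. \<chi> i. cnj (G x $ i))"
  proof (rule L2_mono[OF _ G])
    show "(\<lambda>x. \<chi> i. cnj (G x $ i)) \<in> borel_measurable (lebesgue_on U)"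
      by (rule borel_measurable_continuous_on[where f = "\<lambda>v. \<chi> i. cnj (v $ i)", OF _ L2_measurable[OF G]])
         (intro continuous_on_vec_lambda continuous_intros)
  qed (simp add: n)
  show "test_fun U (\<lambda>x. cnj (\<phi> k x))" for k by (rule test_fun_cnj[OF t])
  show "(\<lambda>k. L2_sq U (\<lambda>x. cnj (\<phi> k x) - cnj (w x))) \<longlonglongrightarrow> 0"
    by (rule L2_sq_squeeze[of _ "\<lambda>k x. \<phi> k x - w x"])
       (use assms in \<open>auto simp: grad_limit_def simp flip: complex_cnj_diff\<close>)
  show "(\<lambda>k. L2_sq U (\<lambda>x. grad (\<lambda>x. cnj (\<phi> k x)) x - (\<chi> i. cnj (G x $ i)))) \<longlonglongrightarrow> 0"
  proof (rule L2_sq_squeeze[of _ "\<lambda>k x. grad (\<phi> k) x - G x"])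
    have "grad (\<lambda>x. cnj (\<phi> k x)) x - (\<chi> i. cnj (G x $ i)) = (\<chi> i. cnj ((grad (\<phi> k) x - G x) $ i))" for k x
      by (simp add: vec_eq_iff grad_cnj[OF t])
    then show "norm (grad (\<lambda>x. cnj (\<phi> k x)) x - (\<chi> i. cnj (G x $ i))) \<le> norm (grad (\<phi> k) x - G x)" for k x
      by (simp only: n)
  qed (use assms in \<open>simp add: grad_limit_def\<close>)
qed

lemma test_fun_L2:
  assumes U: "open U" and \<psi>: "test_fun U \<psi>" shows "L2 U \<psi>" and "L2 U (grad \<psi>)"
proof -
  obtain K where K: "compact K" "K \<subseteq> U" and supp: "\<forall>x. x \<notin> K \<longrightarrow> \<psi> x = 0 \<and> grad \<psi> x = 0"
    using test_fun_support[OF \<psi>] by blast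
  have g: "continuous_on U (grad \<psi>)"
  proof -
    have "continuous_on U (\<lambda>x. \<chi> i. grad \<psi> x $ i)"
      by (intro continuous_on_vec_lambda test_fun_grad_cont[OF \<psi>])
    then show ?thesis by simp
  qed
  show "L2 U \<psi>"
    by (intro L2I_integrable borel_measurable_lebesgue_on_cont U integrable_compact_support[OF U K] continuous_intros
        test_fun_cont[OF \<psi>]) (use supp in simp)
  show "L2 U (grad \<psi>)"
    by (intro L2I_integrable borel_measurable_lebesgue_on_cont U integrable_compact_support[OF U K] continuous_intros g)
       (use supp in simp)
qed

section \<open>Ground state representation and spectral gap\<close>

lemma complex_vector_norm_square: "of_real ((norm v)\<^sup>2) = (\<Sum>i\<in>UNIV. v $ i * cnj (v $ i))"
  for v :: "complex^'n"
proof -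
  have "(norm v)\<^sup>2 = (\<Sum>i\<in>UNIV. (norm (v $ i))\<^sup>2)"
    by (simp add: norm_vec_def L2_set_def sum_nonneg)
  then show ?thesis by (simp only: of_real_sum complex_norm_square)
qed

text \<open>
  Jensen's inequality on \<open>[0, 1]\<close>: with \<open>a = \<bar>c 1 - c 0\<bar>\<close>, integrate
  \<open>(\<bar>c'\<bar> - a)\<^sup>2 \<ge> 0\<close> and use that the integral of \<open>\<bar>c'\<bar>\<close> is at least \<open>a\<close>.
\<close>

lemma square_increment_le:
  fixes c :: "real \<Rightarrow> complex"
  assumes der: "\<And>t. t \<in> {0..1} \<Longrightarrow> (c has_vector_derivative c' t) (at t within {0..1})"
    and cont: "continuous_on {0..1} c'"
  shows "ennreal ((norm (c 1 - c 0))\<^sup>2) \<le> (\<integral>\<^sup>+t. indicator {0..1} t * ennreal ((norm (c' t))\<^sup>2) \<partial>lborel)"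
proof -
  let ?a = "norm (c 1 - c 0)"
  have n: "(\<lambda>t. norm (c' t)) integrable_on {0..1}" "(\<lambda>t. (norm (c' t))\<^sup>2) integrable_on {0..1}"
    by (intro integrable_continuous_real continuous_intros cont)+
  have "(c' has_integral (c 1 - c 0)) {0..1}"
    by (rule fundamental_theorem_of_calculus) (use der in auto)
  then have a: "?a \<le> integral {0..1} (\<lambda>t. norm (c' t))"
    using integral_norm_bound_integral[OF _ n(1), of c'] by (auto simp: integral_unique has_integral_integrable)
  have "integral {0..1} (\<lambda>t. 2 * ?a * norm (c' t) - ?a\<^sup>2) \<le> integral {0..1} (\<lambda>t. (norm (c' t))\<^sup>2)"
  proof (rule integral_le[OF _ n(2)])
    show "(\<lambda>t. 2 * ?a * norm (c' t) - ?a\<^sup>2) integrable_on {0..1}"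
      by (intro integrable_continuous_real continuous_intros cont)
    show "2 * ?a * norm (c' t) - ?a\<^sup>2 \<le> (norm (c' t))\<^sup>2" for t
      using zero_le_power2[of "norm (c' t) - ?a"] by (simp add: power2_diff algebra_simps)
  qed
  also have "integral {0..1} (\<lambda>t. 2 * ?a * norm (c' t) - ?a\<^sup>2) = 2 * ?a * integral {0..1} (\<lambda>t. norm (c' t)) - ?a\<^sup>2"
    using n(1) by (subst integral_diff) (auto intro: integrable_on_mult_right)
  finally have le: "?a\<^sup>2 \<le> integral {0..1} (\<lambda>t. (norm (c' t))\<^sup>2)"
    using mult_left_mono[OF a, of "2 * ?a"] by (simp add: power2_eq_square)
  have "((\<lambda>t. indicator {0..1} t *\<^sub>R (norm (c' t))\<^sup>2) has_integral integral {0..1} (\<lambda>t. (norm (c' t))\<^sup>2)) UNIV"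
  proof -
    have "((\<lambda>t. if t \<in> {0..1} then (norm (c' t))\<^sup>2 else 0) has_integral integral {0..1} (\<lambda>t. (norm (c' t))\<^sup>2)) UNIV"
      using integrable_integral[OF n(2)] by (simp only: has_integral_restrict_UNIV)
    moreover have "(\<lambda>t. if t \<in> {0..1} then (norm (c' t))\<^sup>2 else 0) = (\<lambda>t. indicator {0..1} t *\<^sub>R (norm (c' t))\<^sup>2)"
      by (auto simp: indicator_def)
    ultimately show ?thesis by simp
  qed
  moreover have "(\<lambda>t. indicator {0..1} t *\<^sub>R (norm (c' t))\<^sup>2) \<in> borel_measurable borel"
    by (intro borel_measurable_continuous_on_indicator continuous_intros cont) simp
  ultimately have "(\<integral>\<^sup>+t. ennreal (indicator {0..1} t *\<^sub>R (norm (c' t))\<^sup>2) \<partial>lborel) = ennreal (integral {0..1} (\<lambda>t. (norm (c' t))\<^sup>2))"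
    by (intro nn_integral_has_integral_lborel) auto
  moreover have "ennreal (indicator {0..1} t *\<^sub>R (norm (c' t))\<^sup>2) = indicator {0..1} t * ennreal ((norm (c' t))\<^sup>2)" for t :: real
    by (simp add: indicator_def)
  ultimately show ?thesis using le by (simp add: ennreal_leI)
qed

context ground_state
begin

text \<open>
  On \<open>U\<close> this is \<open>u \<nabla>(\<psi> / u)\<close>, which vanishes exactly where \<open>\<psi> / u\<close> is stationary.
\<close>

definition defect :: "(real^'n \<Rightarrow> complex) \<Rightarrow> real^'n \<Rightarrow> complex^'n" where
  "defect \<psi> x = (\<chi> i. grad \<psi> x $ i - \<psi> x / cu x * cdu x $ i)"

abbreviation defect_energy :: "(real^'n \<Rightarrow> complex) \<Rightarrow> real" where
  "defect_energy \<psi> \<equiv> (\<integral>x. W x * (norm (defect \<psi> x))\<^sup>2 \<partial>M)"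

lemma defect_cont:
  assumes "test_fun U \<psi>" shows "continuous_on U (defect \<psi>)"
  unfolding defect_def
  by (intro continuous_on_vec_lambda continuous_intros test_fun_grad_cont[OF assms] test_fun_cont[OF assms]
      u_cont_U continuous_on_cvec du_cont_U continuous_on_component) (use u_pos in force)

lemma defect_integrable:
  assumes \<psi>: "test_fun U \<psi>" and w: "continuous_on U w"
  shows "integrable M (\<lambda>x. w x * (norm (defect \<psi> x))\<^sup>2)"
proof -
  obtain K where K: "compact K" "K \<subseteq> U" and supp: "\<forall>x. x \<notin> K \<longrightarrow> \<psi> x = 0 \<and> grad \<psi> x = 0"
    using test_fun_support[OF \<psi>] by blast
  show ?thesis
  proof (rule integrable_compact_support[OF U_open K])
    show "continuous_on U (\<lambda>x. w x * (norm (defect \<psi> x))\<^sup>2)"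
      by (intro continuous_intros w defect_cont[OF \<psi>])
    fix x assume "x \<in> U - K"
    then have "defect \<psi> x = 0" using supp by (simp add: defect_def vec_eq_iff)
    then show "w x * (norm (defect \<psi> x))\<^sup>2 = 0" by simp
  qed
qed

text \<open>
  Test the equation of \<open>u\<close> with \<open>\<eta> = \<bar>\<psi>\<bar>\<^sup>2 / u\<close>. Pointwise,
  \<open>\<nabla>u \<bullet> \<nabla>\<eta> = \<bar>\<nabla>\<psi>\<bar>\<^sup>2 - \<bar>\<nabla>\<psi> - (\<psi> / u) \<nabla>u\<bar>\<^sup>2\<close>.
\<close>

lemma ground_state_representation:
  assumes \<psi>: "test_fun U \<psi>"
  shows "(\<integral>x. (\<Sum>i\<in>UNIV. of_real (W x) * (grad \<psi> x $ i * cnj (grad \<psi> x $ i))) \<partial>M)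
      - of_real l * (\<integral>x. of_real (W x) * (\<psi> x * cnj (\<psi> x)) \<partial>M)
    = of_real (defect_energy \<psi>)"
proof -
  obtain K where K: "compact K" "K \<subseteq> U" and supp: "\<forall>x. x \<notin> K \<longrightarrow> \<psi> x = 0 \<and> grad \<psi> x = 0"
    using test_fun_support[OF \<psi>] by blast
  let ?\<psi>' = "\<lambda>x. frechet_derivative \<psi> (at x)"
  define \<eta> where "\<eta> x = (\<psi> x * cnj (\<psi> x)) * of_real (inverse (u x))" for x
  define \<eta>' where "\<eta>' x v = (\<psi> x * cnj (\<psi> x)) * of_real (- (inverse (u x) * (du x \<bullet> v) * inverse (u x)))
      + (\<psi> x * cnj (?\<psi>' x v) + ?\<psi>' x v * cnj (\<psi> x)) * of_real (inverse (u x))" for x v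
  have unz: "u x \<noteq> 0" if "x \<in> U" for x using u_pos[OF that] by simp
  have \<eta>'_axis: "\<eta>' x (axis i 1) = (\<psi> x * cnj (\<psi> x)) * of_real (- (inverse (u x) * du x $ i * inverse (u x)))
      + (\<psi> x * cnj (grad \<psi> x $ i) + grad \<psi> x $ i * cnj (\<psi> x)) * of_real (inverse (u x))" for x i
    by (simp add: \<eta>'_def grad_nth inner_axis)
  have weak: "(\<integral>x. (\<Sum>i\<in>UNIV. of_real (W x * du x $ i) * \<eta>' x (axis i 1)) \<partial>M)
    = of_real l * (\<integral>x. of_real (W x * u x) * \<eta> x \<partial>M)"
  proof (rule weak_equation[OF K])
    fix x assume x: "x \<in> U"
    have "((\<lambda>x. inverse (u x)) has_derivative (\<lambda>v. - (inverse (u x) * (du x \<bullet> v) * inverse (u x)))) (at x)"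
      by (rule Deriv.has_derivative_inverse[OF unz[OF x] u_deriv[OF x]])
    from has_derivative_mult[OF has_derivative_mult[OF test_fun_deriv[OF \<psi>]
        bounded_linear.has_derivative[OF bounded_linear_cnj test_fun_deriv[OF \<psi>]]]
        bounded_linear.has_derivative[OF bounded_linear_of_real this]]
    show "(\<eta> has_derivative \<eta>' x) (at x)"
      unfolding \<eta>_def[abs_def] \<eta>'_def[abs_def] .
  next
    show "continuous_on U (\<lambda>x. \<eta>' x (axis i 1))" for i
      unfolding \<eta>'_axis
      by (intro continuous_intros test_fun_cont[OF \<psi>] test_fun_grad_cont[OF \<psi>] u_cont_U du_cont_U) (use unz in auto)
  qed (use supp in \<open>simp add: \<eta>_def\<close>)
  have int1: "integrable M (\<lambda>x. \<Sum>i\<in>UNIV. of_real (W x) * (grad \<psi> x $ i * cnj (grad \<psi> x $ i)))"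
    by (rule integrable_compact_support[OF U_open K])
       (use supp in \<open>auto intro!: continuous_intros W_cont test_fun_grad_cont[OF \<psi>]\<close>)
  have int2: "integrable M (\<lambda>x. W x * (norm (defect \<psi> x))\<^sup>2)"
    by (rule defect_integrable[OF \<psi> W_cont])
  have pointwise: "(\<Sum>i\<in>UNIV. of_real (W x * du x $ i) * \<eta>' x (axis i 1))
      = (\<Sum>i\<in>UNIV. of_real (W x) * (grad \<psi> x $ i * cnj (grad \<psi> x $ i))) - of_real (W x * (norm (defect \<psi> x))\<^sup>2)"
    if x: "x \<in> U" for x
  proof -
    have alg: "w * d * (p * p' * (- (inverse q * d * inverse q)) + (p * a' + a * p') * inverse q)
        = w * (a * a') - w * ((a - p / q * d) * (a' - p' / q * d))"
      if "q \<noteq> 0" for w d p p' a a' q :: complex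
      using that by (simp add: divide_inverse algebra_simps)
    have "of_real (W x * du x $ i) * \<eta>' x (axis i 1)
        = of_real (W x) * (grad \<psi> x $ i * cnj (grad \<psi> x $ i))
          - of_real (W x) * (defect \<psi> x $ i * cnj (defect \<psi> x $ i))" for i
      using alg[of "cu x" "of_real (W x)" "of_real (du x $ i)" "\<psi> x" "cnj (\<psi> x)" "cnj (grad \<psi> x $ i)" "grad \<psi> x $ i"]
        unz[OF x] by (simp add: \<eta>'_axis defect_def)
    then have "(\<Sum>i\<in>UNIV. of_real (W x * du x $ i) * \<eta>' x (axis i 1))
        = (\<Sum>i\<in>UNIV. of_real (W x) * (grad \<psi> x $ i * cnj (grad \<psi> x $ i)))
          - of_real (W x) * (\<Sum>i\<in>UNIV. defect \<psi> x $ i * cnj (defect \<psi> x $ i))"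
      by (simp only: sum_subtractf sum_distrib_left)
    then show ?thesis
      by (simp only: of_real_mult complex_vector_norm_square)
  qed
  have "(\<integral>x. (\<Sum>i\<in>UNIV. of_real (W x * du x $ i) * \<eta>' x (axis i 1)) \<partial>M)
      = (\<integral>x. (\<Sum>i\<in>UNIV. of_real (W x) * (grad \<psi> x $ i * cnj (grad \<psi> x $ i))) - of_real (W x * (norm (defect \<psi> x))\<^sup>2) \<partial>M)"
    by (rule Bochner_Integration.integral_cong[OF refl], rule pointwise) simp
  also have "\<dots> = (\<integral>x. (\<Sum>i\<in>UNIV. of_real (W x) * (grad \<psi> x $ i * cnj (grad \<psi> x $ i))) \<partial>M)
      - of_real (defect_energy \<psi>)"
    using int1 int2 by (subst Bochner_Integration.integral_diff) (auto simp del: of_real_mult of_real_power)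
  moreover have "(\<integral>x. of_real (W x * u x) * \<eta> x \<partial>M) = (\<integral>x. of_real (W x) * (\<psi> x * cnj (\<psi> x)) \<partial>M)"
    by (rule Bochner_Integration.integral_cong[OF refl]) (use unz in \<open>simp add: \<eta>_def\<close>)
  ultimately show ?thesis using weak by (simp add: algebra_simps)
qed

text \<open>
  The norm is convex, so on a segment the radially decreasing \<open>u\<close> is at least its smaller value at the
  two ends; the other factor is at most \<open>1\<close>.
\<close>

lemma u_product_le:
  assumes x: "x \<in> U" and y: "y \<in> U" and t: "t \<in> {0..1}"
  shows "u x * u y \<le> u (x + t *\<^sub>R (y - x))"
proof -
  let ?z = "x + t *\<^sub>R (y - x)"
  have z: "?z = (1 - t) *\<^sub>R x + t *\<^sub>R y" by (simp add: algebra_simps)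
  have "norm ?z \<le> (1 - t) * norm x + t * norm y"
    unfolding z using t by (intro norm_triangle_le) simp
  also have "\<dots> \<le> (1 - t) * max (norm x) (norm y) + t * max (norm x) (norm y)"
    using t by (intro add_mono mult_left_mono) auto
  also have "\<dots> = max (norm x) (norm y)" by (simp add: algebra_simps)
  finally have "norm ?z \<le> norm x \<or> norm ?z \<le> norm y" by auto
  then have "u x \<le> u ?z \<or> u y \<le> u ?z"
    using x y unfolding u_def in_U by (meson f_mono less_imp_le norm_ge_zero)
  moreover have "u x * u y \<le> u x" "u x * u y \<le> u y"
    using u_pos[OF x] u_pos[OF y] u_le_1[OF x] u_le_1[OF y]
    by (auto intro: mult_left_le mult_right_le_one_le mult_left_le_one_le less_imp_le)
  ultimately show ?thesis by linarith
qed

text \<open>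
  The left hand side is \<open>u x u y\<close> times the increment of \<open>\<eta> = \<psi> / u\<close>, squared. Along the segment the
  derivative of \<open>\<eta>\<close> is the defect divided by \<open>u\<close>, and \<open>u_product_le\<close> cancels this
  division against \<open>u x u y\<close>.
\<close>

lemma increment_bound:
  assumes \<psi>: "test_fun U \<psi>" and x: "x \<in> U" and y: "y \<in> U"
  shows "ennreal ((norm (\<psi> x * cu y - \<psi> y * cu x))\<^sup>2)
    \<le> (\<integral>\<^sup>+t. indicator {0..1} t * ennreal ((norm (y - x))\<^sup>2 * (norm (defect \<psi> (x + t *\<^sub>R (y - x))))\<^sup>2) \<partial>lborel)"
proof -
  let ?h = "y - x"
  let ?z = "\<lambda>t. x + t *\<^sub>R ?h"
  have zU: "?z t \<in> U" if "t \<in> {0..1}" for t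
  proof -
    have "?z t = (1 - t) *\<^sub>R x + t *\<^sub>R y" by (simp add: algebra_simps)
    then show ?thesis using convexD_alt[OF U_convex x y, of t] that by (simp add: add.commute)
  qed
  define k where "k t = cu x * cu y * (\<psi> (?z t) * of_real (inverse (u (?z t))))" for t
  define k' where "k' t = cu x * cu y * ((\<Sum>i\<in>UNIV. of_real (?h $ i) * defect \<psi> (?z t) $ i) * of_real (inverse (u (?z t))))" for t
  have line: "(?z has_derivative (\<lambda>s. s *\<^sub>R ?h)) (at t within {0..1})" for t
    by (auto intro!: derivative_eq_intros)
  have der: "(k has_vector_derivative k' t) (at t within {0..1})" if t: "t \<in> {0..1}" for t
  proof -
    let ?p = "frechet_derivative \<psi> (at (?z t))"
    have unz: "u (?z t) \<noteq> 0" using u_pos[OF zU[OF t]] by simp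
    have "((\<lambda>x. \<psi> x * of_real (inverse (u x))) has_derivative
        (\<lambda>v. \<psi> (?z t) * of_real (- (inverse (u (?z t)) * (du (?z t) \<bullet> v) * inverse (u (?z t))))
          + ?p v * of_real (inverse (u (?z t))))) (at (?z t))"
      by (intro has_derivative_mult test_fun_deriv[OF \<psi>] bounded_linear.has_derivative[OF bounded_linear_of_real]
          Deriv.has_derivative_inverse[where f = u and x = "?z t", OF unz] u_deriv zU t)
    from has_derivative_compose[OF line this]
    have d: "((\<lambda>t. \<psi> (?z t) * of_real (inverse (u (?z t)))) has_derivative
        (\<lambda>s. \<psi> (?z t) * of_real (- (inverse (u (?z t)) * (du (?z t) \<bullet> (s *\<^sub>R ?h)) * inverse (u (?z t))))
          + ?p (s *\<^sub>R ?h) * of_real (inverse (u (?z t))))) (at t within {0..1})" .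
    have lin: "linear ?p" by (rule has_derivative_linear[OF test_fun_deriv[OF \<psi>]])
    have p: "?p ?h = (\<Sum>i\<in>UNIV. of_real (?h $ i) * grad \<psi> (?z t) $ i)"
    proof -
      have "?h = (\<Sum>i\<in>UNIV. (?h $ i) *\<^sub>R axis i 1)"
        using basis_expansion[of ?h] by (simp only: scalar_mult_eq_scaleR)
      then have "?p ?h = ?p (\<Sum>i\<in>UNIV. (?h $ i) *\<^sub>R axis i 1)"
        by (rule arg_cong)
      also have "\<dots> = (\<Sum>i\<in>UNIV. (?h $ i) *\<^sub>R ?p (axis i 1))"
        by (simp add: linear_sum[OF lin] linear_cmul[OF lin])
      finally show ?thesis by (simp add: grad_nth scaleR_conv_of_real)
    qed
    have dh: "complex_of_real (du (?z t) \<bullet> ?h) = (\<Sum>i\<in>UNIV. of_real (?h $ i) * cdu (?z t) $ i)"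
      by (simp add: inner_vec_def mult.commute)
    have "\<psi> (?z t) * of_real (- (inverse (u (?z t)) * (du (?z t) \<bullet> ?h) * inverse (u (?z t))))
          + ?p ?h * of_real (inverse (u (?z t)))
        = (?p ?h - \<psi> (?z t) / cu (?z t) * of_real (du (?z t) \<bullet> ?h)) * of_real (inverse (u (?z t)))"
      by (simp add: algebra_simps divide_inverse)
    also have "?p ?h - \<psi> (?z t) / cu (?z t) * of_real (du (?z t) \<bullet> ?h)
        = (\<Sum>i\<in>UNIV. of_real (?h $ i) * defect \<psi> (?z t) $ i)"
      unfolding p dh sum_distrib_left sum_subtractf[symmetric]
      by (intro sum.cong refl) (simp only: defect_def vec_lambda_beta right_diff_distrib mult.left_commute)
    finally have val: "\<psi> (?z t) * of_real (- (inverse (u (?z t)) * (du (?z t) \<bullet> ?h) * inverse (u (?z t))))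
          + ?p ?h * of_real (inverse (u (?z t)))
        = (\<Sum>i\<in>UNIV. of_real (?h $ i) * defect \<psi> (?z t) $ i) * of_real (inverse (u (?z t)))" .
    have "\<psi> (?z t) * of_real (- (inverse (u (?z t)) * (du (?z t) \<bullet> (s *\<^sub>R ?h)) * inverse (u (?z t))))
          + ?p (s *\<^sub>R ?h) * of_real (inverse (u (?z t)))
        = s *\<^sub>R ((\<Sum>i\<in>UNIV. of_real (?h $ i) * defect \<psi> (?z t) $ i) * of_real (inverse (u (?z t))))" for s
    proof -
      have "p * of_real (- (i * (s * d) * i)) + (s *\<^sub>R q) * of_real i
          = s *\<^sub>R (p * of_real (- (i * d * i)) + q * of_real i)" for p q :: complex and d i :: real
        by (simp add: scaleR_conv_of_real algebra_simps)
      then show ?thesis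
        unfolding val[symmetric] linear_cmul[OF lin] inner_scaleR_right .
    qed
    with d have "((\<lambda>t. \<psi> (?z t) * of_real (inverse (u (?z t)))) has_vector_derivative
        (\<Sum>i\<in>UNIV. of_real (?h $ i) * defect \<psi> (?z t) $ i) * of_real (inverse (u (?z t)))) (at t within {0..1})"
      by (simp add: has_vector_derivative_def)
    then show ?thesis
      unfolding k_def[abs_def] k'_def by (rule has_vector_derivative_mult_right)
  qed
  have zc: "continuous_on {0..1} ?z" by (intro continuous_intros)
  have im: "?z ` {0..1} \<subseteq> U" using zU by blast
  have cont: "continuous_on {0..1} k'"
    unfolding k'_def[abs_def]
    by (intro continuous_intros continuous_on_compose2[OF defect_cont[OF \<psi>] zc im]
        continuous_on_compose2[OF u_cont_U zc im]) (use zU u_pos in force)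
  have "\<psi> x * cu y - \<psi> y * cu x = - (k 1 - k 0)"
    using u_pos[OF x] u_pos[OF y] by (simp add: k_def algebra_simps)
  then have "ennreal ((norm (\<psi> x * cu y - \<psi> y * cu x))\<^sup>2) = ennreal ((norm (k 1 - k 0))\<^sup>2)"
    by (simp only: norm_minus_cancel)
  also have "\<dots> \<le> (\<integral>\<^sup>+t. indicator {0..1} t * ennreal ((norm (k' t))\<^sup>2) \<partial>lborel)"
    by (rule square_increment_le[OF der cont])
  also have "\<dots> \<le> (\<integral>\<^sup>+t. indicator {0..1} t * ennreal ((norm ?h)\<^sup>2 * (norm (defect \<psi> (?z t)))\<^sup>2) \<partial>lborel)"
  proof (rule nn_integral_mono)
    fix t :: real
    show "indicator {0..1} t * ennreal ((norm (k' t))\<^sup>2)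
        \<le> indicator {0..1} t * ennreal ((norm ?h)\<^sup>2 * (norm (defect \<psi> (?z t)))\<^sup>2)"
    proof (cases "t \<in> {0..1}")
      case True
      have pos: "0 < u (?z t)" by (rule u_pos[OF zU[OF True]])
      have "norm (\<Sum>i\<in>UNIV. of_real (?h $ i) * defect \<psi> (?z t) $ i) \<le> (\<Sum>i\<in>UNIV. \<bar>?h $ i\<bar> * \<bar>norm (defect \<psi> (?z t) $ i)\<bar>)"
        by (rule order_trans[OF norm_sum]) (simp only: norm_mult norm_of_real abs_norm_cancel order_refl)
      also have "\<dots> \<le> norm ?h * norm (defect \<psi> (?z t))"
        using L2_set_mult_ineq[of "\<lambda>i. ?h $ i" "\<lambda>i. norm (defect \<psi> (?z t) $ i)" UNIV]
        by (simp add: norm_vec_def L2_set_def)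
      finally have s: "norm (\<Sum>i\<in>UNIV. of_real (?h $ i) * defect \<psi> (?z t) $ i) \<le> norm ?h * norm (defect \<psi> (?z t))" .
      have r: "u x * u y * inverse (u (?z t)) \<le> 1"
        using u_product_le[OF x y True] pos by (simp add: divide_inverse[symmetric] divide_le_eq)
      have "norm (k' t) = (u x * u y * inverse (u (?z t))) * norm (\<Sum>i\<in>UNIV. of_real (?h $ i) * defect \<psi> (?z t) $ i)"
        using u_pos[OF x] u_pos[OF y] pos by (simp add: k'_def norm_mult norm_inverse)
      also have "\<dots> \<le> 1 * (norm ?h * norm (defect \<psi> (?z t)))"
        using r s by (intro mult_mono) auto
      finally have "(norm (k' t))\<^sup>2 \<le> (norm ?h * norm (defect \<psi> (?z t)))\<^sup>2"
        by (intro power_mono) auto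
      then show ?thesis by (intro mult_left_mono ennreal_leI) (simp_all add: power_mult_distrib)
    qed simp
  qed
  finally show ?thesis .
qed

text \<open>
  For fixed \<open>h\<close> and \<open>t\<close>, the integral over \<open>x\<close> is that of \<open>\<Phi>\<close>, by translation invariance.
\<close>

lemma nn_integral_segments:
  fixes \<Phi> :: "real^'n \<Rightarrow> ennreal"
  assumes [measurable]: "\<Phi> \<in> borel_measurable borel"
  shows "(\<integral>\<^sup>+x. \<integral>\<^sup>+h. indicator (ball 0 r) h * (c * (\<integral>\<^sup>+t. indicator {0..1} t * \<Phi> (x + t *\<^sub>R h) \<partial>lborel)) \<partial>lborel \<partial>lborel)
    = c * emeasure lborel (ball (0::real^'n) r) * (\<integral>\<^sup>+x. \<Phi> x \<partial>lborel)"
proof -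
  let ?I = "\<integral>\<^sup>+x. \<Phi> x \<partial>lborel"
  have [measurable]: "ball (0::real^'n) r \<in> sets borel" by simp
  have "(\<integral>\<^sup>+x. \<integral>\<^sup>+h. indicator (ball 0 r) h * (c * (\<integral>\<^sup>+t. indicator {0..1} t * \<Phi> (x + t *\<^sub>R h) \<partial>lborel)) \<partial>lborel \<partial>lborel)
    = (\<integral>\<^sup>+h. \<integral>\<^sup>+x. indicator (ball 0 r) h * (c * (\<integral>\<^sup>+t. indicator {0..1} t * \<Phi> (x + t *\<^sub>R h) \<partial>lborel)) \<partial>lborel \<partial>lborel)"
    by (rule lborel_pair.Fubini') measurable
  also have "\<dots> = (\<integral>\<^sup>+h. indicator (ball (0::real^'n) r) h * (c * ?I) \<partial>lborel)"
  proof (rule nn_integral_cong)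
    fix h :: "real^'n"
    have "(\<integral>\<^sup>+x. \<integral>\<^sup>+t. indicator {0..1} t * \<Phi> (x + t *\<^sub>R h) \<partial>lborel \<partial>lborel)
        = (\<integral>\<^sup>+t. \<integral>\<^sup>+x. indicator {0..1} t * \<Phi> (x + t *\<^sub>R h) \<partial>lborel \<partial>lborel)"
      by (rule lborel_pair.Fubini') measurable
    also have "\<dots> = (\<integral>\<^sup>+t. indicator {0..1::real} t * ?I \<partial>lborel)"
      by (rule nn_integral_cong) (simp add: nn_integral_cmult nn_integral_lborel_translate)
    also have "\<dots> = ?I" by (simp add: nn_integral_multc)
    finally show "(\<integral>\<^sup>+x. indicator (ball 0 r) h * (c * (\<integral>\<^sup>+t. indicator {0..1} t * \<Phi> (x + t *\<^sub>R h) \<partial>lborel)) \<partial>lborel)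
        = indicator (ball 0 r) h * (c * ?I)"
      by (simp add: nn_integral_cmult)
  qed
  also have "\<dots> = c * emeasure lborel (ball (0::real^'n) r) * ?I"
    by (subst nn_integral_multc) (simp_all add: mult_ac)
  finally show ?thesis .
qed

lemma cu_L2: "L2 U cu"
  using ground_state_H10 by (simp add: H10_def)

text \<open>
  The left hand side is half the double integral of \<open>\<bar>\<psi> x u y - \<psi> y u x\<bar>\<^sup>2\<close>. Insert the bound along
  segments and integrate over the differences \<open>h = y - x\<close>, which lie in the ball of radius
  \<open>2 R\<close>. The factor \<open>1 / wt R\<close> compares the weighted with the unweighted defect.
\<close>

lemma spectral_gap:
  "\<exists>C. \<forall>\<psi>. test_fun U \<psi> \<longrightarrow>
    (\<integral>x. (norm (\<psi> x))\<^sup>2 \<partial>M) * (\<integral>x. (u x)\<^sup>2 \<partial>M)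
      - (norm (\<integral>x. \<psi> x * cu x \<partial>M))\<^sup>2
    \<le> C * defect_energy \<psi>"
proof (intro exI allI impI)
  let ?V = "emeasure lborel (ball (0::real^'n) (2 * R))"
  let ?v = "measure lborel (ball (0::real^'n) (2 * R))"
  have V: "?V = ennreal ?v"
    using emeasure_bounded_finite[of "ball (0::real^'n) (2 * R)"] by (intro emeasure_eq_ennreal_measure) auto
  let ?C = "(2 * R)\<^sup>2 * ?v / wt R / 2"
  fix \<psi> assume \<psi>: "test_fun U \<psi>"
  obtain K where K: "compact K" "K \<subseteq> U" and supp: "\<forall>x. x \<notin> K \<longrightarrow> \<psi> x = 0 \<and> grad \<psi> x = 0"
    using test_fun_support[OF \<psi>] by blast
  have \<psi>0: "\<psi> x = 0" if "x \<notin> U" for x using supp K that by blast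
  have U_borel [measurable]: "U \<in> sets borel" by simp
  define u0 where "u0 x = indicator U x * u x" for x
  have u0: "u0 x = u x" if "x \<in> U" for x using that by (simp add: u0_def)
  have u0': "u0 x = 0" if "x \<notin> U" for x using that by (simp add: u0_def)
  have [measurable]: "u0 \<in> borel_measurable borel"
    using borel_measurable_continuous_on_indicator[OF U_borel u_cont_U] by (simp add: u0_def[abs_def])
  have [measurable]: "\<psi> \<in> borel_measurable borel"
    by (rule borel_measurable_continuous_onI[OF test_fun_cont[OF \<psi>]])
  define \<Phi> where "\<Phi> x = indicator U x *\<^sub>R (norm (defect \<psi> x))\<^sup>2" for x
  have [measurable]: "\<Phi> \<in> borel_measurable borel"
    unfolding \<Phi>_def[abs_def]
    by (rule borel_measurable_continuous_on_indicator[OF U_borel]) (intro continuous_intros defect_cont[OF \<psi>])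
  let ?D = "\<lambda>x y. (norm (\<psi> x * of_real (u0 y) - \<psi> y * of_real (u0 x)))\<^sup>2"
  let ?J = "\<lambda>x h. \<integral>\<^sup>+t. indicator {0..1} t * ennreal (\<Phi> (x + t *\<^sub>R h)) \<partial>lborel"
  have D: "ennreal (?D x (x + h)) \<le> indicator (ball 0 (2 * R)) h * (ennreal ((2 * R)\<^sup>2) * ?J x h)" for x h
  proof (cases "x \<in> U \<and> x + h \<in> U")
    case True
    then have x: "x \<in> U" "x + h \<in> U" by auto
    have "norm h < 2 * R"
      using norm_triangle_ineq4[of "x + h" x] x by (simp add: in_U)
    have "ennreal (?D x (x + h)) \<le> (\<integral>\<^sup>+t. indicator {0..1} t * ennreal ((norm h)\<^sup>2 * (norm (defect \<psi> (x + t *\<^sub>R h)))\<^sup>2) \<partial>lborel)"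
      using increment_bound[OF \<psi> x] by (simp add: u0 x)
    also have "\<dots> \<le> (\<integral>\<^sup>+t. ennreal ((2 * R)\<^sup>2) * (indicator {0..1} t * ennreal (\<Phi> (x + t *\<^sub>R h))) \<partial>lborel)"
    proof (rule nn_integral_mono)
      fix t :: real
      show "indicator {0..1} t * ennreal ((norm h)\<^sup>2 * (norm (defect \<psi> (x + t *\<^sub>R h)))\<^sup>2)
        \<le> ennreal ((2 * R)\<^sup>2) * (indicator {0..1} t * ennreal (\<Phi> (x + t *\<^sub>R h)))"
      proof (cases "t \<in> {0..1}")
        case t: True
        have "x + t *\<^sub>R h = (1 - t) *\<^sub>R x + t *\<^sub>R (x + h)" by (simp add: algebra_simps)
        then have "x + t *\<^sub>R h \<in> U"
          using convexD_alt[OF U_convex x, of t] t by simp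
        then have "\<Phi> (x + t *\<^sub>R h) = (norm (defect \<psi> (x + t *\<^sub>R h)))\<^sup>2" by (simp add: \<Phi>_def)
        moreover have "(norm h)\<^sup>2 \<le> (2 * R)\<^sup>2"
          using \<open>norm h < 2 * R\<close> by (intro power_mono) auto
        ultimately have "(norm h)\<^sup>2 * (norm (defect \<psi> (x + t *\<^sub>R h)))\<^sup>2 \<le> (2 * R)\<^sup>2 * \<Phi> (x + t *\<^sub>R h)"
          by (simp add: mult_right_mono)
        then show ?thesis
          using t by (simp add: ennreal_leI flip: ennreal_mult')
      qed simp
    qed
    also have "\<dots> = ennreal ((2 * R)\<^sup>2) * ?J x h"
      by (rule nn_integral_cmult) measurable
    finally show ?thesis using \<open>norm h < 2 * R\<close> by simp
  next
    case False
    then have "?D x (x + h) = 0" using \<psi>0 u0' by auto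
    then show ?thesis by simp
  qed
  have "(\<integral>\<^sup>+x. \<integral>\<^sup>+y. ennreal (?D x y) \<partial>lborel \<partial>lborel) = (\<integral>\<^sup>+x. \<integral>\<^sup>+h. ennreal (?D x (h + x)) \<partial>lborel \<partial>lborel)"
    by (intro nn_integral_cong nn_integral_lborel_translate[symmetric]) measurable
  also have "\<dots> \<le> (\<integral>\<^sup>+x. \<integral>\<^sup>+h. indicator (ball 0 (2 * R)) h * (ennreal ((2 * R)\<^sup>2) * ?J x h) \<partial>lborel \<partial>lborel)"
    using D by (intro nn_integral_mono) (simp add: add.commute)
  also have "\<dots> = ennreal ((2 * R)\<^sup>2) * ?V * (\<integral>\<^sup>+x. ennreal (\<Phi> x) \<partial>lborel)"
    by (rule nn_integral_segments) measurable
  also have "(\<integral>\<^sup>+x. ennreal (\<Phi> x) \<partial>lborel) = ennreal (\<integral>x. (norm (defect \<psi> x))\<^sup>2 \<partial>M)"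
  proof -
    have i: "integrable M (\<lambda>x. (norm (defect \<psi> x))\<^sup>2)"
      using defect_integrable[OF \<psi> continuous_on_const[of _ 1]] by simp
    have "integrable lborel \<Phi>" "integral\<^sup>L lborel \<Phi> = (\<integral>x. (norm (defect \<psi> x))\<^sup>2 \<partial>M)"
      using i lebesgue_on_eq_lborel[of U \<Phi> "\<lambda>x. (norm (defect \<psi> x))\<^sup>2"] by (simp_all add: \<Phi>_def)
    then show ?thesis using nn_integral_eq_integral[of lborel \<Phi>] by (simp add: \<Phi>_def)
  qed
  finally have up: "(\<integral>\<^sup>+x. \<integral>\<^sup>+y. ennreal (?D x y) \<partial>lborel \<partial>lborel)
      \<le> ennreal ((2 * R)\<^sup>2 * ?v * (\<integral>x. (norm (defect \<psi> x))\<^sup>2 \<partial>M))"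
    unfolding V by (simp add: ennreal_mult')
  define A where "A = (\<integral>x. (norm (\<psi> x))\<^sup>2 \<partial>lborel)"
  define B where "B = (\<integral>x. (u0 x)\<^sup>2 \<partial>lborel)"
  define C where "C = (\<integral>x. \<psi> x * of_real (u0 x) \<partial>lborel)"
  have \<psi>L: "L2 U \<psi>" by (rule test_fun_L2[OF U_open \<psi>])
  have iA: "integrable lborel (\<lambda>x. (norm (\<psi> x))\<^sup>2)" and A: "A = (\<integral>x. (norm (\<psi> x))\<^sup>2 \<partial>M)"
    using L2_integrable_norm_square[OF \<psi>L]
      lebesgue_on_eq_lborel[of U "\<lambda>x. (norm (\<psi> x))\<^sup>2" "\<lambda>x. (norm (\<psi> x))\<^sup>2"] by (simp_all add: \<psi>0 A_def)
  have iB: "integrable lborel (\<lambda>x. (u0 x)\<^sup>2)" and B: "B = (\<integral>x. (u x)\<^sup>2 \<partial>M)"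
    using L2_integrable_norm_square[OF cu_L2]
      lebesgue_on_eq_lborel[of U "\<lambda>x. (u0 x)\<^sup>2" "\<lambda>x. (u x)\<^sup>2"] by (simp_all add: u0 u0' B_def)
  have iC: "integrable lborel (\<lambda>x. \<psi> x * of_real (u0 x))" and C: "C = (\<integral>x. \<psi> x * cu x \<partial>M)"
    using L2_integrable_mult[OF \<psi>L cu_L2]
      lebesgue_on_eq_lborel[of U "\<lambda>x. \<psi> x * of_real (u0 x)" "\<lambda>x. \<psi> x * cu x"] by (simp_all add: u0 u0' C_def)
  have D_eq: "?D x y = (norm (\<psi> x))\<^sup>2 * (u0 y)\<^sup>2 + (u0 x)\<^sup>2 * (norm (\<psi> y))\<^sup>2
      - 2 * Re (\<psi> x * of_real (u0 x) * cnj (\<psi> y * of_real (u0 y)))" for x y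
  proof -
    have "(norm (p * of_real s - q * of_real r))\<^sup>2 = (norm p)\<^sup>2 * s\<^sup>2 + r\<^sup>2 * (norm q)\<^sup>2
        - 2 * Re (p * of_real r * cnj (q * of_real s))" for p q :: complex and r s :: real
      unfolding cmod_power2 by (simp add: power2_eq_square algebra_simps)
    then show ?thesis .
  qed
  have iy: "integrable lborel (\<lambda>y. ?D x y)"
    and inner: "(\<integral>y. ?D x y \<partial>lborel) = (norm (\<psi> x))\<^sup>2 * B + (u0 x)\<^sup>2 * A - 2 * Re (\<psi> x * of_real (u0 x) * cnj C)" for x
  proof -
    have i3: "integrable lborel (\<lambda>y. \<psi> x * of_real (u0 x) * cnj (\<psi> y * of_real (u0 y)))"
      using iC by (intro integrable_mult_right) (rule integrable_cnj)
    show "integrable lborel (\<lambda>y. ?D x y)"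
      unfolding D_eq
      by (intro Bochner_Integration.integrable_diff Bochner_Integration.integrable_add integrable_mult_right
          iA iB integrable_Re i3)
    have "(\<integral>y. ?D x y \<partial>lborel) = (\<integral>y. (norm (\<psi> x))\<^sup>2 * (u0 y)\<^sup>2 + (u0 x)\<^sup>2 * (norm (\<psi> y))\<^sup>2 \<partial>lborel)
        - (\<integral>y. 2 * Re (\<psi> x * of_real (u0 x) * cnj (\<psi> y * of_real (u0 y))) \<partial>lborel)"
      unfolding D_eq
      by (intro Bochner_Integration.integral_diff Bochner_Integration.integrable_add integrable_mult_right
          iA iB integrable_Re i3)
    also have "(\<integral>y. (norm (\<psi> x))\<^sup>2 * (u0 y)\<^sup>2 + (u0 x)\<^sup>2 * (norm (\<psi> y))\<^sup>2 \<partial>lborel) = (norm (\<psi> x))\<^sup>2 * B + (u0 x)\<^sup>2 * A"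
      using iA iB by (subst Bochner_Integration.integral_add) (auto simp: A_def B_def)
    also have "(\<integral>y. 2 * Re (\<psi> x * of_real (u0 x) * cnj (\<psi> y * of_real (u0 y))) \<partial>lborel)
        = 2 * Re (\<integral>y. \<psi> x * of_real (u0 x) * cnj (\<psi> y * of_real (u0 y)) \<partial>lborel)"
      by (simp only: integral_mult_right_zero integral_Re[OF i3])
    also have "(\<integral>y. \<psi> x * of_real (u0 x) * cnj (\<psi> y * of_real (u0 y)) \<partial>lborel) = \<psi> x * of_real (u0 x) * cnj C"
      by (simp only: integral_mult_right_zero Bochner_Integration.integral_cnj C_def)
    finally show "(\<integral>y. ?D x y \<partial>lborel) = (norm (\<psi> x))\<^sup>2 * B + (u0 x)\<^sup>2 * A - 2 * Re (\<psi> x * of_real (u0 x) * cnj C)" .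
  qed
  let ?G = "\<lambda>x. (norm (\<psi> x))\<^sup>2 * B + (u0 x)\<^sup>2 * A - 2 * Re (\<psi> x * of_real (u0 x) * cnj C)"
  have i3: "integrable lborel (\<lambda>x. \<psi> x * of_real (u0 x) * cnj C)"
    by (intro integrable_mult_left iC)
  have iG: "integrable lborel ?G"
    by (intro Bochner_Integration.integrable_diff Bochner_Integration.integrable_add integrable_mult_left
        integrable_mult_right iA iB integrable_Re i3)
  have G: "(\<integral>x. ?G x \<partial>lborel) = 2 * (A * B - (norm C)\<^sup>2)"
  proof -
    have "(\<integral>x. ?G x \<partial>lborel) = (\<integral>x. (norm (\<psi> x))\<^sup>2 * B + (u0 x)\<^sup>2 * A \<partial>lborel)
        - (\<integral>x. 2 * Re (\<psi> x * of_real (u0 x) * cnj C) \<partial>lborel)"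
      by (intro Bochner_Integration.integral_diff Bochner_Integration.integrable_add integrable_mult_left
        integrable_mult_right iA iB integrable_Re i3)
    also have "(\<integral>x. (norm (\<psi> x))\<^sup>2 * B + (u0 x)\<^sup>2 * A \<partial>lborel) = A * B + B * A"
      using iA iB by (subst Bochner_Integration.integral_add) (auto simp: A_def B_def)
    also have "(\<integral>x. 2 * Re (\<psi> x * of_real (u0 x) * cnj C) \<partial>lborel) = 2 * Re (\<integral>x. \<psi> x * of_real (u0 x) * cnj C \<partial>lborel)"
      by (simp only: integral_mult_right_zero integral_Re[OF i3])
    also have "(\<integral>x. \<psi> x * of_real (u0 x) * cnj C \<partial>lborel) = C * cnj C"
      by (simp only: integral_mult_left_zero C_def)
    also have "Re (C * cnj C) = (norm C)\<^sup>2"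
      by (simp only: complex_norm_square[symmetric] Re_complex_of_real)
    finally show ?thesis by (simp add: algebra_simps)
  qed
  have Gnn: "0 \<le> ?G x" for x
    unfolding inner[symmetric] by (rule Bochner_Integration.integral_nonneg) simp
  have "(\<integral>\<^sup>+x. \<integral>\<^sup>+y. ennreal (?D x y) \<partial>lborel \<partial>lborel) = (\<integral>\<^sup>+x. ennreal (?G x) \<partial>lborel)"
    by (rule nn_integral_cong) (simp only: inner[symmetric], rule nn_integral_eq_integral[OF iy], simp)
  also have "\<dots> = ennreal (2 * (A * B - (norm C)\<^sup>2))"
    using nn_integral_eq_integral[OF iG] Gnn by (simp only: G) auto
  finally have "2 * (A * B - (norm C)\<^sup>2) \<le> (2 * R)\<^sup>2 * ?v * (\<integral>x. (norm (defect \<psi> x))\<^sup>2 \<partial>M)"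
    using up by (simp add: ennreal_le_iff)
  also have "\<dots> \<le> (2 * R)\<^sup>2 * ?v * (defect_energy \<psi> / wt R)"
  proof (intro mult_left_mono)
    have "(\<integral>x. (norm (defect \<psi> x))\<^sup>2 \<partial>M) \<le> (\<integral>x. W x * (norm (defect \<psi> x))\<^sup>2 / wt R \<partial>M)"
    proof (rule integral_mono)
      show "integrable M (\<lambda>x. (norm (defect \<psi> x))\<^sup>2)"
        using defect_integrable[OF \<psi> continuous_on_const[of _ 1]] by simp
      show "integrable M (\<lambda>x. W x * (norm (defect \<psi> x))\<^sup>2 / wt R)"
        by (intro integrable_divide_zero defect_integrable[OF \<psi> W_cont])
      fix x assume "x \<in> space M"
      then have "wt R \<le> W x" unfolding W_def by (intro wt_antimono) (auto simp: in_U)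
      then have "wt R * (norm (defect \<psi> x))\<^sup>2 \<le> W x * (norm (defect \<psi> x))\<^sup>2" by (rule mult_right_mono) simp
      then show "(norm (defect \<psi> x))\<^sup>2 \<le> W x * (norm (defect \<psi> x))\<^sup>2 / wt R"
        by (simp add: pos_le_divide_eq mult.commute)
    qed
    then show "(\<integral>x. (norm (defect \<psi> x))\<^sup>2 \<partial>M) \<le> defect_energy \<psi> / wt R" by simp
  qed auto
  finally have "A * B - (norm C)\<^sup>2 \<le> ?C * defect_energy \<psi>"
    by simp
  then show "(\<integral>x. (norm (\<psi> x))\<^sup>2 \<partial>M) * (\<integral>x. (u x)\<^sup>2 \<partial>M) - (norm (\<integral>x. \<psi> x * cu x \<partial>M))\<^sup>2
    \<le> ?C * defect_energy \<psi>"
    unfolding A B C .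
qed

end

section \<open>The principal eigenvalue\<close>

context ground_state
begin

definition pair :: "(real^'n \<Rightarrow> complex) \<Rightarrow> (real^'n \<Rightarrow> complex) \<Rightarrow> complex" where
  "pair a b = (\<integral>x. of_real (W x) * a x * b x \<partial>M)"

definition grad_pair :: "(real^'n \<Rightarrow> complex^'n) \<Rightarrow> (real^'n \<Rightarrow> complex^'n) \<Rightarrow> complex" where
  "grad_pair G H = (\<integral>x. (\<Sum>i\<in>UNIV. of_real (W x) * G x $ i * H x $ i) \<partial>M)"

lemma L2_W: "L2 U a \<Longrightarrow> L2 U (\<lambda>x. of_real (W x) * a x)" for a :: "real^'n \<Rightarrow> complex"
proof (rule L2_mono)
  assume a: "L2 U a"
  have "(\<lambda>x. complex_of_real (W x)) \<in> borel_measurable M"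
    by (intro borel_measurable_lebesgue_on_cont continuous_on_of_real W_cont U_open)
  then show "(\<lambda>x. of_real (W x) * a x) \<in> borel_measurable M"
    using L2_measurable[OF a] by measurable
  show "norm (of_real (W x) * a x) \<le> norm (a x)" for x
    using W_le_1[of x] less_imp_le[OF W_pos[of x]] by (simp add: norm_mult mult_left_le_one_le)
qed

lemma W_diff_le: "norm (of_real (W x) * a - of_real (W x) * b) \<le> norm (a - b :: complex)"
  using W_le_1[of x] less_imp_le[OF W_pos[of x]]
  by (simp add: norm_mult mult_left_le_one_le flip: right_diff_distrib)

lemma pair_integrable: "L2 U a \<Longrightarrow> L2 U b \<Longrightarrow> integrable M (\<lambda>x. complex_of_real (W x) * a x * b x)"
  by (intro L2_integrable_mult L2_W)

lemma pair_limit: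
  assumes a: "L2 U a" "\<And>k. L2 U (ak k)" "(\<lambda>k. L2_sq U (\<lambda>x. ak k x - a x)) \<longlonglongrightarrow> 0"
    and b: "L2 U b" "\<And>k. L2 U (bk k)" "(\<lambda>k. L2_sq U (\<lambda>x. bk k x - b x)) \<longlonglongrightarrow> 0"
  shows "(\<lambda>k. pair (ak k) (bk k)) \<longlonglongrightarrow> pair a b"
  unfolding pair_def
  by (intro L2_pairing_limit L2_W a b L2_sq_squeeze[OF a(3)] W_diff_le)

lemma grad_pair_eq_sum:
  assumes "L2 U G" "L2 U H"
  shows "grad_pair G H = (\<Sum>i\<in>UNIV. pair (\<lambda>x. G x $ i) (\<lambda>x. H x $ i))"
  unfolding grad_pair_def pair_def
  by (rule Bochner_Integration.integral_sum) (intro pair_integrable L2_component assms)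

lemma L2_sq_const_zero: "(\<lambda>k::nat. L2_sq U (\<lambda>x. a x - a x)) \<longlonglongrightarrow> 0" for a :: "real^'n \<Rightarrow> complex"
  by (simp add: L2_sq_def)

lemma pair_limit_right:
  assumes "L2 U h" "grad_limit U w G \<phi>"
  shows "(\<lambda>k. pair h (\<phi> k)) \<longlonglongrightarrow> pair h w"
  using assms test_fun_L2(1)[OF U_open]
  by (intro pair_limit L2_sq_const_zero) (auto simp: grad_limit_def)

lemma grad_pair_limit:
  assumes "grad_limit U w G \<phi>" "grad_limit U w' G' \<phi>'"
  shows "(\<lambda>k. grad_pair (grad (\<phi> k)) (grad (\<phi>' k))) \<longlonglongrightarrow> grad_pair G G'"
proof -
  have L: "L2 U G" "L2 U G'" "L2 U (grad (\<phi> k))" "L2 U (grad (\<phi>' k))" for k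
    using assms test_fun_L2(2)[OF U_open] by (auto simp: grad_limit_def)
  show ?thesis
    unfolding grad_pair_eq_sum[OF L(1,2)] grad_pair_eq_sum[OF L(3,4)]
    by (intro tendsto_sum pair_limit L2_component L grad_limit_component[OF assms(1)] grad_limit_component[OF assms(2)])
qed

lemma grad_pair_limit_right:
  assumes "L2 U H" "grad_limit U w G \<phi>"
  shows "(\<lambda>k. grad_pair H (grad (\<phi> k))) \<longlonglongrightarrow> grad_pair H G"
proof -
  have L: "L2 U G" "L2 U (grad (\<phi> k))" for k
    using assms test_fun_L2(2)[OF U_open] by (auto simp: grad_limit_def)
  show ?thesis
    unfolding grad_pair_eq_sum[OF assms(1) L(1)] grad_pair_eq_sum[OF assms(1) L(2)]
    by (intro tendsto_sum pair_limit L2_component L assms(1) grad_limit_component[OF assms(2)] L2_sq_const_zero)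
qed

text \<open>
  Both sides of the weighted equation are continuous in the test function with respect to the norm of
  \<open>H\<^sup>1\<close>, so the test function may be replaced by any \<open>w\<close> in \<open>H\<^sup>1\<^sub>0\<close>.
\<close>

lemma weak_solution:
  assumes "dirichlet_sol drift U v h" "L2 U h"
  shows "\<exists>G \<phi>. grad_limit U v G \<phi> \<and>
    (\<forall>w H \<phi>'. grad_limit U w H \<phi>' \<longrightarrow> grad_pair G H = pair h w)"
proof -
  obtain G where H10: "H10 U v G" and eq: "\<And>\<psi>. test_fun U \<psi> \<Longrightarrow>
      (\<integral>x. (\<Sum>i\<in>UNIV. of_real (wt (norm x)) * G x $ i * grad \<psi> x $ i) \<partial>M)
      = (\<integral>x. of_real (wt (norm x)) * h x * \<psi> x \<partial>M)"
    using dirichlet_sol_weighted[OF assms(1)] by blast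
  obtain \<phi> where \<phi>: "grad_limit U v G \<phi>" using H10_grad_limit[OF H10] by blast
  show ?thesis
  proof (intro exI conjI allI impI)
    show "grad_limit U v G \<phi>" by (rule \<phi>)
    fix w H \<phi>' assume w: "grad_limit U w H \<phi>'"
    have "L2 U G" using \<phi> by (simp add: grad_limit_def)
    have "grad_pair G (grad (\<phi>' k)) = pair h (\<phi>' k)" for k
      unfolding grad_pair_def pair_def W_def using w by (intro eq) (simp add: grad_limit_def)
    then show "grad_pair G H = pair h w"
      using LIMSEQ_unique[OF grad_pair_limit_right[OF \<open>L2 U G\<close> w]] pair_limit_right[OF assms(2) w] by simp
  qed
qed

lemma pair_scale: "pair (\<lambda>x. c * a x) b = c * pair a b" "pair a (\<lambda>x. c * b x) = c * pair a b"
proof -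
  have "of_real (W x) * (c * a x) * b x = c * (of_real (W x) * a x * b x)"
    "of_real (W x) * a x * (c * b x) = c * (of_real (W x) * a x * b x)" for x
    by (simp_all only: mult_ac)
  then show "pair (\<lambda>x. c * a x) b = c * pair a b" "pair a (\<lambda>x. c * b x) = c * pair a b"
    by (simp_all only: pair_def integral_mult_right_zero)
qed

lemma pair_commute: "pair a b = pair b a"
  unfolding pair_def by (intro Bochner_Integration.integral_cong) (auto simp: mult_ac)

lemma grad_pair_commute: "grad_pair a b = grad_pair b a"
  unfolding grad_pair_def by (intro Bochner_Integration.integral_cong sum.cong) (auto simp: mult_ac)

lemma pair_add: "L2 U a \<Longrightarrow> L2 U b \<Longrightarrow> L2 U w \<Longrightarrow> pair (\<lambda>x. a x + b x) w = pair a w + pair b w"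
proof -
  assume L: "L2 U a" "L2 U b" "L2 U w"
  have "complex_of_real (W x) * (a x + b x) * w x = of_real (W x) * a x * w x + of_real (W x) * b x * w x" for x
    by (simp add: algebra_simps)
  then show ?thesis
    using pair_integrable[OF L(1,3)] pair_integrable[OF L(2,3)]
    by (simp only: pair_def Bochner_Integration.integral_add)
qed

lemma pair_cnj: "pair a (\<lambda>x. cnj (a x)) = of_real (\<integral>x. W x * (norm (a x))\<^sup>2 \<partial>M)"
proof -
  have "of_real (W x) * a x * cnj (a x) = complex_of_real (W x * (norm (a x))\<^sup>2)" for x
    by (simp only: of_real_mult complex_norm_square mult.assoc)
  then show ?thesis by (simp only: pair_def integral_complex_of_real)
qed

lemma weighted_norm_pos:
  assumes a: "L2 U a" and nz: "\<not> (AE x in M. a x = (0::complex))"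
  shows "0 < (\<integral>x. W x * (norm (a x))\<^sup>2 \<partial>M)"
proof -
  let ?f = "\<lambda>x. W x * (norm (a x))\<^sup>2"
  have nn: "0 \<le> ?f x" for x by (simp add: less_imp_le)
  have "integrable M (\<lambda>x. complex_of_real (?f x))"
  proof -
    have "of_real (W x) * a x * cnj (a x) = complex_of_real (?f x)" for x
      by (simp only: of_real_mult complex_norm_square mult.assoc)
    with pair_integrable[OF a L2_cnj[OF a]] show ?thesis by (simp only:)
  qed
  then have int: "integrable M ?f" by (simp only: complex_of_real_integrable_eq)
  have "integral\<^sup>L M ?f \<noteq> 0"
    using nz integral_nonneg_eq_0_iff_AE[OF int] nn by (auto elim!: eventually_mono)
  moreover have "0 \<le> integral\<^sup>L M ?f" using nn by (intro Bochner_Integration.integral_nonneg) auto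
  ultimately show ?thesis by simp
qed

text \<open>
  Testing the equation of \<open>v\<close> with the conjugate of \<open>v\<close> gives \<open>\<integral>W \<bar>G\<bar>\<^sup>2 = \<mu> \<integral>W \<bar>v\<bar>\<^sup>2\<close>; the ground
  state representation of the approximating test functions converges to the difference of this and
  \<open>l \<integral>W \<bar>v\<bar>\<^sup>2\<close>.
\<close>

lemma eigen_energy:
  assumes "dirichlet_sol drift U v (\<lambda>x. \<mu> * v x)"
  shows "\<exists>G \<phi>. grad_limit U v G \<phi> \<and>
    (\<lambda>k. complex_of_real (defect_energy (\<phi> k))) \<longlonglongrightarrow>
      (\<mu> - of_real l) * of_real (\<integral>x. W x * (norm (v x))\<^sup>2 \<partial>M)"
proof -
  have "L2 U v" using assms by (auto simp: dirichlet_sol_def H10_def)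
  from weak_solution[OF assms L2_scale[OF this]] obtain G \<phi> where \<phi>: "grad_limit U v G \<phi>"
    and eq: "\<And>w H \<phi>'. grad_limit U w H \<phi>' \<Longrightarrow> grad_pair G H = pair (\<lambda>x. \<mu> * v x) w" by blast
  let ?c\<phi> = "\<lambda>k x. cnj (\<phi> k x)"
  note c = grad_limit_cnj[OF \<phi>]
  have t: "test_fun U (\<phi> k)" for k using \<phi> by (simp add: grad_limit_def)
  have rep: "grad_pair (grad (\<phi> k)) (grad (?c\<phi> k)) - of_real l * pair (\<phi> k) (?c\<phi> k)
      = complex_of_real (defect_energy (\<phi> k))" for k
    using ground_state_representation[OF t[of k]]
    by (simp add: grad_pair_def pair_def grad_cnj[OF t] mult.assoc)
  have "(\<lambda>k. pair (\<phi> k) (?c\<phi> k)) \<longlonglongrightarrow> pair v (\<lambda>x. cnj (v x))"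
    using \<phi> c test_fun_L2(1)[OF U_open] by (intro pair_limit) (auto simp: grad_limit_def)
  from tendsto_diff[OF grad_pair_limit[OF \<phi> c] tendsto_mult_left[OF this]]
  have "(\<lambda>k. grad_pair (grad (\<phi> k)) (grad (?c\<phi> k)) - of_real l * pair (\<phi> k) (?c\<phi> k))
      \<longlonglongrightarrow> grad_pair G (\<lambda>x. \<chi> i. cnj (G x $ i)) - of_real l * pair v (\<lambda>x. cnj (v x))" .
  moreover have "grad_pair G (\<lambda>x. \<chi> i. cnj (G x $ i)) - of_real l * pair v (\<lambda>x. cnj (v x))
      = (\<mu> - of_real l) * of_real (\<integral>x. W x * (norm (v x))\<^sup>2 \<partial>M)"
    by (simp only: eq[OF c] pair_scale pair_cnj left_diff_distrib)
  ultimately have "(\<lambda>k. complex_of_real (defect_energy (\<phi> k))) \<longlonglongrightarrow>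
      (\<mu> - of_real l) * of_real (\<integral>x. W x * (norm (v x))\<^sup>2 \<partial>M)"
    by (simp only: rep)
  with \<phi> show ?thesis by blast
qed

lemma eigenvalue_Re_ge:
  assumes "eigenvalue drift U \<mu>" shows "l \<le> Re \<mu>"
proof -
  obtain v where v: "dirichlet_sol drift U v (\<lambda>x. \<mu> * v x)" and nz: "\<not> (AE x in M. v x = 0)"
    using assms by (auto simp: eigenvalue_def eigenfunction_def)
  have "L2 U v" using v by (auto simp: dirichlet_sol_def H10_def)
  let ?N = "\<integral>x. W x * (norm (v x))\<^sup>2 \<partial>M"
  obtain \<phi> G where lim: "(\<lambda>k. complex_of_real (defect_energy (\<phi> k))) \<longlonglongrightarrow>
      (\<mu> - of_real l) * of_real ?N"
    using eigen_energy[OF v] by blast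
  have "(\<lambda>k. \<integral>x. W x * (norm (defect (\<phi> k) x))\<^sup>2 \<partial>M) \<longlonglongrightarrow> (Re \<mu> - l) * ?N"
    using tendsto_Re[OF lim] by simp
  then have "0 \<le> (Re \<mu> - l) * ?N"
    by (rule LIMSEQ_le_const) (auto intro!: exI[of _ 0] Bochner_Integration.integral_nonneg simp: less_imp_le)
  then show ?thesis
    using weighted_norm_pos[OF \<open>L2 U v\<close> nz] by (simp add: zero_le_mult_iff)
qed

text \<open>
  For \<open>\<mu> = l\<close> the defect energies tend to zero. In the limit the spectral gap inequality becomes the
  equality case of the Cauchy-Schwarz inequality for \<open>v\<close> and \<open>u\<close>.
\<close>

lemma eigenspace_spanned:
  assumes v: "dirichlet_sol drift U v (\<lambda>x. of_real l * v x)"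
  shows "\<exists>c. AE x in M. v x = c * cu x"
proof -
  obtain \<phi> G where \<phi>: "grad_limit U v G \<phi>"
    and lim: "(\<lambda>k. complex_of_real (defect_energy (\<phi> k))) \<longlonglongrightarrow>
      (of_real l - of_real l) * of_real (\<integral>x. W x * (norm (v x))\<^sup>2 \<partial>M)"
    using eigen_energy[OF v] by blast
  have d0: "(\<lambda>k. \<integral>x. W x * (norm (defect (\<phi> k) x))\<^sup>2 \<partial>M) \<longlonglongrightarrow> 0"
    using tendsto_Re[OF lim] by simp
  obtain C where C: "\<And>\<psi>. test_fun U \<psi> \<Longrightarrow>
    (\<integral>x. (norm (\<psi> x))\<^sup>2 \<partial>M) * (\<integral>x. (u x)\<^sup>2 \<partial>M) - (norm (\<integral>x. \<psi> x * cu x \<partial>M))\<^sup>2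
    \<le> C * defect_energy \<psi>"
    using spectral_gap by blast
  have vL: "L2 U v" and t: "\<And>k. test_fun U (\<phi> k)" using \<phi> by (auto simp: grad_limit_def)
  have \<phi>L: "L2 U (\<phi> k)" for k by (rule test_fun_L2(1)[OF U_open t])
  define B where "B = (\<integral>x. (u x)\<^sup>2 \<partial>M)"
  define D where "D = (\<integral>x. v x * cu x \<partial>M)"
  define A where "A = (\<integral>x. (norm (v x))\<^sup>2 \<partial>M)"
  have norm_cnj: "complex_of_real (\<integral>x. (norm (a x))\<^sup>2 \<partial>M) = (\<integral>x. a x * cnj (a x) \<partial>M)" for a :: "real^'n \<Rightarrow> complex"
    by (simp only: integral_complex_of_real[symmetric] complex_norm_square)
  have limA: "(\<lambda>k. \<integral>x. (norm (\<phi> k x))\<^sup>2 \<partial>M) \<longlonglongrightarrow> A"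
  proof -
    have "(\<lambda>k. \<integral>x. \<phi> k x * cnj (\<phi> k x) \<partial>M) \<longlonglongrightarrow> (\<integral>x. v x * cnj (v x) \<partial>M)"
      using \<phi> grad_limit_cnj[OF \<phi>] \<phi>L by (intro L2_pairing_limit) (auto simp: grad_limit_def intro: L2_cnj)
    then have "(\<lambda>k. complex_of_real (\<integral>x. (norm (\<phi> k x))\<^sup>2 \<partial>M)) \<longlonglongrightarrow> complex_of_real A"
      by (simp only: A_def norm_cnj)
    then show ?thesis by (simp only: tendsto_of_real_iff)
  qed
  have limD: "(\<lambda>k. \<integral>x. \<phi> k x * cu x \<partial>M) \<longlonglongrightarrow> D"
    unfolding D_def using \<phi> \<phi>L by (intro L2_pairing_limit cu_L2 L2_sq_const_zero) (auto simp: grad_limit_def)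
  have "A * B - (norm D)\<^sup>2 \<le> C * 0"
  proof (rule LIMSEQ_le)
    show "(\<lambda>k. (\<integral>x. (norm (\<phi> k x))\<^sup>2 \<partial>M) * B - (norm (\<integral>x. \<phi> k x * cu x \<partial>M))\<^sup>2) \<longlonglongrightarrow> A * B - (norm D)\<^sup>2"
      by (intro tendsto_intros limA limD)
    show "(\<lambda>k. C * defect_energy (\<phi> k)) \<longlonglongrightarrow> C * 0"
      by (intro tendsto_intros d0)
    show "\<exists>N. \<forall>k\<ge>N. (\<integral>x. (norm (\<phi> k x))\<^sup>2 \<partial>M) * B - (norm (\<integral>x. \<phi> k x * cu x \<partial>M))\<^sup>2
        \<le> C * defect_energy (\<phi> k)"
      using C[OF t] by (simp add: B_def)
  qed
  then have gap: "A * B \<le> (norm D)\<^sup>2" by simp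
  have "L2 U cu" by (rule cu_L2)
  have iB: "integrable M (\<lambda>x. (u x)\<^sup>2)" using L2_integrable_norm_square[OF cu_L2] by simp
  have "B \<noteq> 0"
  proof
    assume "B = 0"
    then have "AE x in M. (u x)\<^sup>2 = 0"
      unfolding B_def by (subst (asm) integral_nonneg_eq_0_iff_AE[OF iB]) auto
    then show False using ground_state_not_AE_zero by (simp add: power2_eq_iff)
  qed
  moreover have "0 \<le> B" unfolding B_def by (intro Bochner_Integration.integral_nonneg) simp
  ultimately have B: "0 < B" by simp
  \<comment> \<open>The orthogonal projection of \<open>v\<close> onto the line spanned by \<open>u\<close>.\<close>
  let ?c = "D / of_real B"
  let ?d = "\<lambda>x. v x - ?c * cu x"
  have dL: "L2 U ?d" by (intro L2_diff vL L2_scale cu_L2)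
  have "(\<integral>x. (norm (?d x))\<^sup>2 \<partial>M) = A - (norm D)\<^sup>2 / B"
  proof -
    have e: "(norm (?d x))\<^sup>2 = (norm (v x))\<^sup>2 + (norm ?c)\<^sup>2 * (u x)\<^sup>2 - 2 * Re (cnj ?c * (v x * cu x))" for x
    proof -
      have "(norm (p - c * of_real r))\<^sup>2 = (norm p)\<^sup>2 + (norm c)\<^sup>2 * r\<^sup>2 - 2 * Re (cnj c * (p * of_real r))"
        for p c :: complex and r :: real
        unfolding cmod_power2 by (simp add: power2_eq_square algebra_simps)
      then show ?thesis .
    qed
    have i1: "integrable M (\<lambda>x. (norm (v x))\<^sup>2)" by (rule L2_integrable_norm_square[OF vL])
    have i2: "integrable M (\<lambda>x. cnj ?c * (v x * cu x))" by (intro integrable_mult_right L2_integrable_mult vL cu_L2)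
    have "(\<integral>x. (norm (?d x))\<^sup>2 \<partial>M) = (\<integral>x. (norm (v x))\<^sup>2 + (norm ?c)\<^sup>2 * (u x)\<^sup>2 \<partial>M)
        - (\<integral>x. 2 * Re (cnj ?c * (v x * cu x)) \<partial>M)"
      unfolding e by (intro Bochner_Integration.integral_diff Bochner_Integration.integrable_add integrable_mult_right
        integrable_Re i1 i2 iB)
    also have "(\<integral>x. (norm (v x))\<^sup>2 + (norm ?c)\<^sup>2 * (u x)\<^sup>2 \<partial>M) = A + (norm ?c)\<^sup>2 * B"
      using i1 iB by (subst Bochner_Integration.integral_add) (auto simp: A_def B_def)
    also have "(\<integral>x. 2 * Re (cnj ?c * (v x * cu x)) \<partial>M) = 2 * Re (\<integral>x. cnj ?c * (v x * cu x) \<partial>M)"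
      by (simp only: integral_mult_right_zero integral_Re[OF i2])
    also have "(\<integral>x. cnj ?c * (v x * cu x) \<partial>M) = cnj ?c * D"
      by (simp only: integral_mult_right_zero D_def[symmetric])
    also have "cnj ?c * D = of_real ((norm D)\<^sup>2 / B)"
      by (simp only: of_real_divide complex_norm_square) (simp add: mult.commute)
    also have "(norm ?c)\<^sup>2 * B = (norm D)\<^sup>2 / B"
      using B by (simp add: norm_divide power_divide power2_eq_square)
    finally show ?thesis by (simp only: Re_complex_of_real)
  qed
  also have "\<dots> \<le> 0" using gap B by (simp add: pos_le_divide_eq)
  finally have le0: "(\<integral>x. (norm (?d x))\<^sup>2 \<partial>M) \<le> 0" .
  have "0 \<le> (\<integral>x. (norm (?d x))\<^sup>2 \<partial>M)" by (intro Bochner_Integration.integral_nonneg) simp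
  with le0 have "(\<integral>x. (norm (?d x))\<^sup>2 \<partial>M) = 0" by linarith
  then have "AE x in M. (norm (?d x))\<^sup>2 = 0"
    by (subst (asm) integral_nonneg_eq_0_iff_AE[OF L2_integrable_norm_square[OF dL]]) auto
  then show ?thesis by (intro exI[of _ ?c]) (auto elim!: eventually_mono)
qed

lemma ground_state_eigenfunction: "eigenfunction drift U (of_real l) cu"
  using ground_state_dirichlet_sol ground_state_not_AE_zero by (simp add: eigenfunction_def)

lemma dirichlet_sol_cong_AE:
  assumes "dirichlet_sol b U w h" "AE x in M. h x = h' x"
    "h \<in> borel_measurable M" "h' \<in> borel_measurable M"
  shows "dirichlet_sol b U w h'"
proof -
  have "(\<integral>x. h x * \<psi> x \<partial>M) = (\<integral>x. h' x * \<psi> x \<partial>M)" if "test_fun U \<psi>" for \<psi>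
  proof (rule integral_cong_AE)
    have "\<psi> \<in> borel_measurable M" by (rule L2_measurable[OF test_fun_L2(1)[OF U_open that]])
    then show "(\<lambda>x. h x * \<psi> x) \<in> borel_measurable M" "(\<lambda>x. h' x * \<psi> x) \<in> borel_measurable M"
      using assms(3,4) by measurable
  qed (use assms(2) in \<open>auto elim!: eventually_mono\<close>)
  note eq = this
  show ?thesis
    using assms(1) by (simp only: dirichlet_sol_def eq cong: imp_cong)
qed

theorem principal_eigenvalue_ground_state: "principal_eigenvalue drift U l"
  unfolding principal_eigenvalue_def
proof (intro conjI allI impI)
  show "l \<le> Re \<mu>" if "eigenvalue drift U \<mu>" for \<mu>
    by (rule eigenvalue_Re_ge[OF that])
  show "\<exists>\<phi>. (\<forall>x\<in>U. 0 < \<phi> x) \<and> eigenfunction drift U (of_real l) (\<lambda>x. of_real (\<phi> x))"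
    using u_pos ground_state_eigenfunction by blast
  show "simple_eigenvalue drift U (of_real l)"
    unfolding simple_eigenvalue_def
  proof (intro exI[of _ cu] conjI allI impI ground_state_eigenfunction)
    fix v w :: "real^'n \<Rightarrow> complex"
    assume asm: "dirichlet_sol drift U v (\<lambda>x. of_real l * v x) \<and> dirichlet_sol drift U w (\<lambda>x. of_real l * w x + v x)"
    then have v: "dirichlet_sol drift U v (\<lambda>x. of_real l * v x)"
      and w: "dirichlet_sol drift U w (\<lambda>x. of_real l * w x + v x)" by auto
    have vL: "L2 U v" and wL: "L2 U w" using v w by (auto simp: dirichlet_sol_def H10_def)
    have hL: "L2 U (\<lambda>x. of_real l * w x + v x)" by (intro L2_add L2_scale vL wL)
    obtain c where c: "AE x in M. v x = c * cu x"
      using eigenspace_spanned[OF v] by blast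
    obtain G \<phi> where G: "grad_limit U w G \<phi>"
      and eqw: "\<And>a H \<phi>'. grad_limit U a H \<phi>' \<Longrightarrow> grad_pair G H = pair (\<lambda>x. of_real l * w x + v x) a"
      using weak_solution[OF w hL] by blast
    obtain H \<phi>' where H: "grad_limit U cu H \<phi>'"
      and equ: "\<And>a H' \<phi>''. grad_limit U a H' \<phi>'' \<Longrightarrow> grad_pair H H' = pair (\<lambda>x. of_real l * cu x) a"
      using weak_solution[OF ground_state_dirichlet_sol L2_scale[OF cu_L2]] by blast
    \<comment> \<open>Test the equation of \<open>w\<close> with \<open>u\<close> and that of \<open>u\<close> with \<open>w\<close>: the gradient terms agree, and so \<open>v\<close>
        is orthogonal to \<open>u\<close> in \<open>L\<^sup>2(W dx)\<close>.\<close>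
    have "pair (\<lambda>x. of_real l * w x + v x) cu = pair (\<lambda>x. of_real l * cu x) w"
      using eqw[OF H] equ[OF G] grad_pair_commute by metis
    then have "pair v cu = 0"
      using pair_add[OF L2_scale[OF wL] vL cu_L2] by (simp add: pair_scale pair_commute[of cu w])
    moreover have "pair v cu = c * pair cu cu"
    proof -
      have "pair v cu = pair (\<lambda>x. c * cu x) cu"
        unfolding pair_def
      proof (rule integral_cong_AE)
        show "(\<lambda>x. of_real (W x) * v x * cu x) \<in> borel_measurable M"
          "(\<lambda>x. of_real (W x) * (c * cu x) * cu x) \<in> borel_measurable M"
          using pair_integrable[OF vL cu_L2] pair_integrable[OF L2_scale[OF cu_L2] cu_L2] by auto
      qed (use c in \<open>auto elim!: eventually_mono\<close>)
      then show ?thesis by (simp only: pair_scale)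
    qed
    moreover have "pair cu cu \<noteq> 0"
      using pair_cnj[of cu] weighted_norm_pos[OF cu_L2 ground_state_not_AE_zero] by simp
    ultimately have "c = 0" by simp
    then have "AE x in M. of_real l * w x + v x = of_real l * w x"
      using c by (auto elim!: eventually_mono)
    then have "dirichlet_sol drift U w (\<lambda>x. of_real l * w x)"
      using w L2_measurable[OF hL] L2_measurable[OF L2_scale[OF wL, of "of_real l"]]
      by (intro dirichlet_sol_cong_AE[OF w])
    then show "\<exists>c. AE x in M. w x = c * cu x"
      by (rule eigenspace_spanned)
  qed
qed

end

section \<open>Decay of the principal eigenvalue\<close>

lemma principal_eigenvalue_ball:
  fixes R :: real
  assumes R: "1 \<le> R"
  shows "\<exists>l>0. l \<le> eigenvalue_bound CARD('n::finite) R \<and>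
    principal_eigenvalue (drift :: real^'n \<Rightarrow> real^'n) (ball 0 R) l"
proof -
  let ?n = "CARD('n)"
  have n: "1 \<le> ?n" by (simp add: Suc_leI)
  obtain l where ev: "0 < l" "l \<le> eigenvalue_bound ?n R" "sol ?n l R = 0"
    "\<And>r. 0 \<le> r \<Longrightarrow> r < R \<Longrightarrow> 0 < sol ?n l r"
    "\<And>r. r \<in> {0..R} \<Longrightarrow> 0 \<le> sol ?n l r"
    using radial_eigenvalue_exists[OF n R] by blast
  have l0: "0 \<le> l" using ev(1) by simp
  interpret ground_state R l "sol ?n l" "avg ?n (sol ?n l)" "ball 0 R :: (real^'n) set"
  proof
    show "continuous_on {0..R} (sol ?n l)" by (rule sol_cont[OF l0])
    then show "continuous_on {0..R} (avg ?n (sol ?n l))" by (rule avg_cont)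
    show "sol ?n l s \<le> sol ?n l r" if "0 \<le> r" "r \<le> s" "s \<le> R" for r s
      by (rule sol_decreasing[OF l0 ev(5) that])
    show "(sol ?n l has_real_derivative - l * r / wt r * avg ?n (sol ?n l) r) (at r)" if "0 < r" "r < R" for r
      by (rule sol_deriv[OF l0 that])
    show "(avg ?n (sol ?n l) has_real_derivative (wt r * sol ?n l r - real ?n * avg ?n (sol ?n l) r) / r) (at r)"
      if "0 < r" "r < R" for r
      by (rule avg_deriv[OF n sol_cont[OF l0] that])
    show "real ?n * avg ?n (sol ?n l) 0 = wt 0 * sol ?n l 0" by (rule avg_at_0[OF n])
  qed (use R ev sol_at_0[OF l0] in auto)
  show ?thesis using ev(1,2) principal_eigenvalue_ground_state by blast
qed

text \<open>The powers of \<open>R\<close> are absorbed by half of the exponential decay.\<close>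

lemma eigenvalue_bound_decay:
  "\<exists>C>0. \<forall>R\<ge>1. eigenvalue_bound m R \<le> C * R powr (-2) * exp (- (1/4) * R)"
proof (intro exI conjI allI impI)
  let ?C = "2 * real m / (wt (1/2) * (1/2) ^ m) * (fact m * 4 ^ m) + 1"
  have c: "0 \<le> 2 * real m / (wt (1/2) * (1/2) ^ m)"
    by (intro divide_nonneg_nonneg mult_nonneg_nonneg less_imp_le[OF wt_pos]) auto
  show "0 < ?C" using c by (intro add_nonneg_pos mult_nonneg_nonneg) auto
  fix R :: real assume R: "1 \<le> R"
  have "R ^ m = (R / 4) ^ m * 4 ^ m"
    by (simp add: power_divide)
  also have "\<dots> \<le> (fact m * exp (R / 4)) * 4 ^ m"
    using R by (intro mult_right_mono power_le_fact_exp) auto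
  finally have Rm: "R ^ m \<le> fact m * 4 ^ m * exp (R / 4)"
    by (simp only: mult_ac)
  have e: "exp (R / 2) = exp (R / 4) * exp (R / 4)"
    by (simp flip: exp_add)
  have "eigenvalue_bound m R = 2 * real m / (wt (1/2) * (1/2) ^ m) * (R ^ m / (R\<^sup>2 * exp (R / 2)))"
    by (simp add: eigenvalue_bound_def)
  also have "\<dots> \<le> 2 * real m / (wt (1/2) * (1/2) ^ m) * ((fact m * 4 ^ m * exp (R / 4)) / (R\<^sup>2 * exp (R / 2)))"
    using Rm R c by (intro mult_left_mono divide_right_mono) auto
  also have "\<dots> = 2 * real m / (wt (1/2) * (1/2) ^ m) * (fact m * 4 ^ m) * (1 / (R\<^sup>2 * exp (R / 4)))"
    using R unfolding e by simp
  also have "\<dots> \<le> ?C * (1 / (R\<^sup>2 * exp (R / 4)))"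
    using R by (intro mult_right_mono) auto
  also have "1 / (R\<^sup>2 * exp (R / 4)) = R powr (-2) * exp (- (1/4) * R)"
  proof -
    have "R powr (-2) = 1 / R\<^sup>2"
      using R by (simp add: powr_minus inverse_eq_divide)
    moreover have "exp (- (1/4) * R) = 1 / exp (R / 4)"
      by (simp add: exp_minus inverse_eq_divide)
    ultimately show ?thesis by simp
  qed
  finally show "eigenvalue_bound m R \<le> ?C * R powr (-2) * exp (- (1/4) * R)"
    by (simp only: mult.assoc)
qed

lemma Linf_norm_drift_le: "open U \<Longrightarrow> Linf_norm U drift \<le> 1"
  unfolding Linf_norm_def
proof (rule esssup_I)
  assume "open U"
  then show "(\<lambda>x. ereal (norm (drift x))) \<in> borel_measurable (lebesgue_on U)"
    by (intro borel_measurable_ereal borel_measurable_lebesgue_on_cont continuous_on_norm)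
       (use smooth_drift[unfolded smooth_def, rule_format, of 0] in \<open>auto intro: continuous_on_subset\<close>)
qed (use norm_drift_le in auto)

text \<open>
  On the part \<open>\<bar>x\<bar> > 1/2\<close> of the ball, which has positive measure as \<open>R \<ge> 1\<close>, the drift has length
  \<open>\<bar>x\<bar> / sqrt (1 + \<bar>x\<bar>\<^sup>2) \<ge> 1/4\<close>.
\<close>

lemma Linf_norm_drift_ge:
  assumes R: "1 \<le> R" shows "ereal (1/4) \<le> Linf_norm (ball (0::real^'n) R) drift"
proof (rule ccontr)
  let ?U = "ball (0::real^'n) R"
  assume "\<not> ereal (1/4) \<le> Linf_norm ?U drift"
  then have less: "Linf_norm ?U drift < ereal (1/4)" by simp
  have "AE x in lebesgue_on ?U. ereal (norm (drift x)) \<le> Linf_norm ?U drift"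
    unfolding Linf_norm_def by (rule esssup_AE)
  then have ae: "AE x in lebesgue_on ?U. norm (drift x) < 1/4"
    by eventually_elim (use less in \<open>metis ereal_less_eq(3) le_less_trans less_ereal.simps(1)\<close>)
  let ?S = "{x \<in> ?U. 1/2 < norm x}"
  have "?S = ?U \<inter> {x. 1/2 < norm x}" by auto
  then have "open ?S" by (auto intro!: open_Int open_Collect_less continuous_intros)
  have big: "1/4 \<le> norm (drift x)" if "x \<in> ?S" for x :: "real^'n"
  proof -
    have x: "1/2 < norm x" using that by simp
    have "sqrt (1 + (norm x)\<^sup>2) \<le> 4 * norm x"
    proof (rule real_le_lsqrt)
      have "(1/2) * (1/2) \<le> norm x * norm x" using x by (intro mult_mono) auto
      then show "1 + (norm x)\<^sup>2 \<le> (4 * norm x)\<^sup>2" by (simp add: power2_eq_square)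
    qed auto
    moreover have "0 < sqrt (1 + (norm x)\<^sup>2)" by (simp add: add_pos_nonneg)
    ultimately show ?thesis by (simp add: norm_drift pos_le_divide_eq)
  qed
  have "AE x in lebesgue_on ?U. x \<notin> ?S"
    using ae by eventually_elim (use big in force)
  moreover have "?S \<in> sets (lebesgue_on ?U)"
    using \<open>open ?S\<close> by (intro sets_restrict_space_iff[THEN iffD2]) auto
  ultimately have "?S \<in> null_sets (lebesgue_on ?U)"
    by (simp add: AE_iff_null_sets)
  then have "negligible ?S"
    by (subst (asm) null_sets_restrict_space) (auto simp: negligible_iff_null_sets)
  moreover have "(3/4) *\<^sub>R axis undefined 1 \<in> ?S"
    using R by (simp add: norm_axis_1)
  ultimately show False using open_not_negligible[OF \<open>open ?S\<close>] by blast
qed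

theorem proposition2p7:
  assumes "2 \<le> CARD('n::finite)"
  shows "\<exists>C C0 C1 C2 :: real. 0 < C \<and> 0 < C0 \<and> 0 < C1 \<and> 0 < C2 \<and>
    (\<exists>b :: real^'n \<Rightarrow> real^'n. smooth b \<and> Linf_norm UNIV b < \<infinity> \<and>
      (\<forall>R\<ge>1. let M0 = real_of_ereal (Linf_norm (ball 0 R) b) in
         0 \<le> lambda1_space b \<and>
         lambda1_space b \<le> ereal (lambda1 b (ball 0 R)) \<and>
         lambda1 b (ball 0 R) \<le> C * R powr (-2) * exp (- C0 * M0 * R) \<and>
         C1 \<le> M0 \<and> M0 \<le> C2))"
proof -
  let ?b = "drift :: real^'n \<Rightarrow> real^'n"
  let ?l = "\<lambda>R. lambda1 ?b (ball 0 R)"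
  obtain C where C: "0 < C"
    "\<And>R. 1 \<le> R \<Longrightarrow> eigenvalue_bound CARD('n) R \<le> C * R powr (-2) * exp (- (1/4) * R)"
    using eigenvalue_bound_decay by blast
  have l: "0 < ?l R" "?l R \<le> C * R powr (-2) * exp (- (1/4) * R)" if R: "1 \<le> R" for R
  proof -
    obtain l where "0 < l" "l \<le> eigenvalue_bound CARD('n) R" "principal_eigenvalue ?b (ball 0 R) l"
      using principal_eigenvalue_ball[OF R] by blast
    then show "0 < ?l R" "?l R \<le> C * R powr (-2) * exp (- (1/4) * R)"
      using C(2)[OF R] by (auto simp: lambda1_eqI)
  qed
  have "(?l \<longlongrightarrow> 0) at_top"
  proof (rule tendsto_sandwich[OF _ _ tendsto_const])
    show "\<forall>\<^sub>F R in at_top. 0 \<le> ?l R"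
      using eventually_ge_at_top[of 1] by eventually_elim (use l(1) in \<open>auto intro: less_imp_le\<close>)
    show "\<forall>\<^sub>F R in at_top. ?l R \<le> C * R powr (-2)"
      using eventually_ge_at_top[of 1]
    proof eventually_elim
      case (elim R)
      have "C * R powr (-2) * exp (- (1/4) * R) \<le> C * R powr (-2)"
        using C(1) elim by (intro mult_left_le) auto
      then show ?case using l(2)[OF elim] by linarith
    qed
    show "((\<lambda>R. C * R powr (-2)) \<longlongrightarrow> 0) at_top"
      by (intro tendsto_mult_right_zero tendsto_neg_powr filterlim_ident) simp
  qed
  then have "((\<lambda>R. ereal (?l R)) \<longlongrightarrow> ereal 0) at_top" by (rule tendsto_ereal)
  then have space: "lambda1_space ?b = 0"
    unfolding lambda1_space_def by (simp add: tendsto_Lim zero_ereal_def)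
  have main: "let M0 = real_of_ereal (Linf_norm (ball 0 R) ?b) in
         0 \<le> lambda1_space ?b \<and> lambda1_space ?b \<le> ereal (?l R) \<and>
         ?l R \<le> C * R powr (-2) * exp (- (1/4) * M0 * R) \<and> 1/4 \<le> M0 \<and> M0 \<le> 1" if R: "1 \<le> R" for R
  proof -
    have up: "Linf_norm (ball 0 R) ?b \<le> 1" by (rule Linf_norm_drift_le) simp
    have lo: "ereal (1/4) \<le> Linf_norm (ball 0 R) ?b" by (rule Linf_norm_drift_ge[OF R])
    obtain M where M: "Linf_norm (ball 0 R) ?b = ereal M"
      using up lo by (cases "Linf_norm (ball 0 R) ?b") auto
    have M': "1/4 \<le> M" "M \<le> 1" using up lo by (simp_all add: M one_ereal_def)
    \<comment> \<open>The drift is at most \<open>1\<close>, so the norm \<open>M\<close> may be inserted into the exponent.\<close>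
    have "- (1/4) * R \<le> - (1/4) * M * R" using M'(2) R by simp
    then have "C * R powr (-2) * exp (- (1/4) * R) \<le> C * R powr (-2) * exp (- (1/4) * M * R)"
      using C(1) by (intro mult_left_mono) auto
    then show ?thesis
      using l[OF R] M' by (simp add: M space Let_def less_imp_le)
  qed
  have "Linf_norm UNIV ?b \<le> 1" by (rule Linf_norm_drift_le) simp
  then have "Linf_norm UNIV ?b < \<infinity>" by (rule le_less_trans) simp
  then show ?thesis
    using C(1) smooth_drift main
    by (intro exI[of _ C] exI[of _ "1/4"] exI[of _ "1/4"] exI[of _ 1] conjI exI[of _ ?b] allI impI) auto
qed

end
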